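(* Let $E \subset \mathbb{C}$ be a compact set with $\mathrm{cap}(E) > 0$, and let $\mu_E$ be its equilibrium measure. Let $C_E$ denote the best (smallest) constant $C$ such that $\|q\|_E \le C^n \|p\|_E$ for every $n \ge 1$, every monic polynomial $p$ of degree $n$ with complex coefficients, and every monic factor $q$ of $p$. Then $$C_E = \frac{\displaystyle\max_{u \in \partial E} \exp\left( \int_{|z-u| \ge 1} \log |z-u| \, d\mu_E(z)\right)}{\mathrm{cap}(E)}.$$ Furthermore, if $E$ is regular, then $$C_E = \max_{u \in \partial E} \exp\left( -\int_{|z-u| \le 1} \log |z-u| \, d\mu_E(z)\right).$$
   Context: For a compact set $E \subset \mathbb{C}$, $\|f\|_E := \sup_{z\in E} |f(z)|$. A monic factor of a monic polynomial $p \in \mathbb{C}[z]$ is a monic polynomial $q$ such that $p = q r$ for some monic polynomial $r$. $\mathrm{cap}(E)$ is the logarithmic capacity of $E$. That is, $\mathrm{cap}(E) = \exp\left(\sup_\mu \iint \log|z-t|\, d\mu(z)\, d\mu(t)\right)$, where $\mu$ ranges over Borel probability measures supported on $E$. When $\mathrm{cap}(E)>0$, the equilibrium measure $\mu_E$ is the unique Borel probability measure supported on $E$ attaining this supremum. The set $E$ is called regular if it is regular in the sense of the exterior Dirichlet problem, i.e. every boundary point of $\Omega$, the unbounded component of $\overline{\mathbb{C}} \setminus E$, is a regular point for the Dirichlet problem in $\Omega$. $\partial E$ denotes the boundary of $E$. *)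

theory Defs
  imports "HOL-Probability.Probability" "HOL-Computational_Algebra.Polynomial"
begin

section \<open>Sup norms and the best constant for monic factors\<close>

definition sup_norm_on :: "complex set \<Rightarrow> (complex \<Rightarrow> complex) \<Rightarrow> real" where
  "sup_norm_on E f = (SUP z\<in>E. cmod (f z))"

definition monic :: "complex poly \<Rightarrow> bool" where
  "monic p \<longleftrightarrow> lead_coeff p = 1"

definition monic_factor :: "complex poly \<Rightarrow> complex poly \<Rightarrow> bool" where
  "monic_factor q p \<longleftrightarrow> monic q \<and> (\<exists>r. monic r \<and> p = q * r)"

definition factor_constant :: "complex set \<Rightarrow> real \<Rightarrow> bool" where
  "factor_constant E C \<longleftrightarrow>
     (\<forall>n\<ge>1. \<forall>p q. monic p \<and> degree p = n \<and> monic_factor q p \<longrightarrow>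
        sup_norm_on E (poly q) \<le> C ^ n * sup_norm_on E (poly p))"

definition best_factor_constant :: "complex set \<Rightarrow> real" where
  "best_factor_constant E = (LEAST C. factor_constant E C)"


section \<open>Logarithmic energy, capacity and equilibrium measure\<close>

text \<open>
  The integral of an extended-real function as positive part minus negative part
  (\<^const>\<open>e2ennreal\<close> sends negative values to 0). It is meaningful when the function is
  measurable and one of the two parts is finite. In all uses below the function is
  bounded above almost everywhere on a probability space, so the value lies in
  \<open>[-\<infinity>, \<infinity>)\<close>.
\<close>

definition ext_integral :: "'a measure \<Rightarrow> ('a \<Rightarrow> ereal) \<Rightarrow> ereal" where
  "ext_integral M f =
     enn2ereal (\<integral>\<^sup>+x. e2ennreal (f x) \<partial>M) - enn2ereal (\<integral>\<^sup>+x. e2ennreal (- f x) \<partial>M)"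

text \<open>The library has \<open>ln 0 = 0\<close>; the logarithmic kernel needs \<open>-\<infinity>\<close> on the diagonal.\<close>

definition log_kernel :: "complex \<Rightarrow> complex \<Rightarrow> ereal" where
  "log_kernel z t = (if z = t then -\<infinity> else ereal (ln (cmod (z - t))))"

definition borel_probabilities_on :: "complex set \<Rightarrow> complex measure set" where
  "borel_probabilities_on E = {\<mu>. prob_space \<mu> \<and> sets \<mu> = sets borel \<and> emeasure \<mu> E = 1}"

definition log_energy :: "complex measure \<Rightarrow> ereal" where
  "log_energy \<mu> = ext_integral (\<mu> \<Otimes>\<^sub>M \<mu>) (\<lambda>(z, t). log_kernel z t)"

definition max_log_energy :: "complex set \<Rightarrow> ereal" where
  "max_log_energy E = (SUP \<mu>\<in>borel_probabilities_on E. log_energy \<mu>)"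

text \<open>
  The exponential of \<^term>\<open>max_log_energy E\<close> with \<open>exp (-\<infinity>) = 0\<close>. For bounded \<open>E\<close> the
  supremum is never \<open>\<infinity>\<close>.
\<close>

definition log_capacity :: "complex set \<Rightarrow> real" where
  "log_capacity E =
     (if max_log_energy E = -\<infinity> then 0 else exp (real_of_ereal (max_log_energy E)))"

definition equilibrium_measure :: "complex set \<Rightarrow> complex measure" where
  "equilibrium_measure E =
     (THE \<mu>. \<mu> \<in> borel_probabilities_on E \<and> log_energy \<mu> = max_log_energy E)"


section \<open>Regularity for the exterior Dirichlet problem\<close>

definition circle_mean :: "(complex \<Rightarrow> ereal) \<Rightarrow> complex \<Rightarrow> real \<Rightarrow> ereal" where
  "circle_mean u z r =
     ext_integral (uniform_measure lborel {0..2 * pi}) (\<lambda>\<theta>. u (z + of_real r * cis \<theta>))"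

text \<open>
  Upper semicontinuous with values in \<open>[-\<infinity>, \<infinity>)\<close> and satisfying the local submean
  inequality; the function that is identically \<open>-\<infinity>\<close> is allowed.
\<close>

definition subharmonic_on :: "complex set \<Rightarrow> (complex \<Rightarrow> ereal) \<Rightarrow> bool" where
  "subharmonic_on D u \<longleftrightarrow>
     (\<forall>z\<in>D. u z < \<infinity>) \<and>
     (\<forall>z\<in>D. \<forall>a. u z < a \<longrightarrow> (\<forall>\<^sub>F w in at z within D. u w < a)) \<and>
     (\<forall>z\<in>D. \<exists>\<rho>>0. ball z \<rho> \<subseteq> D \<and> (\<forall>r. 0 < r \<and> r < \<rho> \<longrightarrow> u z \<le> circle_mean u z r))"

text \<open>
  Subharmonicity on the domain \<open>D \<union> {\<infinity>}\<close> of the Riemann sphere, where \<open>D\<close> contains a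
  neighbourhood of \<open>\<infinity>\<close>: the function is subharmonic in the chart \<open>z\<close> on \<open>D\<close> and in the
  chart \<open>w = 1/z\<close> around \<open>\<infinity>\<close>, with \<open>c\<close> its value at \<open>\<infinity>\<close>.
\<close>

definition subharmonic_on_with_infinity :: "complex set \<Rightarrow> (complex \<Rightarrow> ereal) \<Rightarrow> ereal \<Rightarrow> bool" where
  "subharmonic_on_with_infinity D u c \<longleftrightarrow>
     subharmonic_on D u \<and>
     subharmonic_on {w. w = 0 \<or> inverse w \<in> D} (\<lambda>w. if w = 0 then c else u (inverse w))"

text \<open>
  The Perron solution, at the finite points, of the Dirichlet problem in \<open>D \<union> {\<infinity>}\<close> with
  boundary data \<open>\<phi>\<close>. Since \<open>\<infinity>\<close> is an interior point of \<open>D \<union> {\<infinity>}\<close>, the boundary of this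
  domain in the sphere is \<^term>\<open>frontier D\<close>.
\<close>

definition perron_solution :: "complex set \<Rightarrow> (complex \<Rightarrow> real) \<Rightarrow> complex \<Rightarrow> ereal" where
  "perron_solution D \<phi> z =
     Sup {u z | u c. subharmonic_on_with_infinity D u c \<and>
            (\<forall>\<zeta>\<in>frontier D. Limsup (at \<zeta> within D) u \<le> ereal (\<phi> \<zeta>))}"

definition dirichlet_regular_point :: "complex set \<Rightarrow> complex \<Rightarrow> bool" where
  "dirichlet_regular_point D \<zeta> \<longleftrightarrow>
     (\<forall>\<phi>. continuous_on (frontier D) \<phi> \<longrightarrow>
        (perron_solution D \<phi> \<longlongrightarrow> ereal (\<phi> \<zeta>)) (at \<zeta> within D))"

text \<open>
  For compact \<open>E\<close>, \<^term>\<open>outside E\<close> is the unbounded component of \<open>- E\<close>, so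
  \<open>outside E \<union> {\<infinity>}\<close> is the component of the complement of \<open>E\<close> in the sphere
  that contains \<open>\<infinity>\<close>.
\<close>

definition dirichlet_regular :: "complex set \<Rightarrow> bool" where
  "dirichlet_regular E \<longleftrightarrow>
     (\<forall>\<zeta>\<in>frontier (outside E). dirichlet_regular_point (outside E) \<zeta>)"

end

theory Submission
  imports Defs "HOL-Complex_Analysis.Conformal_Mappings"
    "HOL-Computational_Algebra.Fundamental_Theorem_Algebra"
begin

text \<open>
  Write \<open>U\<close> for the potential \<open>z \<mapsto> \<integral> log |z - t| d\<mu>\<close> of the equilibrium measure and \<open>V = log cap E\<close>.
  Jensen's formula says that \<open>log\<^sup>+ |u - t|\<close> is the mean of \<open>log |z - t|\<close> over the circle \<open>|z - u| = 1\<close>.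
  If \<open>q\<close> divides \<open>p\<close>, then \<open>log |q(u)|\<close> is at most the sum of \<open>log\<^sup>+ |u - z\<^sub>j|\<close> over all zeros of \<open>p\<close>,
  hence at most the mean of \<open>log |p|\<close> over that circle; the Bernstein--Walsh inequality
  \<open>log |p| \<le> log \<parallel>p\<parallel> + n (U - V)\<close> and Jensen's formula for \<open>U\<close> then give the upper bound for the constant.
  For the lower bound take for \<open>p\<close> the polynomials whose zeros are Leja points, along a subsequence
  with \<open>\<parallel>p\<parallel>\<^bsup>1/n\<^esup> \<longrightarrow> cap E\<close>, and for \<open>q\<close> the factor with the zeros at distance at least 1 from \<open>u\<close>:
  the zeros are distributed like \<open>\<mu>\<close> by uniqueness of the equilibrium measure.
  For regular \<open>E\<close> the equality \<open>U = V\<close> on the boundary turns the first formula into the second.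

  The potential theory rests on the maximum principle alone: \<open>U \<ge> V\<close> everywhere is a minimum principle off the
  support of \<open>\<mu>\<close>, while exceptional sets of capacity zero are absorbed by adding a small multiple of
  \<open>-log |p|\<^bsup>1/n\<^esup>\<close> for a polynomial \<open>p\<close> that is tiny on the exceptional set.
\<close>

section \<open>Truncated logarithmic potentials and circle measures\<close>

text \<open>The two bounds meet because \<open>trunc_log 1 u\<close>, the positive part of
  \<open>ln |u - t|\<close>, serves both: it is nonnegative, so its sum over all zeros majorises any
  selection of zeros, and that sum is exactly the logarithm at \<open>u\<close> of the factor with
  the zeros at distance at least 1. It is also continuous, so it passes to weak limits of zero
  distributions however many zeros lie near the circle \<open>|u - t| = 1\<close>. The lower bound
  holds at every \<open>u\<close> in \<open>E\<close>; the maximum is over the frontier because the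
  maximum modulus principle reduces the upper bound to frontier points. The obstacle is that U = V
  may fail on a part of \<open>E\<close> of capacity zero, so that boundary comparisons hold only
  off such a set. The same set returns in the uniqueness proof, where it is invisible to circle
  measures because these have finite energy; so all circle means of the two potentials agree, and
  these determine the measure. In the regular case the hypothesis concerns only the boundary of the
  unbounded component, while the frontier of \<open>E\<close> may also border holes. Such points are
  handled by filling the holes.\<close>

text \<open>
  Truncating the kernel at \<open>e\<close> keeps all potentials real and continuous, avoids the junk value \<open>ln 0 = 0\<close>,
  and \<open>trunc_log r a\<close> is at the same time the potential of the uniform measure on the circle of radius \<open>r\<close>
  about \<open>a\<close>. Statements about the logarithmic kernel are obtained as \<open>e\<close> tends to 0.
\<close>

definition trunc_log :: "real \<Rightarrow> complex \<Rightarrow> complex \<Rightarrow> real" where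
  "trunc_log e z t = ln (max e (cmod (z - t)))"

definition trunc_pot :: "complex measure \<Rightarrow> real \<Rightarrow> complex \<Rightarrow> real" where
  "trunc_pot \<mu> e z = (\<integral>t. trunc_log e z t \<partial>\<mu>)"

definition trunc_energy :: "complex measure \<Rightarrow> complex measure \<Rightarrow> real \<Rightarrow> real" where
  "trunc_energy \<mu> \<sigma> e = (\<integral>z. trunc_pot \<mu> e z \<partial>\<sigma>)"

lemma trunc_log_commute: "trunc_log e z t = trunc_log e t z"
  by (simp add: trunc_log_def norm_minus_commute)

lemma trunc_log_mono: "0 < e \<Longrightarrow> e \<le> e' \<Longrightarrow> trunc_log e z t \<le> trunc_log e' z t"
  by (simp add: trunc_log_def)

lemma trunc_log_ge: "0 < e \<Longrightarrow> ln e \<le> trunc_log e z t"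
  by (simp add: trunc_log_def)

lemma trunc_log_ge_ln: "z \<noteq> t \<Longrightarrow> ln (cmod (z - t)) \<le> trunc_log e z t"
  unfolding trunc_log_def by (subst ln_le_cancel_iff) (auto simp: less_max_iff_disj)

lemma trunc_log_le: "0 < e \<Longrightarrow> cmod (z - t) \<le> D \<Longrightarrow> trunc_log e z t \<le> ln (max e D)"
  unfolding trunc_log_def by (subst ln_le_cancel_iff) auto

lemma trunc_log_eq_ln: "e \<le> cmod (z - t) \<Longrightarrow> trunc_log e z t = ln (cmod (z - t))"
  by (simp add: trunc_log_def max_absorb2)

lemma ln_diff_le_divide:
  assumes "0 < e" "e \<le> a" "e \<le> (b::real)"
  shows "ln a - ln b \<le> \<bar>a - b\<bar> / e"
proof -
  have "ln a - ln b \<le> (a - b) / b" using assms by (intro ln_diff_le) auto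
  also have "\<dots> \<le> \<bar>a - b\<bar> / b" using assms by (intro divide_right_mono) auto
  also have "\<dots> \<le> \<bar>a - b\<bar> / e" using assms by (intro divide_left_mono) auto
  finally show ?thesis .
qed

lemma trunc_log_Lipschitz:
  assumes "0 < e" shows "\<bar>trunc_log e z t - trunc_log e z' t\<bar> \<le> cmod (z - z') / e"
proof -
  have d: "\<bar>max e (cmod (z - t)) - max e (cmod (z' - t))\<bar> \<le> cmod (z - z')"
  proof -
    have "\<bar>cmod (z - t) - cmod (z' - t)\<bar> \<le> cmod (z - z')"
      using norm_triangle_ineq3[of "z - t" "z' - t"] by simp
    then show ?thesis by (auto simp: max_def)
  qed
  have "ln (max e (cmod (z - t))) - ln (max e (cmod (z' - t)))
      \<le> \<bar>max e (cmod (z - t)) - max e (cmod (z' - t))\<bar> / e"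
    using assms by (intro ln_diff_le_divide) auto
  moreover have "ln (max e (cmod (z' - t))) - ln (max e (cmod (z - t)))
      \<le> \<bar>max e (cmod (z' - t)) - max e (cmod (z - t))\<bar> / e"
    using assms by (intro ln_diff_le_divide) auto
  ultimately have "\<bar>trunc_log e z t - trunc_log e z' t\<bar>
      \<le> \<bar>max e (cmod (z - t)) - max e (cmod (z' - t))\<bar> / e"
    unfolding trunc_log_def by (smt (verit) abs_minus_commute)
  also have "\<dots> \<le> cmod (z - z') / e"
    using d assms by (intro divide_right_mono) auto
  finally show ?thesis .
qed

lemma continuous_on_trunc_log: "0 < e \<Longrightarrow> continuous_on UNIV (trunc_log e z)"
  unfolding trunc_log_def by (intro continuous_intros) auto

lemma continuous_on_tlog2: "0 < e \<Longrightarrow> continuous_on UNIV (\<lambda>x. trunc_log e (fst x) (snd x))"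
  unfolding trunc_log_def by (intro continuous_intros) auto

lemma trunc_log_measurable [measurable]: "(\<lambda>t. trunc_log e z t) \<in> borel_measurable borel"
  unfolding trunc_log_def by measurable

lemma trunc_log_measurable_pair: "(\<lambda>x. trunc_log e (fst x) (snd x)) \<in> borel_measurable (borel \<Otimes>\<^sub>M borel)"
  unfolding trunc_log_def by measurable

section \<open>Borel probability measures on a set and their truncated potentials\<close>

lemma bpD:
  assumes "\<mu> \<in> borel_probabilities_on S"
  shows "prob_space \<mu>" "sets \<mu> = sets borel" "space \<mu> = UNIV" "emeasure \<mu> S = 1"
    "S \<in> sets borel" "AE t in \<mu>. t \<in> S" "measure \<mu> UNIV = 1" "finite_measure \<mu>"
proof -
  show p: "prob_space \<mu>" and s: "sets \<mu> = sets borel" and e: "emeasure \<mu> S = 1"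
    using assms by (auto simp: borel_probabilities_on_def)
  show sp: "space \<mu> = UNIV" using sets_eq_imp_space_eq[OF s] by simp
  have "S \<in> sets \<mu>" using e by (metis emeasure_notin_sets zero_neq_one)
  then show "S \<in> sets borel" using s by simp
  interpret prob_space \<mu> by fact
  show "AE t in \<mu>. t \<in> S" using e \<open>S \<in> sets \<mu>\<close>
    by (intro AE_I_eq_1) (auto simp: sp)
  show "measure \<mu> UNIV = 1" using prob_space sp by simp
  show "finite_measure \<mu>" by unfold_locales
qed

lemma bpI:
  assumes "prob_space \<mu>" "sets \<mu> = sets borel" "S \<in> sets borel" "AE t in \<mu>. t \<in> S"
  shows "\<mu> \<in> borel_probabilities_on S"
proof -
  interpret prob_space \<mu> by fact
  have sp: "space \<mu> = UNIV" using sets_eq_imp_space_eq[OF assms(2)] by simp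
  have "emeasure \<mu> S = 1"
    using assms by (subst emeasure_eq_1_AE) (auto simp: sp)
  then show ?thesis using assms by (simp add: borel_probabilities_on_def)
qed

lemma bp_mono:
  assumes "\<mu> \<in> borel_probabilities_on S" "S \<subseteq> T" "T \<in> sets borel"
  shows "\<mu> \<in> borel_probabilities_on T"
  using bpD[OF assms(1)] assms(2,3) by (intro bpI) (auto elim: eventually_mono)

lemma bp_measurable:
  "\<mu> \<in> borel_probabilities_on S \<Longrightarrow> f \<in> borel_measurable borel \<Longrightarrow> f \<in> borel_measurable \<mu>"
  using measurable_cong_sets[OF bpD(2) refl] by blast

lemma bp_integrable:
  assumes "\<mu> \<in> borel_probabilities_on S" "f \<in> borel_measurable borel"
    "\<And>t. t \<in> S \<Longrightarrow> \<bar>f t\<bar> \<le> (B::real)"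
  shows "integrable \<mu> f"
proof -
  note \<mu> = bpD[OF assms(1)]
  interpret prob_space \<mu> by fact
  have m: "f \<in> borel_measurable \<mu>"
    using assms(1,2) by (rule bp_measurable)
  show ?thesis using \<mu>(6) assms(3) m
    by (intro integrable_const_bound[where B = B]) (auto elim!: eventually_mono)
qed

lemma bounded_imp_bounded_continuous:
  fixes f :: "complex \<Rightarrow> real"
  assumes "bounded S" "continuous_on UNIV f"
  shows "\<exists>B. \<forall>t\<in>S. \<bar>f t\<bar> \<le> B"
proof -
  have "compact (f ` closure S)"
    using assms by (intro compact_continuous_image continuous_on_subset[OF assms(2)]) auto
  then have "bounded (f ` closure S)" by (rule compact_imp_bounded)
  then obtain B where "\<And>y. y \<in> f ` closure S \<Longrightarrow> norm y \<le> B" unfolding bounded_iff by blast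
  then have "\<forall>t\<in>S. \<bar>f t\<bar> \<le> B"
    using closure_subset[of S] by auto
  then show ?thesis ..
qed

lemma bp_integrable_continuous:
  fixes f :: "complex \<Rightarrow> real"
  assumes "\<mu> \<in> borel_probabilities_on S" "bounded S" "continuous_on UNIV f"
  shows "integrable \<mu> f"
proof -
  obtain B where "\<forall>t\<in>S. \<bar>f t\<bar> \<le> B"
    using bounded_imp_bounded_continuous[OF assms(2,3)] by blast
  then show ?thesis using assms by (intro bp_integrable[where B = B])
      (auto intro: borel_measurable_continuous_onI)
qed

lemma bp_integral_mono:
  fixes f g :: "complex \<Rightarrow> real"
  assumes "\<mu> \<in> borel_probabilities_on S" "integrable \<mu> f" "integrable \<mu> g"
    "\<And>t. t \<in> S \<Longrightarrow> f t \<le> g t"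
  shows "integral\<^sup>L \<mu> f \<le> integral\<^sup>L \<mu> g"
  using bpD(6)[OF assms(1)] assms(2-4)
  by (intro integral_mono_AE) (auto elim!: eventually_mono)

lemma bp_integral_cong:
  fixes f g :: "complex \<Rightarrow> real"
  assumes "\<mu> \<in> borel_probabilities_on S" "f \<in> borel_measurable borel" "g \<in> borel_measurable borel"
    "\<And>t. t \<in> S \<Longrightarrow> f t = g t"
  shows "integral\<^sup>L \<mu> f = integral\<^sup>L \<mu> g"
  using bpD(6)[OF assms(1)] assms(2-4) bp_measurable[OF assms(1)]
  by (intro integral_cong_AE) (auto elim!: eventually_mono)

lemma bp_const: "\<mu> \<in> borel_probabilities_on S \<Longrightarrow> (\<integral>t. c \<partial>\<mu>) = (c::real)"
  using bpD(3,7) by (metis lebesgue_integral_const scaleR_one)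

lemma bp_integral_le_const:
  fixes f :: "complex \<Rightarrow> real"
  assumes "\<mu> \<in> borel_probabilities_on S" "integrable \<mu> f" "\<And>t. t \<in> S \<Longrightarrow> f t \<le> c"
  shows "integral\<^sup>L \<mu> f \<le> c"
  using bp_integral_mono[OF assms(1,2) _ assms(3)] bp_const[OF assms(1), of c]
    finite_measure.integrable_const[OF bpD(8)[OF assms(1)], of c]
  by (simp add: bpD(3,7)[OF assms(1)])

lemma bp_integral_ge_const:
  fixes f :: "complex \<Rightarrow> real"
  assumes "\<mu> \<in> borel_probabilities_on S" "integrable \<mu> f" "\<And>t. t \<in> S \<Longrightarrow> c \<le> f t"
  shows "c \<le> integral\<^sup>L \<mu> f"
  using bp_integral_mono[OF assms(1) _ assms(2,3)] bp_const[OF assms(1), of c]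
    finite_measure.integrable_const[OF bpD(8)[OF assms(1)], of c]
  by (simp add: bpD(3,7)[OF assms(1)])

lemma integrable_trunc_log:
  assumes "\<mu> \<in> borel_probabilities_on S" "bounded S" "0 < e"
  shows "integrable \<mu> (trunc_log e z)" "integrable \<mu> (\<lambda>t. trunc_log e z t)"
  using bp_integrable_continuous[OF assms(1,2) continuous_on_trunc_log[OF assms(3)]] by auto

lemma trunc_pot_Lipschitz:
  assumes "\<mu> \<in> borel_probabilities_on S" "bounded S" "0 < e"
  shows "\<bar>trunc_pot \<mu> e z - trunc_pot \<mu> e z'\<bar> \<le> cmod (z - z') / e"
proof -
  note i = integrable_trunc_log[OF assms]
  have "trunc_pot \<mu> e z - trunc_pot \<mu> e z' = (\<integral>t. trunc_log e z t - trunc_log e z' t \<partial>\<mu>)"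
    unfolding trunc_pot_def using i by (intro Bochner_Integration.integral_diff[symmetric]) auto
  moreover have "\<dots> \<le> cmod (z - z') / e"
    using i trunc_log_Lipschitz[OF assms(3)] by (intro bp_integral_le_const[OF assms(1)]) (auto simp: abs_le_iff)
  moreover have "- (cmod (z - z') / e) \<le> (\<integral>t. trunc_log e z t - trunc_log e z' t \<partial>\<mu>)"
    using i trunc_log_Lipschitz[OF assms(3)] by (intro bp_integral_ge_const[OF assms(1)]) (auto simp: abs_le_iff algebra_simps)
  ultimately show ?thesis by (simp add: abs_le_iff)
qed

lemma continuous_on_trunc_pot:
  assumes "\<mu> \<in> borel_probabilities_on S" "bounded S" "0 < e"
  shows "continuous_on A (trunc_pot \<mu> e)"
proof -
  have "(1/e)-lipschitz_on UNIV (trunc_pot \<mu> e)"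
    using trunc_pot_Lipschitz[OF assms] assms(3)
    by (intro lipschitz_onI) (auto simp: dist_norm)
  then show ?thesis using lipschitz_on_continuous_on continuous_on_subset by blast
qed

lemma trunc_pot_measurable:
  assumes "\<mu> \<in> borel_probabilities_on S" "bounded S" "0 < e"
  shows "trunc_pot \<mu> e \<in> borel_measurable borel"
  using continuous_on_trunc_pot[OF assms] by (intro borel_measurable_continuous_onI)

lemma trunc_pot_mono:
  assumes "\<mu> \<in> borel_probabilities_on S" "bounded S" "0 < e" "e \<le> e'"
  shows "trunc_pot \<mu> e z \<le> trunc_pot \<mu> e' z"
  unfolding trunc_pot_def using assms
  by (intro integral_mono_AE integrable_trunc_log[OF assms(1,2)]) (auto intro!: trunc_log_mono)

lemma trunc_pot_ge: 
  assumes "\<mu> \<in> borel_probabilities_on S" "bounded S" "0 < e"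
  shows "ln e \<le> trunc_pot \<mu> e z"
  unfolding trunc_pot_def using assms trunc_log_ge
  by (intro bp_integral_ge_const[OF assms(1)] integrable_trunc_log[OF assms(1,2)]) auto

lemma integrable_trunc_pot:
  assumes "\<mu> \<in> borel_probabilities_on S" "bounded S" "\<sigma> \<in> borel_probabilities_on T" "bounded T" "0 < e"
  shows "integrable \<sigma> (trunc_pot \<mu> e)"
  using bp_integrable_continuous[OF assms(3,4) continuous_on_trunc_pot[OF assms(1,2,5)]] .

lemma trunc_energy_mono:
  assumes "\<mu> \<in> borel_probabilities_on S" "bounded S" "\<sigma> \<in> borel_probabilities_on T" "bounded T" "0 < e" "e \<le> e'"
  shows "trunc_energy \<mu> \<sigma> e \<le> trunc_energy \<mu> \<sigma> e'"
  unfolding trunc_energy_def using assms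
  by (intro integral_mono_AE integrable_trunc_pot[OF assms(1-4)]) (auto intro!: trunc_pot_mono)

lemma integrable_trunc_log_pair:
  assumes "\<mu> \<in> borel_probabilities_on S" "bounded S" "\<sigma> \<in> borel_probabilities_on T" "bounded T" "0 < e"
  shows "integrable (\<mu> \<Otimes>\<^sub>M \<sigma>) (\<lambda>x. trunc_log e (fst x) (snd x))"
    and "AE x in \<mu> \<Otimes>\<^sub>M \<sigma>. x \<in> S \<times> T"
proof -
  note a = bpD[OF assms(1)] and b = bpD[OF assms(3)]
  interpret M: prob_space \<mu> by fact
  interpret N: prob_space \<sigma> by fact
  interpret P: pair_prob_space \<mu> \<sigma> ..
  have s: "sets (\<mu> \<Otimes>\<^sub>M \<sigma>) = sets (borel \<Otimes>\<^sub>M borel)"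
    using a b by (intro sets_pair_measure_cong)
  have "emeasure (\<mu> \<Otimes>\<^sub>M \<sigma>) (S \<times> T) = 1"
    using a b by (subst N.emeasure_pair_measure_Times) auto
  moreover have "S \<times> T \<in> sets (\<mu> \<Otimes>\<^sub>M \<sigma>)" using a b by auto
  ultimately show ae: "AE x in \<mu> \<Otimes>\<^sub>M \<sigma>. x \<in> S \<times> T"
    by (intro P.AE_I_eq_1) (auto simp: space_pair_measure a b Collect_mem_eq)
  have "bounded (S \<times> T)" using assms by (intro bounded_Times)
  then have "compact (closure (S \<times> T))" by simp
  then have "compact ((\<lambda>x. trunc_log e (fst x) (snd x)) ` closure (S \<times> T))"
    by (intro compact_continuous_image continuous_on_subset[OF continuous_on_tlog2[OF assms(5)]]) auto
  then have "bounded ((\<lambda>x. trunc_log e (fst x) (snd x)) ` closure (S \<times> T))" by (rule compact_imp_bounded)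
  then obtain B where "\<And>y. y \<in> (\<lambda>x. trunc_log e (fst x) (snd x)) ` closure (S \<times> T) \<Longrightarrow> norm y \<le> B"
    unfolding bounded_iff by blast
  then have B: "norm (trunc_log e (fst x) (snd x)) \<le> B" if "x \<in> S \<times> T" for x
    using subsetD[OF closure_subset that] by (simp only: image_eqI)
  have "(\<lambda>x. trunc_log e (fst x) (snd x)) \<in> borel_measurable (\<mu> \<Otimes>\<^sub>M \<sigma>)"
    using trunc_log_measurable_pair measurable_cong_sets[OF s refl] by blast
  then show "integrable (\<mu> \<Otimes>\<^sub>M \<sigma>) (\<lambda>x. trunc_log e (fst x) (snd x))"
    using ae B by (intro P.integrable_const_bound[where B = B]) (auto elim!: eventually_mono)
qed

lemma trunc_energy_commute:
  assumes "\<mu> \<in> borel_probabilities_on S" "bounded S" "\<sigma> \<in> borel_probabilities_on T" "bounded T" "0 < e"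
  shows "trunc_energy \<mu> \<sigma> e = trunc_energy \<sigma> \<mu> e"
proof -
  note a = bpD[OF assms(1)] and b = bpD[OF assms(3)]
  interpret M: prob_space \<mu> by fact
  interpret N: prob_space \<sigma> by fact
  interpret P: pair_prob_space \<mu> \<sigma> ..
  have "(\<integral>z. (\<integral>t. trunc_log e t z \<partial>\<mu>) \<partial>\<sigma>) = (\<integral>t. (\<integral>z. trunc_log e t z \<partial>\<sigma>) \<partial>\<mu>)"
    using integrable_trunc_log_pair(1)[OF assms] by (intro P.Fubini_integral) (simp add: case_prod_beta')
  then show ?thesis by (simp add: trunc_energy_def trunc_pot_def trunc_log_commute)
qed

lemma trunc_energy_eq_pair:
  assumes "\<mu> \<in> borel_probabilities_on S" "bounded S" "\<sigma> \<in> borel_probabilities_on T" "bounded T" "0 < e"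
  shows "trunc_energy \<mu> \<sigma> e = (\<integral>x. trunc_log e (fst x) (snd x) \<partial>(\<sigma> \<Otimes>\<^sub>M \<mu>))"
proof -
  note a = bpD[OF assms(1)] and b = bpD[OF assms(3)]
  interpret M: prob_space \<mu> by fact
  interpret N: prob_space \<sigma> by fact
  interpret P: pair_prob_space \<sigma> \<mu> ..
  show ?thesis unfolding trunc_energy_def trunc_pot_def
    using P.integral_fst'[OF integrable_trunc_log_pair(1)[OF assms(3,4,1,2,5)]] by simp
qed

section \<open>Uniform measures on circles and Jensen's formula\<close>

definition circle_measure :: "complex \<Rightarrow> real \<Rightarrow> complex measure" where
  "circle_measure a r = distr (uniform_measure lborel {0..2*pi}) borel (\<lambda>\<theta>. a + of_real r * cis \<theta>)"

lemma prob_space_uniform_angle: "prob_space (uniform_measure lborel {0..2*pi})"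
  by (intro prob_space_uniform_measure) auto

lemma circle_measure_map_measurable [measurable]: "(\<lambda>\<theta>. a + of_real r * cis \<theta>) \<in> borel_measurable borel"
  by (intro borel_measurable_continuous_onI continuous_intros)

lemma circle_measure_bp: "0 \<le> r \<Longrightarrow> circle_measure a r \<in> borel_probabilities_on (sphere a r)"
proof (intro bpI)
  assume r: "0 \<le> r"
  show "prob_space (circle_measure a r)" unfolding circle_measure_def
    by (intro prob_space.prob_space_distr prob_space_uniform_angle) simp
  show "AE t in circle_measure a r. t \<in> sphere a r"
    unfolding circle_measure_def using r
    by (subst AE_distr_iff) (auto simp: dist_norm norm_mult)
qed (auto simp: circle_measure_def)

lemma integral_circle_measure:
  "f \<in> borel_measurable borel \<Longrightarrow>
   (\<integral>z. f z \<partial>circle_measure a r) = (\<integral>\<theta>. f (a + of_real r * cis \<theta>) \<partial>uniform_measure lborel {0..2*pi})"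
  for f :: "complex \<Rightarrow> real"
  unfolding circle_measure_def by (subst integral_distr) auto

lemma integral_uniform_measure_real:
  fixes f :: "'a \<Rightarrow> real"
  assumes "A \<in> sets M" "emeasure M A \<noteq> 0" "emeasure M A \<noteq> \<infinity>" "f \<in> borel_measurable M"
  shows "(\<integral>x. f x \<partial>uniform_measure M A) = (\<integral>x. indicator A x * f x \<partial>M) / measure M A"
proof -
  have "uniform_measure M A = density M (\<lambda>x. ennreal (indicator A x / measure M A))"
    unfolding uniform_measure_def
    using assms by (intro arg_cong[where f = "density M"] ext)
      (auto simp: emeasure_eq_ennreal_measure divide_ennreal[of 1, simplified] indicator_def zero_less_measure_iff)
  moreover have "(\<integral>x. f x \<partial>density M (\<lambda>x. ennreal (indicator A x / measure M A)))
      = (\<integral>x. (indicator A x / measure M A) *\<^sub>R f x \<partial>M)"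
    using assms by (intro integral_density) auto
  ultimately show ?thesis by simp
qed

text \<open>Cauchy's formula at the centre, first over the parameter interval from 0 to 1 and then
  stretched to the angles from 0 to \<open>2 * pi\<close>.\<close>

lemma circle_mean_holomorphic:
  assumes "f holomorphic_on cball a r" "0 < r"
  shows "(\<integral>\<theta>. Re (f (a + of_real r * cis \<theta>)) \<partial>uniform_measure lborel {0..2*pi}) = Re (f a)"
proof -
  have "((\<lambda>u. f u / (u - a)) has_contour_integral (2 * of_real pi * \<i> * f a)) (circlepath a r)"
    using assms by (intro Cauchy_integral_circlepath_simple) auto
  then have "((\<lambda>x. f (circlepath a r x) / (circlepath a r x - a) * vector_derivative (circlepath a r) (at x))
      has_integral (2 * of_real pi * \<i> * f a)) {0..1}"
    by (simp add: has_contour_integral)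
  then have "((\<lambda>x. f (a + of_real r * cis (2 * pi * x)) * (2 * of_real pi * \<i>))
      has_integral (2 * of_real pi * \<i> * f a)) {0..1}"
  proof (rule has_integral_eq[rotated])
    fix x :: real
    have "circlepath a r x = a + of_real r * cis (2 * pi * x)"
      by (simp add: circlepath cis_conv_exp mult_ac)
    moreover have "vector_derivative (circlepath a r) (at x)
        = (2 * of_real pi * \<i>) * (of_real r * cis (2 * pi * x))"
      by (simp add: vector_derivative_circlepath cis_conv_exp mult_ac)
    ultimately show "f (circlepath a r x) / (circlepath a r x - a) * vector_derivative (circlepath a r) (at x)
        = f (a + of_real r * cis (2 * pi * x)) * (2 * of_real pi * \<i>)"
      using assms(2) by simp
  qed
  from has_integral_mult_right[OF this, of "1 / (2 * of_real pi * \<i>)"]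
  have "((\<lambda>x. f (a + of_real r * cis (2 * pi * x))) has_integral f a) {0..1}"
    by (simp add: field_simps)
  from has_integral_linear[OF this bounded_linear_Re]
  have "((\<lambda>x. Re (f (a + of_real r * cis (2 * pi * x)))) has_integral Re (f a)) {0..1}"
    by (simp add: o_def)
  from has_integral_stretch_real[OF this, of "1 / (2 * pi)"]
  have hi: "((\<lambda>x. Re (f (a + of_real r * cis x))) has_integral (2 * pi * Re (f a))) {0..2*pi}"
    using image_mult_atLeastAtMost[of "2 * pi" 0 1] by (simp add: mult.commute)
  have cs: "continuous_on A (\<lambda>x. Re (f (a + of_real r * cis x)))" for A
    using assms
    by (intro continuous_intros continuous_on_compose2[OF holomorphic_on_imp_continuous_on[OF assms(1)]])
      (auto simp: dist_norm norm_mult)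
  have "set_integrable lborel {0..2*pi} (\<lambda>x. Re (f (a + of_real r * cis x)))"
    unfolding set_integrable_def using borel_integrable_compact[OF _ cs] by simp
  from set_borel_integral_eq_integral(2)[OF this] hi
  have "(LINT x:{0..2*pi}|lborel. Re (f (a + of_real r * cis x))) = 2 * pi * Re (f a)"
    by (simp add: integral_unique)
  moreover have "(\<lambda>x. Re (f (a + of_real r * cis x))) \<in> borel_measurable borel"
    by (rule borel_measurable_continuous_onI[OF cs])
  ultimately show ?thesis
    by (subst integral_uniform_measure_real) (auto simp: set_lebesgue_integral_def)
qed

text \<open>The disc misses \<open>t\<close>, so \<open>(z - t) / (a - t)\<close> stays within
  distance 1 of the value 1, in the right half-plane. There the principal logarithm is holomorphic,
  and \<open>ln |z - t|\<close> is its real part up to a constant.\<close>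

lemma circle_measure_ln_outside:
  assumes "0 < r" "r < cmod (a - t)"
  shows "(\<integral>\<theta>. ln (cmod (a + of_real r * cis \<theta> - t)) \<partial>uniform_measure lborel {0..2*pi}) = ln (cmod (a - t))"
proof -
  have at: "a \<noteq> t" using assms by auto
  define f where "f z = Ln ((z - t) / (a - t)) + of_real (ln (cmod (a - t)))" for z
  have pos: "0 < Re ((z - t) / (a - t))" and nz: "z \<noteq> t" if "z \<in> cball a r" for z
  proof -
    have "(z - t) / (a - t) = 1 + (z - a) / (a - t)" using at by (simp add: field_simps)
    moreover have "cmod ((z - a) / (a - t)) < 1"
      using that assms at by (auto simp: norm_divide dist_norm norm_minus_commute divide_simps)
    ultimately show "0 < Re ((z - t) / (a - t))"
      using abs_Re_le_cmod[of "(z - a) / (a - t)"] by simp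
    then show "z \<noteq> t" by auto
  qed
  have "f holomorphic_on cball a r" unfolding f_def
    using pos at by (intro holomorphic_intros) (force simp: complex_nonpos_Reals_iff)+
  moreover have "Re (f z) = ln (cmod (z - t))" if "z \<in> cball a r" for z
    using nz[OF that] at by (simp add: f_def norm_divide ln_div)
  ultimately show ?thesis
    using circle_mean_holomorphic[of f a r] assms
    by (simp add: dist_norm norm_mult)
qed

text \<open>A point inside the circle is moved outside by reflection. Points on the circle are
  reached later, by a limit in the truncation.\<close>

lemma circle_measure_ln:
  assumes "0 < r" "r \<noteq> cmod (a - t)"
  shows "(\<integral>\<theta>. ln (cmod (a + of_real r * cis \<theta> - t)) \<partial>uniform_measure lborel {0..2*pi}) = trunc_log r a t"
proof (cases "r < cmod (a - t)")
  case True
  then show ?thesis using circle_measure_ln_outside[OF assms(1)] by (simp add: trunc_log_def)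
next
  case False
  interpret U: prob_space "uniform_measure lborel {0..2*pi::real}" by (rule prob_space_uniform_angle)
  show ?thesis
  proof (cases "a = t")
    case True
    then show ?thesis using assms(1) U.prob_space by (simp add: trunc_log_def norm_mult)
  next
    case ne: False
    define b where "b = cnj (a - t)"
    have b: "b \<noteq> 0" "cmod b = cmod (a - t)" using ne by (auto simp: b_def norm_minus_commute simp flip: complex_cnj_diff)
    have lt: "cmod b < r" using False assms b by simp
    \<comment> \<open>Conjugating and multiplying by the unimodular \<open>cis \<theta>\<close>
      leaves the modulus unchanged. The result is \<open>|b|\<close> times the distance from a point
      of the unit circle to \<open>- r / b\<close>, which lies outside that circle because
      \<open>|b| < r\<close>.\<close>
    have eq: "cmod (a + of_real r * cis \<theta> - t) = cmod b * cmod (0 + of_real 1 * cis \<theta> - (- of_real r / b))" for \<theta>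
    proof -
      have "cmod (a + of_real r * cis \<theta> - t) = cmod (cnj (a + of_real r * cis \<theta> - t) * cis \<theta>)"
        by (simp only: norm_mult norm_cis complex_mod_cnj mult_1_right)
      also have "cnj (a + of_real r * cis \<theta> - t) * cis \<theta> = b * cis \<theta> + of_real r * (cis (- \<theta>) * cis \<theta>)"
        by (simp add: b_def algebra_simps cis_cnj)
      also have "\<dots> = b * cis \<theta> + of_real r" by (simp add: cis_mult)
      also have "\<dots> = b * (0 + of_real 1 * cis \<theta> - (- of_real r / b))" using b by (simp add: field_simps)
      finally show ?thesis by (simp add: norm_mult)
    qed
    have o: "1 < cmod (0 - (- of_real r / b))" using lt b ne by (simp add: norm_divide less_divide_eq)
    have nz: "cmod (0 + of_real 1 * cis \<theta> - (- of_real r / b)) > 0" for \<theta>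
    proof -
      have "0 + of_real 1 * cis \<theta> \<noteq> (- of_real r / b)"
        using o norm_cis[of \<theta>] by (metis add_0 diff_0 minus_diff_eq minus_minus mult.left_neutral norm_minus_cancel of_real_1 order_less_irrefl)
      then have "0 + of_real 1 * cis \<theta> - (- of_real r / b) \<noteq> 0" by (simp only: right_minus_eq not_False_eq_True)
      then show ?thesis by (simp only: zero_less_norm_iff not_False_eq_True)
    qed
    have "(\<integral>\<theta>. ln (cmod (a + of_real r * cis \<theta> - t)) \<partial>uniform_measure lborel {0..2*pi})
      = (\<integral>\<theta>. ln (cmod b) + ln (cmod (0 + of_real 1 * cis \<theta> - (- of_real r / b))) \<partial>uniform_measure lborel {0..2*pi})"
      unfolding eq using b nz by (intro Bochner_Integration.integral_cong refl ln_mult_pos) auto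
    also have "\<dots> = ln (cmod b) + (\<integral>\<theta>. ln (cmod (0 + of_real 1 * cis \<theta> - (- of_real r / b))) \<partial>uniform_measure lborel {0..2*pi})"
    proof (subst Bochner_Integration.integral_add)
      have "continuous_on UNIV (\<lambda>\<theta>. ln (cmod (0 + of_real 1 * cis \<theta> - (- of_real r / b))))"
        using nz by (intro continuous_intros) (auto simp: less_le)
      then have cm: "(\<lambda>\<theta>. ln (cmod (0 + of_real 1 * cis \<theta> - (- of_real r / b)))) \<in> borel_measurable borel"
        by (rule borel_measurable_continuous_onI)
      let ?q = "cmod (of_real r / b)"
      have q: "1 < ?q" using o by (simp add: norm_minus_commute)
      have "\<bar>ln (cmod (0 + of_real 1 * cis \<theta> - (- of_real r / b)))\<bar> \<le> max \<bar>ln (?q + 1)\<bar> \<bar>ln (?q - 1)\<bar>" for \<theta>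
      proof -
        have "cmod (cis \<theta> + of_real r / b) \<le> ?q + 1" using norm_triangle_ineq[of "cis \<theta>" "of_real r / b"] by simp
        moreover have "?q - 1 \<le> cmod (cis \<theta> + of_real r / b)" 
          using norm_triangle_ineq4[of "cis \<theta> + of_real r / b" "cis \<theta>"] by simp
        ultimately have "ln (cmod (cis \<theta> + of_real r / b)) \<le> ln (?q + 1)" "ln (?q - 1) \<le> ln (cmod (cis \<theta> + of_real r / b))"
          using q nz[of \<theta>] by (auto simp: ln_le_cancel_iff)
        then show ?thesis by (simp add: abs_le_iff) linarith
      qed
      then show "integrable (uniform_measure lborel {0..2*pi}) (\<lambda>\<theta>. ln (cmod (0 + of_real 1 * cis \<theta> - (- of_real r / b))))"
        using cm by (intro U.integrable_const_bound[where B = "max \<bar>ln (?q + 1)\<bar> \<bar>ln (?q - 1)\<bar>"]) auto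
    qed (use U.prob_space in auto)
    also have "\<dots> = ln (cmod b) + ln (cmod (0 - (- of_real r / b)))"
      using circle_measure_ln_outside[of 1 0 "- of_real r / b"] o by simp
    also have "\<dots> = ln r" using b ne assms by (simp add: norm_divide ln_div)
    finally show ?thesis using False assms by (simp add: trunc_log_def)
  qed
qed

text \<open>The bound on \<open>e\<close> is the distance from \<open>t\<close> to the circle, so
  the truncation is inactive.\<close>

lemma trunc_pot_circle_measure_eq:
  assumes "0 < r" "0 < e" "e \<le> \<bar>cmod (a - t) - r\<bar>"
  shows "trunc_pot (circle_measure a r) e t = trunc_log r a t"
proof -
  have "e \<le> cmod (a + of_real r * cis \<theta> - t)" for \<theta>
  proof -
    have "\<bar>cmod (a - t) - r\<bar> \<le> cmod (a + of_real r * cis \<theta> - t)"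
      using norm_triangle_ineq3[of "a - t" "- of_real r * cis \<theta>"] assms(1) by (simp add: norm_mult algebra_simps)
    then show ?thesis using assms by linarith
  qed
  then have "(\<integral>z. trunc_log e t z \<partial>circle_measure a r) = (\<integral>\<theta>. ln (cmod (a + of_real r * cis \<theta> - t)) \<partial>uniform_measure lborel {0..2*pi})"
    by (subst integral_circle_measure) (auto simp: trunc_log_commute[of _ t] trunc_log_eq_ln)
  then show ?thesis unfolding trunc_pot_def using circle_measure_ln[of r a t] assms by auto
qed

lemma trunc_pot_circle_measure_ge:
  assumes "0 < r" "0 < e"
  shows "trunc_log r a t \<le> trunc_pot (circle_measure a r) e t"
proof -
  have bp: "circle_measure a r \<in> borel_probabilities_on (sphere a r)" using assms by (intro circle_measure_bp) auto
  have bd: "bounded (sphere a r)" by simp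
  show ?thesis
  proof (cases "cmod (a - t) = r")
    case False
    define e' where "e' = min e \<bar>cmod (a - t) - r\<bar>"
    have "trunc_log r a t = trunc_pot (circle_measure a r) e' t"
      using assms False by (intro trunc_pot_circle_measure_eq[symmetric]) (auto simp: e'_def)
    also have "\<dots> \<le> trunc_pot (circle_measure a r) e t"
      using assms False by (intro trunc_pot_mono[OF bp bd]) (auto simp: e'_def)
    finally show ?thesis .
  next
    case True
    have "trunc_log r a t \<le> trunc_pot (circle_measure a r) e t + \<delta>" if "\<delta> > 0" for \<delta>
    proof -
      \<comment> \<open>Below, \<open>t'\<close> is \<open>t\<close> moved radially outward by
        \<open>d * r\<close>. With this \<open>d\<close> the Lipschitz constant \<open>1 / e\<close>
        turns the displacement into exactly \<open>\<delta>\<close>.\<close>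
      define d where "d = \<delta> * e / r"
      have d: "d > 0" using that assms by (simp add: d_def)
      define t' where "t' = t + of_real d * (t - a)"
      have "a - t' = of_real (1 + d) * (a - t)" by (simp add: t'_def algebra_simps)
      then have at: "cmod (a - t') = (1 + d) * r" using d True by (simp add: norm_mult del: of_real_add)
      have tt: "cmod (t' - t) = d * r" using d True by (simp add: t'_def norm_mult norm_minus_commute)
      define e' where "e' = min e (d * r)"
      have "trunc_log r a t \<le> ln ((1 + d) * r)" using True d assms by (simp add: trunc_log_def)
      also have "\<dots> = trunc_log r a t'" using at d assms by (simp add: trunc_log_def max_def)
      also have "\<dots> = trunc_pot (circle_measure a r) e' t'"
        using at d assms by (intro trunc_pot_circle_measure_eq[symmetric]) (auto simp: e'_def algebra_simps)
      also have "\<dots> \<le> trunc_pot (circle_measure a r) e t'"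
        using assms d by (intro trunc_pot_mono[OF bp bd]) (auto simp: e'_def)
      also have "\<dots> \<le> trunc_pot (circle_measure a r) e t + cmod (t' - t) / e"
        using trunc_pot_Lipschitz[OF bp bd assms(2), of t' t] by linarith
      also have "cmod (t' - t) / e = \<delta>" using tt assms by (simp add: d_def)
      finally show ?thesis .
    qed
    then show ?thesis by (rule field_le_epsilon)
  qed
qed

text \<open>For \<open>t\<close> on the circle, pushing \<open>t\<close> outward by \<open>e\<close> increases the distance to every point of the disc.\<close>

lemma trunc_pot_circle_measure_le:
  assumes "0 < r" "0 < e" "cmod (a - t) = r"
  shows "trunc_pot (circle_measure a r) e t \<le> ln (r + e)"
proof -
  have bp: "circle_measure a r \<in> borel_probabilities_on (sphere a r)" using assms by (intro circle_measure_bp) auto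
  define t' where "t' = t + of_real (e / r) * (t - a)"
  have "a - t' = of_real (1 + e / r) * (a - t)"
    unfolding t'_def of_real_add of_real_1 by (simp add: algebra_simps del: of_real_divide)
  then have "cmod (a - t') = \<bar>1 + e / r\<bar> * r" using assms
    by (simp only: norm_mult norm_of_real)
  also have "\<dots> = r + e" using assms by (simp add: distrib_right)
  finally have at: "cmod (a - t') = r + e" .
  have le: "cmod (t - z) \<le> cmod (t' - z)" if "z \<in> sphere a r" for z
  proof -
    define p q where "p = t - a" and "q = z - a"
    define s where "s = e / r"
    have s: "s \<ge> 0" using assms by (simp add: s_def)
    have pq: "norm p = r" "norm q = r" using assms that by (auto simp: p_def q_def dist_norm norm_minus_commute)
    have "p \<bullet> q \<le> r\<^sup>2" using norm_cauchy_schwarz[of p q] pq by (simp add: power2_eq_square)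
    have ip: "p \<bullet> p = r\<^sup>2" using pq by (simp add: power2_norm_eq_inner[symmetric])
    have "(norm (t - z))\<^sup>2 = (norm (p - q))\<^sup>2" by (simp add: p_def q_def)
    moreover have "(norm (t' - z))\<^sup>2 = (norm ((1 + s) *\<^sub>R p - q))\<^sup>2"
      by (simp add: p_def q_def t'_def s_def scaleR_conv_of_real algebra_simps)
    moreover have "(norm ((1 + s) *\<^sub>R p - q))\<^sup>2 - (norm (p - q))\<^sup>2 = s\<^sup>2 * r\<^sup>2 + 2 * s * (r\<^sup>2 - p \<bullet> q)"
      unfolding power2_norm_eq_inner
      by (simp add: inner_diff_left inner_diff_right inner_commute ip algebra_simps power2_eq_square[of s])
    moreover have "0 \<le> s\<^sup>2 * r\<^sup>2 + 2 * s * (r\<^sup>2 - p \<bullet> q)"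
      using s \<open>p \<bullet> q \<le> r\<^sup>2\<close> by simp
    ultimately have "(norm (t - z))\<^sup>2 \<le> (norm (t' - z))\<^sup>2" by linarith
    then show ?thesis by (simp add: power2_le_iff_abs_le)
  qed
  have "trunc_pot (circle_measure a r) e t \<le> trunc_pot (circle_measure a r) e t'"
    unfolding trunc_pot_def
  proof (intro bp_integral_mono[OF bp] integrable_trunc_log[OF bp])
    fix z assume "z \<in> sphere a r"
    then have "max e (cmod (t - z)) \<le> max e (cmod (t' - z))" by (intro max.mono le) auto
    then show "trunc_log e t z \<le> trunc_log e t' z"
      unfolding trunc_log_def using assms by (subst ln_le_cancel_iff) (auto simp: less_max_iff_disj)
  qed (use assms in auto)
  also have "\<dots> = trunc_log r a t'" using at assms by (intro trunc_pot_circle_measure_eq) auto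
  also have "\<dots> = ln (r + e)" using at assms by (simp add: trunc_log_def)
  finally show ?thesis .
qed

lemma trunc_pot_circle_measure_tendsto:
  assumes "0 < r"
  shows "(\<lambda>n. trunc_pot (circle_measure a r) (1 / Suc n) t) \<longlonglongrightarrow> trunc_log r a t"
proof (cases "cmod (a - t) = r")
  case True
  have l: "(\<lambda>n. ln (r + 1 / Suc n)) \<longlonglongrightarrow> ln (r + 0)"
    using assms LIMSEQ_Suc[OF lim_1_over_n] by (intro tendsto_intros) auto
  show ?thesis
  proof (rule tendsto_sandwich[OF always_eventually always_eventually tendsto_const])
    show "\<forall>n. trunc_log r a t \<le> trunc_pot (circle_measure a r) (1 / Suc n) t" using trunc_pot_circle_measure_ge[OF assms] by simp
    show "\<forall>n. trunc_pot (circle_measure a r) (1 / Suc n) t \<le> ln (r + 1 / Suc n)"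
      using trunc_pot_circle_measure_le[OF assms _ True] by simp
    show "(\<lambda>n. ln (r + 1 / Suc n)) \<longlonglongrightarrow> trunc_log r a t" using l True by (simp add: trunc_log_def)
  qed
next
  case False
  have "\<forall>\<^sub>F n in sequentially. 1 / Suc n < \<bar>cmod (a - t) - r\<bar>"
    using False by (intro order_tendstoD(2)[OF LIMSEQ_Suc[OF lim_1_over_n]]) auto
  then have "\<forall>\<^sub>F n in sequentially. trunc_pot (circle_measure a r) (1 / Suc n) t = trunc_log r a t"
    by eventually_elim (use assms in \<open>auto intro!: trunc_pot_circle_measure_eq\<close>)
  then show ?thesis by (rule tendsto_eventually)
qed

text \<open>Fubini turns the energy into the \<open>\<mu>\<close>-integral of the circle potentials,
  which converge to \<open>trunc_log r a\<close> and lie between \<open>ln r\<close> and their value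
  at truncation 1. This is how \<open>trunc_pot \<mu> r a\<close> becomes the circle mean of the
  potential of \<open>\<mu>\<close>.\<close>

lemma trunc_energy_circle_measure_tendsto:
  assumes "\<mu> \<in> borel_probabilities_on S" "bounded S" "0 < r"
  shows "(\<lambda>n. trunc_energy \<mu> (circle_measure a r) (1 / Suc n)) \<longlonglongrightarrow> trunc_pot \<mu> r a"
proof -
  have bp: "circle_measure a r \<in> borel_probabilities_on (sphere a r)" using assms by (intro circle_measure_bp) auto
  note \<mu> = bpD[OF assms(1)]
  have 1: "trunc_energy \<mu> (circle_measure a r) (1 / Suc n) = (\<integral>t. trunc_pot (circle_measure a r) (1 / Suc n) t \<partial>\<mu>)" for n
    unfolding trunc_energy_def[symmetric] using assms bp
    by (intro trunc_energy_commute[OF assms(1,2) bp]) auto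
  have mono: "trunc_pot (circle_measure a r) (1 / Suc n) t \<le> trunc_pot (circle_measure a r) 1 t" for n t
    by (intro trunc_pot_mono[OF bp]) auto
  have "(\<lambda>n. \<integral>t. trunc_pot (circle_measure a r) (1 / Suc n) t \<partial>\<mu>) \<longlonglongrightarrow> (\<integral>t. trunc_log r a t \<partial>\<mu>)"
  proof (rule integral_dominated_convergence[where w = "\<lambda>t. \<bar>ln r\<bar> + \<bar>trunc_pot (circle_measure a r) 1 t\<bar>"])
    show "integrable \<mu> (\<lambda>t. \<bar>ln r\<bar> + \<bar>trunc_pot (circle_measure a r) 1 t\<bar>)"
      using integrable_trunc_pot[OF bp _ assms(1,2), of 1] finite_measure.integrable_const[OF \<mu>(8), of "\<bar>ln r\<bar>"] by auto
    show "AE t in \<mu>. norm (trunc_pot (circle_measure a r) (1 / Suc n) t) \<le> \<bar>ln r\<bar> + \<bar>trunc_pot (circle_measure a r) 1 t\<bar>" for n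
    proof (rule AE_I2)
      fix t
      have "ln r \<le> trunc_pot (circle_measure a r) (1 / Suc n) t"
        using trunc_pot_circle_measure_ge[OF assms(3), of "1 / Suc n" a t] trunc_log_ge[OF assms(3), of a t] by simp
      then show "norm (trunc_pot (circle_measure a r) (1 / Suc n) t) \<le> \<bar>ln r\<bar> + \<bar>trunc_pot (circle_measure a r) 1 t\<bar>"
        using mono[of n t] by auto
    qed
    show "AE t in \<mu>. (\<lambda>n. trunc_pot (circle_measure a r) (1 / Suc n) t) \<longlonglongrightarrow> trunc_log r a t"
      using trunc_pot_circle_measure_tendsto[OF assms(3)] by simp
  qed (use bp assms in \<open>auto intro!: bp_measurable[OF assms(1)] trunc_pot_measurable[OF bp]\<close>)
  then show ?thesis unfolding 1 trunc_pot_def[of \<mu>] .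
qed

section \<open>Energy and the variational inequality\<close>

text \<open>Nonnegative integrals are monotone for arbitrary functions. The comparison therefore
  covers subharmonic functions on circles, whose measurability is never established here.\<close>

lemma ext_integral_mono:
  assumes "\<And>x. f x \<le> g x"
  shows "ext_integral M f \<le> ext_integral M g"
  unfolding ext_integral_def
proof (rule ereal_minus_mono)
  show "enn2ereal (\<integral>\<^sup>+x. e2ennreal (f x) \<partial>M) \<le> enn2ereal (\<integral>\<^sup>+x. e2ennreal (g x) \<partial>M)"
    unfolding less_eq_ennreal.rep_eq[symmetric] using assms
    by (intro nn_integral_mono e2ennreal_mono)
  show "enn2ereal (\<integral>\<^sup>+x. e2ennreal (- g x) \<partial>M) \<le> enn2ereal (\<integral>\<^sup>+x. e2ennreal (- f x) \<partial>M)"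
    unfolding less_eq_ennreal.rep_eq[symmetric] using assms
    by (intro nn_integral_mono e2ennreal_mono) simp
qed

lemma ext_integral_real:
  assumes "integrable M f"
  shows "ext_integral M (\<lambda>x. ereal (f x)) = ereal (integral\<^sup>L M f)"
proof -
  have fin: "(\<integral>\<^sup>+x. ennreal (f x) \<partial>M) < \<infinity>" "(\<integral>\<^sup>+x. ennreal (- f x) \<partial>M) < \<infinity>"
    using assms real_integrable_def[of M f] by (auto simp: top.not_eq_extremum)
  have e: "enn2ereal x = ereal (enn2real x)" if "x < \<infinity>" for x
    using that by (cases x) (auto simp: ennreal.rep_eq max_def)
  show ?thesis
    unfolding ext_integral_def real_lebesgue_integral_def[OF assms]
    using e[OF fin(1)] e[OF fin(2)] by (simp flip: ennreal.abs_eq)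
qed

text \<open>The bridge from the extended-real energy of the definitions to truncated energies, which
  are real. One direction holds because the kernel lies below each truncation. For the other, the
  truncations with \<open>e \<le> 1\<close> share the positive part of the kernel, while their
  negative parts increase to its negative part.\<close>

lemma log_energy_ge_iff:
  assumes "\<mu> \<in> borel_probabilities_on S" "bounded S"
  shows "ereal A \<le> log_energy \<mu> \<longleftrightarrow> (\<forall>e>0. A \<le> trunc_energy \<mu> \<mu> e)"
proof -
  define P where "P = \<mu> \<Otimes>\<^sub>M \<mu>"
  define k where "k x = log_kernel (fst x) (snd x)" for x
  define g where "g e x = trunc_log e (fst x) (snd x)" for e x
  have LE: "log_energy \<mu> = ext_integral P k"
    by (simp add: log_energy_def P_def k_def[abs_def] case_prod_beta')
  have gi: "integrable P (g e)" if "0 < e" for e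
    using integrable_trunc_log_pair(1)[OF assms assms that] by (simp add: P_def g_def[abs_def])
  have ext_g: "ext_integral P (\<lambda>x. ereal (g e x)) = ereal (trunc_energy \<mu> \<mu> e)" if "0 < e" for e
    using ext_integral_real[OF gi[OF that]] trunc_energy_eq_pair[OF assms assms that] by (simp add: P_def g_def[abs_def])
  have k_le: "k x \<le> ereal (g e x)" if "0 < e" for e x
    using trunc_log_ge_ln[of "fst x" "snd x" e] by (auto simp: k_def g_def log_kernel_def)
  show ?thesis
  proof
    assume "ereal A \<le> log_energy \<mu>"
    then show "\<forall>e>0. A \<le> trunc_energy \<mu> \<mu> e"
      using ext_integral_mono[of k "\<lambda>x. ereal (g _ x)" P, OF k_le] ext_g LE
      by (metis ereal_less_eq(3) order_trans)
  next
    assume A: "\<forall>e>0. A \<le> trunc_energy \<mu> \<mu> e"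
    define p where "p = (\<integral>\<^sup>+x. e2ennreal (k x) \<partial>P)"
    define n where "n = (\<integral>\<^sup>+x. e2ennreal (- k x) \<partial>P)"
    \<comment> \<open>Truncation at a level of at most 1 changes only nonpositive values into
      nonpositive values, and \<open>ennreal\<close> sends both to 0.\<close>
    have pe: "e2ennreal (k x) = ennreal (g e x)" if "0 < e" "e \<le> 1" for e x
    proof (cases "fst x = snd x")
      case True
      then show ?thesis using that by (simp add: k_def g_def log_kernel_def trunc_log_def e2ennreal_neg ennreal_neg)
    next
      case False
      let ?d = "cmod (fst x - snd x)"
      have d: "?d > 0" using False by simp
      have "ennreal (ln ?d) = ennreal (ln (max e ?d))"
      proof (cases "?d \<le> e")
        case True
        have "ln e \<le> 0" using that by simp
        moreover have "ln ?d \<le> 0" using True that d by (subst ln_le_zero_iff) auto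
        moreover have "max e ?d = e" using True by (rule max_absorb1)
        ultimately have "ln ?d \<le> 0" "ln (max e ?d) \<le> 0" by simp_all
        then show ?thesis by (simp add: ennreal_neg)
      next
        case False
        then show ?thesis by (simp add: max_def)
      qed
      then show ?thesis using False by (simp add: k_def g_def log_kernel_def trunc_log_def ennreal.abs_eq)
    qed
    have fin: "(\<integral>\<^sup>+x. ennreal (g e x) \<partial>P) < \<infinity>" "(\<integral>\<^sup>+x. ennreal (- g e x) \<partial>P) < \<infinity>" if "0 < e" for e
      using gi[OF that] real_integrable_def[of P "g e"] by (auto simp: top.not_eq_extremum)
    have p_eq: "p = (\<integral>\<^sup>+x. ennreal (g e x) \<partial>P)" if "0 < e" "e \<le> 1" for e
      unfolding p_def using pe[OF that] by simp
    have p_fin: "p < \<infinity>" using fin(1)[of 1] p_eq[of 1] by simp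
    have n_e: "(\<integral>\<^sup>+x. ennreal (- g e x) \<partial>P) \<le> ennreal (enn2real p - A)" if "0 < e" "e \<le> 1" for e
    proof -
      have "A \<le> trunc_energy \<mu> \<mu> e" using A that by simp
      also have "\<dots> = (\<integral>x. g e x \<partial>P)"
        using trunc_energy_eq_pair[OF assms assms that(1)] by (simp add: P_def g_def[abs_def])
      also have "\<dots> = enn2real p - enn2real (\<integral>\<^sup>+x. ennreal (- g e x) \<partial>P)"
        unfolding real_lebesgue_integral_def[OF gi[OF that(1)]] p_eq[OF that] ..
      finally have "enn2real (\<integral>\<^sup>+x. ennreal (- g e x) \<partial>P) \<le> enn2real p - A" by simp
      then have "ennreal (enn2real (\<integral>\<^sup>+x. ennreal (- g e x) \<partial>P)) \<le> ennreal (enn2real p - A)"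
        by (rule ennreal_leI)
      then show ?thesis using fin(2)[OF that(1)] by simp
    qed
    have pos: "A \<le> enn2real p"
    proof -
      have "A \<le> trunc_energy \<mu> \<mu> 1" using A by simp
      also have "\<dots> = (\<integral>x. g 1 x \<partial>P)"
        using trunc_energy_eq_pair[OF assms assms, of 1] by (simp add: P_def g_def[abs_def])
      also have "\<dots> \<le> enn2real p"
        unfolding real_lebesgue_integral_def[OF gi[OF zero_less_one]] p_eq[OF zero_less_one order_refl] by simp
      finally show ?thesis .
    qed
    \<comment> \<open>Along the truncations \<open>exp (- j)\<close> the negative part is
      \<open>j\<close> on the diagonal, so its supremum there is \<infinity>, as the kernel
      requires.\<close>
    define G where "G j x = ennreal (- g (exp (- real j)) x)" for j :: nat and x
    have G_inc: "incseq G"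
      unfolding G_def incseq_def le_fun_def g_def by (intro allI impI ennreal_leI) (auto intro!: trunc_log_mono)
    have "n \<le> (\<integral>\<^sup>+x. (SUP j. G j x) \<partial>P)"
      unfolding n_def
    proof (rule nn_integral_mono)
      fix x
      show "e2ennreal (- k x) \<le> (SUP j. G j x)"
      proof (cases "fst x = snd x")
        case True
        then have "G j x = of_nat j" for j
          by (simp add: G_def g_def trunc_log_def max_def ennreal_of_nat_eq_real_of_nat)
        then show ?thesis by (simp add: ennreal_SUP_of_nat_eq_top)
      next
        case False
        let ?d = "cmod (fst x - snd x)"
        have d: "?d > 0" using False by simp
        obtain j :: nat where j: "- ln ?d \<le> real j" using real_arch_simple by blast
        have "exp (- real j) \<le> exp (ln ?d)" using j by (subst exp_le_cancel_iff) linarith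
        then have "exp (- real j) \<le> ?d" unfolding exp_ln[OF d] .
        then have "G j x = e2ennreal (- k x)"
          using False by (simp add: G_def g_def k_def log_kernel_def trunc_log_def max_def ennreal.abs_eq)
        then show ?thesis by (metis SUP_upper UNIV_I)
      qed
    qed
    also have "\<dots> = (SUP j. \<integral>\<^sup>+x. G j x \<partial>P)"
    proof (rule nn_integral_monotone_convergence_SUP[OF G_inc])
      show "G j \<in> borel_measurable P" for j
        unfolding G_def using borel_measurable_integrable[OF gi, of "exp (- real j)"] by simp
    qed
    also have "\<dots> \<le> ennreal (enn2real p - A)"
      unfolding G_def by (intro SUP_least n_e) auto
    finally have n_le: "n \<le> ennreal (enn2real p - A)" .
    have "enn2ereal n \<le> enn2ereal (ennreal (enn2real p - A))"
      using n_le by (simp add: less_eq_ennreal.rep_eq)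
    also have "\<dots> = ereal (enn2real p - A)" using pos by (simp add: ennreal.rep_eq)
    finally have nn: "enn2ereal n \<le> ereal (enn2real p - A)" .
    have "enn2ereal p = ereal (enn2real p)"
      using p_fin by (cases p) (auto simp: ennreal.rep_eq max_def)
    moreover have "ereal A = ereal (enn2real p) - ereal (enn2real p - A)" by simp
    moreover have "ereal (enn2real p) - ereal (enn2real p - A) \<le> ereal (enn2real p) - enn2ereal n"
      using nn by (intro ereal_minus_mono) auto
    ultimately show "ereal A \<le> log_energy \<mu>"
      unfolding LE ext_integral_def p_def[symmetric] n_def[symmetric] by simp
  qed
qed

section \<open>Conditioning, atoms and mixtures\<close>

lemma uniform_measure_bp:
  assumes "\<mu> \<in> borel_probabilities_on S" "A \<in> sets borel" "0 < measure \<mu> A"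
  shows "uniform_measure \<mu> A \<in> borel_probabilities_on (S \<inter> A)"
proof -
  note \<mu> = bpD[OF assms(1)]
  interpret prob_space \<mu> by fact
  have ne: "emeasure \<mu> A \<noteq> 0" "emeasure \<mu> A \<noteq> \<infinity>" using assms(3) by (auto simp: emeasure_eq_measure)
  show ?thesis
  proof (rule bpI)
    show "prob_space (uniform_measure \<mu> A)" using ne by (rule prob_space_uniform_measure)
    show "AE t in uniform_measure \<mu> A. t \<in> S \<inter> A"
      using \<mu>(6) assms(2) by (intro AE_uniform_measureI) (auto simp: \<mu>(2) elim!: eventually_mono)
  qed (use \<mu> assms in auto)
qed

lemma integral_uniform_bp:
  assumes "\<mu> \<in> borel_probabilities_on S" "A \<in> sets borel" "0 < measure \<mu> A" "f \<in> borel_measurable borel"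
  shows "(\<integral>x. f x \<partial>uniform_measure \<mu> A) = (\<integral>x. indicator A x * f x \<partial>\<mu>) / measure \<mu> (A :: complex set)"
proof -
  note \<mu> = bpD[OF assms(1)]
  interpret prob_space \<mu> by fact
  show ?thesis using assms \<mu> bp_measurable[OF assms(1)]
    by (intro integral_uniform_measure_real) (auto simp: emeasure_eq_measure)
qed

lemma bp_integrable_indicator:
  fixes f :: "complex \<Rightarrow> real"
  assumes "\<mu> \<in> borel_probabilities_on S" "A \<in> sets borel" "integrable \<mu> f"
  shows "integrable \<mu> (\<lambda>x. indicator A x * f x)"
  using integrable_mult_indicator[of A \<mu> f] assms bpD(2)[OF assms(1)] by simp

text \<open>The part of the integral off \<open>A\<close> is at most \<open>c\<close>; what remains
  is the mass of \<open>A\<close> times the conditional mean.\<close>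

lemma uniform_measure_integral_ge:
  fixes f :: "complex \<Rightarrow> real"
  assumes "\<mu> \<in> borel_probabilities_on S" "A \<in> sets borel" "0 < measure \<mu> A"
    "f \<in> borel_measurable borel" "integrable \<mu> f" "\<And>x. x \<in> S \<Longrightarrow> f x \<le> c" "0 \<le> c"
  shows "integral\<^sup>L \<mu> f - c \<le> measure \<mu> A * (\<integral>x. f x \<partial>uniform_measure \<mu> A)"
proof -
  note \<mu> = bpD[OF assms(1)]
  note i = bp_integrable_indicator[OF assms(1,2,5)]
  have "integral\<^sup>L \<mu> f - (\<integral>x. indicator A x * f x \<partial>\<mu>) = (\<integral>x. f x - indicator A x * f x \<partial>\<mu>)"
    using i assms(5) by (intro Bochner_Integration.integral_diff[symmetric])
  also have "\<dots> \<le> c"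
    using i assms(5-7) by (intro bp_integral_le_const[OF assms(1)]) (auto simp: indicator_def)
  finally show ?thesis using assms integral_uniform_bp[OF assms(1-4)] by simp
qed

lemma trunc_log_bounded_above:
  assumes "bounded S" "bounded T"
  shows "\<exists>c\<ge>0. \<forall>e z t. 0 < e \<longrightarrow> e \<le> 1 \<longrightarrow> z \<in> S \<longrightarrow> t \<in> T \<longrightarrow> trunc_log e z t \<le> c"
proof -
  obtain R1 R2 where R: "\<forall>z\<in>S. cmod z \<le> R1" "\<forall>z\<in>T. cmod z \<le> R2" using assms bounded_iff by metis
  have "trunc_log e z t \<le> ln (max 1 (R1 + R2))" if "0 < e" "e \<le> 1" "z \<in> S" "t \<in> T" for e z t
  proof -
    have "cmod (z - t) \<le> R1 + R2" using R that norm_triangle_ineq4[of z t] by fastforce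
    then have "trunc_log e z t \<le> ln (max e (R1 + R2))" using that by (intro trunc_log_le)
    also have "\<dots> \<le> ln (max 1 (R1 + R2))" using that by simp
    finally show ?thesis .
  qed
  then show ?thesis by (intro exI[of _ "ln (max 1 (R1 + R2))"]) auto
qed

text \<open>On a bounded set all truncated kernels with \<open>e \<le> 1\<close> have a common upper
  bound \<open>c\<close>, so discarding mass loses only a bounded amount of energy. The restriction
  to \<open>A\<close> is made in one variable at a time, each at the cost of \<open>c\<close> and a
  division by the mass \<open>m\<close>. Larger \<open>e\<close> follow by monotonicity.\<close>

lemma uniform_measure_finite_energy:
  assumes "\<mu> \<in> borel_probabilities_on S" "bounded S" "A \<in> sets borel" "0 < measure \<mu> A"
    "\<And>e. 0 < e \<Longrightarrow> C \<le> trunc_energy \<mu> \<mu> e"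
  shows "\<exists>C'. \<forall>e>0. C' \<le> trunc_energy (uniform_measure \<mu> A) (uniform_measure \<mu> A) e"
proof -
  define \<nu> where "\<nu> = uniform_measure \<mu> A"
  define m where "m = measure \<mu> A"
  have m: "0 < m" using assms by (simp add: m_def)
  have \<nu>: "\<nu> \<in> borel_probabilities_on (S \<inter> A)" "bounded (S \<inter> A)"
    using uniform_measure_bp[OF assms(1,3,4)] assms by (auto simp: \<nu>_def bounded_Int)
  obtain c where c: "c \<ge> 0" "\<And>e z t. 0 < e \<Longrightarrow> e \<le> 1 \<Longrightarrow> z \<in> S \<Longrightarrow> t \<in> S \<Longrightarrow> trunc_log e z t \<le> c"
    using trunc_log_bounded_above[OF assms(2,2)] by blast
  have main: "((C - c) / m - c) / m \<le> trunc_energy \<nu> \<nu> e" if e: "0 < e" "e \<le> 1" for e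
  proof -
    have 1: "trunc_pot \<mu> e z - c \<le> m * trunc_pot \<nu> e z" if "z \<in> S" for z
      unfolding trunc_pot_def \<nu>_def m_def using c that e assms
      by (intro uniform_measure_integral_ge[OF assms(1,3,4)] integrable_trunc_log) auto
    have 2: "trunc_pot \<nu> e z \<le> c" if "z \<in> S" for z
      unfolding trunc_pot_def using c e that by (intro bp_integral_le_const[OF \<nu>(1)] integrable_trunc_log[OF \<nu>]) auto
    have i1: "integrable \<mu> (trunc_pot \<nu> e)" and i2: "integrable \<mu> (trunc_pot \<mu> e)"
      using integrable_trunc_pot[OF \<nu> assms(1,2) e(1)] integrable_trunc_pot[OF assms(1,2) assms(1,2) e(1)] by auto
    have "C - c \<le> (\<integral>z. trunc_pot \<mu> e z \<partial>\<mu>) - c"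
      using assms(5)[OF e(1)] by (simp add: trunc_energy_def)
    also have "\<dots> = (\<integral>z. trunc_pot \<mu> e z - c \<partial>\<mu>)"
      using i2 bp_const[OF assms(1), of c] finite_measure.integrable_const[OF bpD(8)[OF assms(1)], of c]
      by (subst Bochner_Integration.integral_diff) (auto simp: bpD(3,7)[OF assms(1)])
    also have "\<dots> \<le> (\<integral>z. m * trunc_pot \<nu> e z \<partial>\<mu>)"
      using i1 i2 1 finite_measure.integrable_const[OF bpD(8)[OF assms(1)], of c]
      by (intro bp_integral_mono[OF assms(1)]) auto
    also have "\<dots> = m * (\<integral>z. trunc_pot \<nu> e z \<partial>\<mu>)" by simp
    finally have "(C - c) / m \<le> (\<integral>z. trunc_pot \<nu> e z \<partial>\<mu>)" using m by (simp add: field_simps)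
    moreover have "(\<integral>z. trunc_pot \<nu> e z \<partial>\<mu>) - c \<le> m * trunc_energy \<nu> \<nu> e"
      unfolding trunc_energy_def m_def using trunc_pot_measurable[OF \<nu> e(1)] i1 2 c(1)
      by (subst (2) \<nu>_def, intro uniform_measure_integral_ge[OF assms(1,3,4)]) auto
    ultimately have "(C - c) / m - c \<le> m * trunc_energy \<nu> \<nu> e" by linarith
    then show ?thesis using m by (simp add: divide_le_eq mult.commute)
  qed
  have "((C - c) / m - c) / m \<le> trunc_energy \<nu> \<nu> e" if e: "0 < e" for e
  proof -
    have "((C - c) / m - c) / m \<le> trunc_energy \<nu> \<nu> (min e 1)" using e by (intro main) auto
    also have "\<dots> \<le> trunc_energy \<nu> \<nu> e" using e by (intro trunc_energy_mono[OF \<nu> \<nu>]) auto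
    finally show ?thesis .
  qed
  then show ?thesis unfolding \<nu>_def by blast
qed

text \<open>Conditioning on an atom would give a point mass, whose truncated energy is at most
  \<open>ln e\<close> and so unbounded below, although conditioning preserves a lower bound.\<close>

lemma finite_energy_no_atom:
  assumes "\<mu> \<in> borel_probabilities_on S" "bounded S" "\<And>e. 0 < e \<Longrightarrow> C \<le> trunc_energy \<mu> \<mu> e"
  shows "measure \<mu> {x} = 0"
proof (rule ccontr)
  assume "measure \<mu> {x} \<noteq> 0"
  then have m: "0 < measure \<mu> {x}" by (simp add: zero_less_measure_iff)
  obtain C' where C': "\<And>e. 0 < e \<Longrightarrow> C' \<le> trunc_energy (uniform_measure \<mu> {x}) (uniform_measure \<mu> {x}) e"
    using uniform_measure_finite_energy[OF assms(1,2) _ m assms(3)] by auto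
  define \<nu> where "\<nu> = uniform_measure \<mu> {x}"
  have \<nu>: "\<nu> \<in> borel_probabilities_on (S \<inter> {x})" "bounded (S \<inter> {x})"
    using uniform_measure_bp[OF assms(1) _ m] assms by (auto simp: \<nu>_def bounded_Int)
  have "trunc_pot \<nu> e z \<le> ln e" if "z \<in> S \<inter> {x}" "0 < e" for e z
    unfolding trunc_pot_def using that
    by (intro bp_integral_le_const[OF \<nu>(1)] integrable_trunc_log[OF \<nu>]) (auto simp: trunc_log_def)
  then have "trunc_energy \<nu> \<nu> e \<le> ln e" if "0 < e" for e
    unfolding trunc_energy_def using that by (intro bp_integral_le_const[OF \<nu>(1)] integrable_trunc_pot[OF \<nu> \<nu>]) auto
  from this[of "exp (C' - 1)"] C'[of "exp (C' - 1)"] show False by (simp add: \<nu>_def)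
qed

lemma no_atom_small_ball:
  assumes "\<mu> \<in> borel_probabilities_on S" "measure \<mu> {x} = 0" "0 < \<epsilon>"
  shows "\<exists>\<rho>>0. measure \<mu> (ball x \<rho>) < \<epsilon>"
proof -
  note \<mu> = bpD[OF assms(1)]
  interpret prob_space \<mu> by fact
  have "(\<lambda>n. measure \<mu> (ball x (1 / Suc n))) \<longlonglongrightarrow> measure \<mu> (\<Inter>n. ball x (1 / Suc n))"
  proof (intro finite_Lim_measure_decseq)
    have "ball x (1 / Suc n) \<subseteq> ball x (1 / Suc m)" if "m \<le> n" for m n
      using that by (intro subset_ball) (auto intro!: divide_left_mono)
    then show "decseq (\<lambda>n. ball x (1 / Suc n))" by (auto simp: decseq_def)
  qed (use \<mu> in auto)
  moreover have "(\<Inter>n. ball x (1 / Suc n)) = {x}"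
  proof -
    have "y = x" if "\<And>n. dist x y < 1 / Suc n" for y
    proof (rule ccontr)
      assume "y \<noteq> x"
      then obtain n where "1 / Suc n < dist x y" using nat_approx_posE[of "dist x y"] by auto
      with that[of n] show False by simp
    qed
    then show ?thesis by auto
  qed
  ultimately have "(\<lambda>n. measure \<mu> (ball x (1 / Suc n))) \<longlonglongrightarrow> 0" using assms by simp
  from order_tendstoD(2)[OF this assms(3)]
  obtain n where "measure \<mu> (ball x (1 / Suc n)) < \<epsilon>" by (auto simp: eventually_sequentially)
  then show ?thesis by (intro exI[of _ "1 / Suc n"]) auto
qed

text \<open>The convex combination \<open>(1 - s) \<mu> + s \<sigma>\<close>, realised by drawing
  from \<open>\<sigma>\<close> with probability \<open>s\<close>.\<close>

definition mix_measure :: "real \<Rightarrow> complex measure \<Rightarrow> complex measure \<Rightarrow> complex measure" where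
  "mix_measure s \<mu> \<sigma> = measure_pmf (bernoulli_pmf s) \<bind> (\<lambda>b. if b then \<sigma> else \<mu>)"

lemma
  assumes "\<mu> \<in> borel_probabilities_on S" "\<sigma> \<in> borel_probabilities_on S" "0 \<le> s" "s \<le> 1"
  shows mix_measure_bp: "mix_measure s \<mu> \<sigma> \<in> borel_probabilities_on S"
    and integral_mix_measure: "f \<in> borel_measurable borel \<Longrightarrow> (\<And>t. t \<in> S \<Longrightarrow> \<bar>f t\<bar> \<le> B) \<Longrightarrow>
      integral\<^sup>L (mix_measure s \<mu> \<sigma>) f = (1 - s) * integral\<^sup>L \<mu> f + s * (integral\<^sup>L \<sigma> f :: real)"
proof -
  note \<mu> = bpD[OF assms(1)] and \<sigma> = bpD[OF assms(2)]
  have K: "(\<lambda>b. if b then \<sigma> else \<mu>) \<in> measurable (measure_pmf (bernoulli_pmf s)) (subprob_algebra borel)"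
    using \<mu> \<sigma> by (auto simp: space_subprob_algebra prob_space_imp_subprob_space)
  have sets: "sets (mix_measure s \<mu> \<sigma>) = sets borel"
    unfolding mix_measure_def by (rule sets_bind) (auto simp: \<mu> \<sigma>)
  have nn: "(\<integral>\<^sup>+x. f x \<partial>mix_measure s \<mu> \<sigma>) = (\<integral>\<^sup>+x. f x \<partial>\<sigma>) * ennreal s + (\<integral>\<^sup>+x. f x \<partial>\<mu>) * ennreal (1 - s)"
    if "f \<in> borel_measurable borel" for f
    unfolding mix_measure_def using assms by (subst nn_integral_bind[OF that K]) simp
  have em: "emeasure (mix_measure s \<mu> \<sigma>) X = emeasure \<sigma> X * ennreal s + emeasure \<mu> X * ennreal (1 - s)"
    if "X \<in> sets borel" for X
    using nn[of "indicator X"] that sets \<mu> \<sigma> by simp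
  have "emeasure (mix_measure s \<mu> \<sigma>) S = 1" "emeasure (mix_measure s \<mu> \<sigma>) UNIV = 1"
    using em[of S] em[of UNIV] \<mu> \<sigma> assms(3,4) prob_space.emeasure_space_1[of \<mu>] prob_space.emeasure_space_1[of \<sigma>]
    by (auto simp flip: ennreal_plus)
  then show bp: "mix_measure s \<mu> \<sigma> \<in> borel_probabilities_on S"
    using sets sets_eq_imp_space_eq[OF sets] by (auto simp: borel_probabilities_on_def intro: prob_spaceI)
  show "integral\<^sup>L (mix_measure s \<mu> \<sigma>) f = (1 - s) * integral\<^sup>L \<mu> f + s * integral\<^sup>L \<sigma> f"
    if f: "f \<in> borel_measurable borel" "\<And>t. t \<in> S \<Longrightarrow> \<bar>f t\<bar> \<le> B" for f :: "complex \<Rightarrow> real"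
  proof -
    \<comment> \<open>The shift by \<open>B\<close> makes the function nonnegative almost
      everywhere, so that the formula for nonnegative integrals applies.\<close>
    have fB: "(\<lambda>x. f x + B) \<in> borel_measurable borel" using f by simp
    have I: "(\<integral>\<^sup>+x. ennreal (f x + B) \<partial>\<rho>) = ennreal (integral\<^sup>L \<rho> f + B)" and P: "0 \<le> integral\<^sup>L \<rho> f + B"
      if \<rho>: "\<rho> \<in> borel_probabilities_on S" for \<rho>
    proof -
      have i: "integrable \<rho> f" using bp_integrable[OF \<rho> f] .
      have iB: "integrable \<rho> (\<lambda>x. f x + B)"
        using i finite_measure.integrable_const[OF bpD(8)[OF \<rho>], of B] by simp
      have e: "(\<integral>x. f x + B \<partial>\<rho>) = integral\<^sup>L \<rho> f + B"
        using i finite_measure.integrable_const[OF bpD(8)[OF \<rho>], of B] bpD(3,7)[OF \<rho>] by simp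
      have ae: "AE x in \<rho>. 0 \<le> f x + B" using bpD(6)[OF \<rho>]
        by eventually_elim (use f(2) in \<open>force simp: abs_le_iff\<close>)
      show "(\<integral>\<^sup>+x. ennreal (f x + B) \<partial>\<rho>) = ennreal (integral\<^sup>L \<rho> f + B)"
        using nn_integral_eq_integral[OF iB ae] e by simp
      show "0 \<le> integral\<^sup>L \<rho> f + B" using integral_nonneg_AE[OF ae] e by simp
    qed
    have "ennreal (integral\<^sup>L (mix_measure s \<mu> \<sigma>) f + B)
        = ennreal (integral\<^sup>L \<sigma> f + B) * ennreal s + ennreal (integral\<^sup>L \<mu> f + B) * ennreal (1 - s)"
      using nn[of "\<lambda>x. ennreal (f x + B)"] f I[OF bp] I[OF assms(1)] I[OF assms(2)] by simp
    also have "\<dots> = ennreal ((integral\<^sup>L \<sigma> f + B) * s + (integral\<^sup>L \<mu> f + B) * (1 - s))"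
      using P[OF assms(1)] P[OF assms(2)] assms(3,4) by (simp add: ennreal_mult ennreal_plus)
    finally have "integral\<^sup>L (mix_measure s \<mu> \<sigma>) f + B = (integral\<^sup>L \<sigma> f + B) * s + (integral\<^sup>L \<mu> f + B) * (1 - s)"
      using P[OF bp] P[OF assms(1)] P[OF assms(2)] assms(3,4) by (subst (asm) ennreal_inj) auto
    then show ?thesis by (simp add: algebra_simps)
  qed
qed

text \<open>\<open>V\<close> is the logarithm of the capacity. By \<open>log_energy_ge_iff\<close>
  the bounds on truncated energies say that \<open>\<mu>\<close> has logarithmic energy at least
  \<open>V\<close> and that no measure on \<open>E\<close> has more. Uniqueness is left out on
  purpose: the locale is also established for weak limits before they are identified with
  \<open>\<mu>\<close>, and for \<open>E\<close> with its holes filled.\<close>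

locale equilibrium =
  fixes E :: "complex set" and V :: real and \<mu> :: "complex measure"
  assumes compact: "compact E"
    and bp: "\<mu> \<in> borel_probabilities_on E"
    and energy: "\<And>e. 0 < e \<Longrightarrow> V \<le> trunc_energy \<mu> \<mu> e"
    and maximal: "\<And>\<sigma> A. \<sigma> \<in> borel_probabilities_on E \<Longrightarrow> (\<And>e. 0 < e \<Longrightarrow> A \<le> trunc_energy \<sigma> \<sigma> e) \<Longrightarrow> A \<le> V"
begin

lemma bd: "bounded E" using compact by (rule compact_imp_bounded)

text \<open>Differentiate the energy of \<open>(1 - s) \<mu> + s \<sigma>\<close> at \<open>s = 0\<close>.\<close>

lemma variational:
  assumes \<sigma>: "\<sigma> \<in> borel_probabilities_on E"
    and A: "\<And>e. 0 < e \<Longrightarrow> A \<le> trunc_energy \<sigma> \<sigma> e" and B: "\<And>e. 0 < e \<Longrightarrow> B \<le> trunc_energy \<mu> \<sigma> e"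
  shows "B \<le> V"
proof -
  \<comment> \<open>The truncated energy of the mixture is quadratic in \<open>s\<close>, and
    maximality bounds it by \<open>V\<close>. Cancelling the constant terms and one factor
    \<open>s\<close> leaves this inequality.\<close>
  have key: "2 * (1 - s) * (B - V) \<le> s * (V - A)" if s: "0 < s" "s < 1" for s
  proof -
    define \<rho> where "\<rho> = mix_measure s \<mu> \<sigma>"
    have \<rho>: "\<rho> \<in> borel_probabilities_on E" unfolding \<rho>_def using s by (intro mix_measure_bp bp \<sigma>) auto
    have int: "integral\<^sup>L \<rho> f = (1 - s) * integral\<^sup>L \<mu> f + s * integral\<^sup>L \<sigma> f" if "continuous_on UNIV f" for f :: "complex \<Rightarrow> real"
    proof -
      obtain C where "\<forall>t\<in>E. \<bar>f t\<bar> \<le> C" using bounded_imp_bounded_continuous[OF bd \<open>continuous_on UNIV f\<close>] by blast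
      then show ?thesis unfolding \<rho>_def using s borel_measurable_continuous_onI[OF that]
        by (intro integral_mix_measure[OF bp \<sigma>, where B = C]) auto
    qed
    have "(1 - s)\<^sup>2 * V + 2 * s * (1 - s) * B + s\<^sup>2 * A \<le> trunc_energy \<rho> \<rho> e" if e: "0 < e" for e
    proof -
      have p: "trunc_pot \<rho> e z = (1 - s) * trunc_pot \<mu> e z + s * trunc_pot \<sigma> e z" for z
        unfolding trunc_pot_def by (rule int[OF continuous_on_trunc_log[OF e]])
      have c: "continuous_on UNIV (\<lambda>z. (1 - s) * trunc_pot \<mu> e z + s * trunc_pot \<sigma> e z)"
        using e by (intro continuous_intros continuous_on_trunc_pot[OF bp bd] continuous_on_trunc_pot[OF \<sigma> bd])
      have lin: "(\<integral>z. (1 - s) * trunc_pot \<mu> e z + s * trunc_pot \<sigma> e z \<partial>\<tau>) = (1 - s) * trunc_energy \<mu> \<tau> e + s * trunc_energy \<sigma> \<tau> e"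
        if "\<tau> \<in> borel_probabilities_on E" for \<tau>
        unfolding trunc_energy_def using integrable_trunc_pot[OF bp bd that bd e] integrable_trunc_pot[OF \<sigma> bd that bd e]
        by (subst Bochner_Integration.integral_add) auto
      have "trunc_energy \<rho> \<rho> e = (\<integral>z. (1 - s) * trunc_pot \<mu> e z + s * trunc_pot \<sigma> e z \<partial>\<rho>)"
        unfolding trunc_energy_def p ..
      also have "\<dots> = (1 - s) * ((1 - s) * trunc_energy \<mu> \<mu> e + s * trunc_energy \<sigma> \<mu> e) + s * ((1 - s) * trunc_energy \<mu> \<sigma> e + s * trunc_energy \<sigma> \<sigma> e)"
        unfolding int[OF c] lin[OF bp] lin[OF \<sigma>] ..
      also have "trunc_energy \<sigma> \<mu> e = trunc_energy \<mu> \<sigma> e" by (rule trunc_energy_commute[OF \<sigma> bd bp bd e])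
      finally have eq: "trunc_energy \<rho> \<rho> e = (1 - s)\<^sup>2 * trunc_energy \<mu> \<mu> e + 2 * s * (1 - s) * trunc_energy \<mu> \<sigma> e + s\<^sup>2 * trunc_energy \<sigma> \<sigma> e"
        by (simp add: algebra_simps power2_eq_square)
      show ?thesis unfolding eq using s energy[OF e] A[OF e] B[OF e]
        by (intro add_mono mult_left_mono) auto
    qed
    from maximal[OF \<rho> this] have "s * (2 * (1 - s) * (B - V)) \<le> s * (s * (V - A))"
      by (simp add: algebra_simps power2_eq_square)
    then show ?thesis using s by simp
  qed
  have "((\<lambda>s. s * (V - A) - 2 * (1 - s) * (B - V)) \<longlongrightarrow> 0 * (V - A) - 2 * (1 - 0) * (B - V)) (at_right 0)"
    by (intro tendsto_intros)
  moreover have "\<forall>\<^sub>F s in at_right (0::real). 0 \<le> s * (V - A) - 2 * (1 - s) * (B - V)"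
    using eventually_at_right_less eventually_at_right[of 0 1 "\<lambda>s. s < 1", simplified]
    by (metis (mono_tags, lifting) diff_ge_0_iff_ge eventually_at_right_field key zero_less_one)
  ultimately have "0 \<le> 0 * (V - A) - 2 * (1 - 0) * (B - V)"
    by (intro tendsto_lowerbound) auto
  then show ?thesis by simp
qed

lemma no_atom: "measure \<mu> {x} = 0"
  using finite_energy_no_atom[OF bp bd energy] .

text \<open>A potential below \<open>V\<close> at \<open>x\<close> would stay below some
  \<open>v < V\<close> on a ball \<open>D\<close> of positive mass. The mass off \<open>D\<close>
  would then see a mean potential above \<open>V\<close>, and conditioning on it would contradict
  \<open>variational\<close>.\<close>

lemma trunc_pot_ge_on_support:
  assumes x: "\<And>r. 0 < r \<Longrightarrow> 0 < measure \<mu> (ball x r)" and e: "0 < e"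
  shows "V \<le> trunc_pot \<mu> e x"
proof (rule ccontr)
  assume "\<not> V \<le> trunc_pot \<mu> e x"
  then obtain v where v: "trunc_pot \<mu> e x < v" "v < V" using dense[of "trunc_pot \<mu> e x" V] by auto
  have "isCont (trunc_pot \<mu> e) x"
    using continuous_on_trunc_pot[OF bp bd e, of UNIV] continuous_on_eq_continuous_at[of UNIV] by auto
  then have "\<forall>\<^sub>F y in nhds x. trunc_pot \<mu> e y < v"
    using v by (intro order_tendstoD) (simp_all add: isCont_def tendsto_at_iff_tendsto_nhds)
  then obtain r where r: "0 < r" "\<And>y. y \<in> ball x r \<Longrightarrow> trunc_pot \<mu> e y < v"
    unfolding eventually_nhds_metric by (auto simp: dist_commute)
  define D where "D = ball x r"
  define b where "b = measure \<mu> D"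
  note \<mu> = bpD[OF bp]
  interpret prob_space \<mu> by fact
  have Dm: "D \<in> sets borel" "- D \<in> sets borel" by (auto simp: D_def)
  have b: "0 < b" "b \<le> 1" using x[OF r(1)] by (auto simp: b_def D_def)
  have iD: "(\<integral>z. indicator D z * trunc_pot \<mu> e' z \<partial>\<mu>) \<le> v * b" if e': "0 < e'" "e' \<le> e" for e'
  proof -
    have "(\<integral>z. indicator D z * trunc_pot \<mu> e' z \<partial>\<mu>) \<le> (\<integral>z. indicator D z * v \<partial>\<mu>)"
    proof (rule bp_integral_mono[OF bp])
      show "integrable \<mu> (\<lambda>z. indicator D z * trunc_pot \<mu> e' z)"
        using integrable_trunc_pot[OF bp bd bp bd e'(1)] by (rule bp_integrable_indicator[OF bp Dm(1)])
      show "integrable \<mu> (\<lambda>z. indicator D z * v)"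
        by (rule bp_integrable_indicator[OF bp Dm(1)]) simp
      show "indicator D t * trunc_pot \<mu> e' t \<le> indicator D t * v" for t
        using r(2)[of t] trunc_pot_mono[OF bp bd e', of t] by (auto simp: indicator_def D_def)
    qed
    also have "\<dots> = v * b" using Dm \<mu> by (simp add: b_def)
    finally show ?thesis .
  qed
  have split: "(\<integral>z. indicator D z * trunc_pot \<mu> e' z \<partial>\<mu>) + (\<integral>z. indicator (- D) z * trunc_pot \<mu> e' z \<partial>\<mu>) = trunc_energy \<mu> \<mu> e'"
    if e': "0 < e'" for e'
  proof -
    have i: "integrable \<mu> (trunc_pot \<mu> e')" using integrable_trunc_pot[OF bp bd bp bd e'] .
    have "trunc_energy \<mu> \<mu> e' = (\<integral>z. indicator D z * trunc_pot \<mu> e' z + indicator (- D) z * trunc_pot \<mu> e' z \<partial>\<mu>)"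
      unfolding trunc_energy_def by (intro Bochner_Integration.integral_cong) (auto simp: indicator_def)
    also have "\<dots> = (\<integral>z. indicator D z * trunc_pot \<mu> e' z \<partial>\<mu>) + (\<integral>z. indicator (- D) z * trunc_pot \<mu> e' z \<partial>\<mu>)"
      by (intro Bochner_Integration.integral_add bp_integrable_indicator[OF bp _ i] Dm)
    finally show ?thesis by simp
  qed
  have mc: "measure \<mu> (- D) = 1 - b"
    using prob_compl[of D] Dm \<mu> by (simp add: b_def Compl_eq_Diff_UNIV)
  \<comment> \<open>The complement of \<open>D\<close> has positive mass; otherwise the whole energy
    would be at most \<open>v\<close>.\<close>
  have b1: "b < 1"
  proof (rule ccontr)
    assume "\<not> b < 1"
    then have "measure \<mu> (- D) = 0" using mc b by simp
    then have "AE z in \<mu>. z \<notin> - D" using Dm \<mu> prob_eq_0[of "- D"] by simp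
    then have "(\<integral>z. indicator (- D) z * trunc_pot \<mu> e z \<partial>\<mu>) = 0"
      by (intro integral_eq_zero_AE) (auto elim: eventually_mono)
    with split[OF e] iD[OF e order_refl] energy[OF e] have "V \<le> v * b" by simp
    with \<open>\<not> b < 1\<close> b v show False by simp
  qed
  define \<nu> where "\<nu> = uniform_measure \<mu> (- D)"
  have pos: "0 < measure \<mu> (- D)" using mc b1 by simp
  have \<nu>: "\<nu> \<in> borel_probabilities_on E"
    unfolding \<nu>_def using \<mu>(5) by (intro bp_mono[OF uniform_measure_bp[OF bp Dm(2) pos]]) auto
  obtain A where A: "\<And>e. 0 < e \<Longrightarrow> A \<le> trunc_energy \<nu> \<nu> e"
    using uniform_measure_finite_energy[OF bp bd Dm(2) pos energy] unfolding \<nu>_def by blast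
  \<comment> \<open>Since \<open>v < V\<close> and \<open>0 < b\<close>, the left side exceeds
    \<open>V\<close>.\<close>
  have J: "(V - v * b) / (1 - b) \<le> trunc_energy \<mu> \<nu> e'" if e': "0 < e'" for e'
  proof -
    define d where "d = min e e'"
    have d: "0 < d" "d \<le> e" "d \<le> e'" using e e' by (auto simp: d_def)
    have "trunc_energy \<mu> \<nu> d = (\<integral>z. indicator (- D) z * trunc_pot \<mu> d z \<partial>\<mu>) / (1 - b)"
      unfolding trunc_energy_def \<nu>_def mc[symmetric]
      by (rule integral_uniform_bp[OF bp Dm(2) pos trunc_pot_measurable[OF bp bd d(1)]])
    moreover have "V - v * b \<le> (\<integral>z. indicator (- D) z * trunc_pot \<mu> d z \<partial>\<mu>)"
      using split[OF d(1)] iD[OF d(1,2)] energy[OF d(1)] by linarith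
    ultimately have "(V - v * b) / (1 - b) \<le> trunc_energy \<mu> \<nu> d"
      using b1 by (simp add: divide_right_mono)
    also have "\<dots> \<le> trunc_energy \<mu> \<nu> e'" using d by (intro trunc_energy_mono[OF bp bd \<nu> bd])
    finally show ?thesis .
  qed
  have "(V - v * b) / (1 - b) \<le> V" using variational[OF \<nu> A J] .
  then have "V - v * b \<le> V * (1 - b)" using b1 by (simp add: divide_le_eq)
  then have "V * b \<le> v * b" by (simp add: algebra_simps)
  then show False using b v by simp
qed

end

section \<open>The maximum principle\<close>

abbreviation circle_avg :: "(complex \<Rightarrow> real) \<Rightarrow> complex \<Rightarrow> real \<Rightarrow> real" where
  "circle_avg f a r \<equiv> (\<integral>\<theta>. f (a + of_real r * cis \<theta>) \<partial>uniform_measure lborel {0..2*pi})"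

lemma angle_in_sphere: "0 \<le> r \<Longrightarrow> a + of_real r * cis \<theta> \<in> sphere a r"
  by (simp add: dist_norm norm_mult)

lemma integrable_circle_avg:
  fixes f :: "complex \<Rightarrow> real"
  assumes "continuous_on (sphere a r) f" "0 \<le> r"
  shows "integrable (uniform_measure lborel {0..2*pi}) (\<lambda>\<theta>. f (a + of_real r * cis \<theta>))"
proof -
  interpret U: prob_space "uniform_measure lborel {0..2*pi::real}" by (rule prob_space_uniform_angle)
  have "continuous_on UNIV (\<lambda>\<theta>. f (a + of_real r * cis \<theta>))"
    using assms angle_in_sphere by (intro continuous_on_compose2[OF assms(1)] continuous_intros) auto
  then have m: "(\<lambda>\<theta>. f (a + of_real r * cis \<theta>)) \<in> borel_measurable borel"
    by (rule borel_measurable_continuous_onI)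
  have "compact (f ` sphere a r)" using assms by (intro compact_continuous_image) auto
  then have "bounded (f ` sphere a r)" by (rule compact_imp_bounded)
  then obtain B where "\<And>y. y \<in> f ` sphere a r \<Longrightarrow> norm y \<le> B" unfolding bounded_iff by blast
  then have "\<bar>f (a + of_real r * cis \<theta>)\<bar> \<le> B" for \<theta> using angle_in_sphere[OF assms(2), of a \<theta>] by force
  then show ?thesis using m by (intro U.integrable_const_bound[where B = B]) auto
qed

lemma circle_avg_const: "circle_avg (\<lambda>_. c) a r = c"
  using prob_space.prob_space[OF prob_space_uniform_angle] by simp

lemma circle_avg_add:
  assumes "continuous_on (sphere a r) f" "continuous_on (sphere a r) g" "0 \<le> r"
  shows "circle_avg (\<lambda>z. f z + g z) a r = circle_avg f a r + circle_avg g a r"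
  using assms by (intro Bochner_Integration.integral_add integrable_circle_avg)

lemma circle_avg_mult: "circle_avg (\<lambda>z. c * f z) a r = c * circle_avg f a r"
  by simp

lemma circle_avg_mono:
  assumes "continuous_on (sphere a r) f" "continuous_on (sphere a r) g" "0 \<le> r"
    "\<And>z. z \<in> sphere a r \<Longrightarrow> f z \<le> g z"
  shows "circle_avg f a r \<le> circle_avg g a r"
  using assms angle_in_sphere by (intro integral_mono integrable_circle_avg) auto

lemma circle_avg_norm_square:
  assumes "0 < r"
  shows "circle_avg (\<lambda>z. (cmod z)\<^sup>2) a r = (cmod a)\<^sup>2 + r\<^sup>2"
proof -
  \<comment> \<open>For \<open>|w| = r\<close>, expanding \<open>|a + w|^2\<close> gives
    \<open>|a|^2 + r^2 + 2 Re (cnj a * w)\<close>, on the circle the real part of an entire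
    function.\<close>
  define f where "f z = of_real ((cmod a)\<^sup>2 + r\<^sup>2) + 2 * cnj a * (z - a)" for z
  have "(cmod (a + of_real r * cis \<theta>))\<^sup>2 = Re (f (a + of_real r * cis \<theta>))" for \<theta>
  proof -
    have "(cmod (a + of_real r * cis \<theta>))\<^sup>2 = (Re a + r * cos \<theta>)\<^sup>2 + (Im a + r * sin \<theta>)\<^sup>2"
      by (simp add: cmod_power2)
    also have "\<dots> = (Re a)\<^sup>2 + (Im a)\<^sup>2 + r\<^sup>2 * ((cos \<theta>)\<^sup>2 + (sin \<theta>)\<^sup>2) + 2 * (Re a * (r * cos \<theta>) + Im a * (r * sin \<theta>))"
      by (simp add: power2_eq_square algebra_simps del: sin_cos_squared_add2 sin_cos_squared_add3)
    also have "\<dots> = Re (f (a + of_real r * cis \<theta>))"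
      by (simp add: f_def cmod_power2)
    finally show ?thesis .
  qed
  then have "circle_avg (\<lambda>z. (cmod z)\<^sup>2) a r = (\<integral>\<theta>. Re (f (a + of_real r * cis \<theta>)) \<partial>uniform_measure lborel {0..2*pi})" by simp
  also have "\<dots> = Re (f a)" using assms by (intro circle_mean_holomorphic) (auto simp: f_def intro!: holomorphic_intros)
  finally show ?thesis by (simp add: f_def)
qed

text \<open>
  The submean inequality tested against continuous majorants on circles, so that no integral of
  the function itself, which may be \<open>-\<infinity>\<close>, is needed.
\<close>

definition submean_at :: "(complex \<Rightarrow> ereal) \<Rightarrow> complex \<Rightarrow> bool" where
  "submean_at u z \<longleftrightarrow> (\<exists>\<rho>>0. \<forall>r. 0 < r \<and> r < \<rho> \<longrightarrow>
     (\<forall>k. continuous_on (sphere z r) k \<longrightarrow> (\<forall>w\<in>sphere z r. u w \<le> ereal (k w)) \<longrightarrow> u z \<le> ereal (circle_avg k z r)))"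

text \<open>Harmonicity in the form that potentials satisfy by Fubini and that the maximum principle
  consumes: continuity and the mean value property on small circles.\<close>

definition mean_harmonic :: "complex set \<Rightarrow> (complex \<Rightarrow> real) \<Rightarrow> bool" where
  "mean_harmonic D H \<longleftrightarrow> continuous_on D H \<and>
     (\<forall>z\<in>D. \<exists>\<rho>>0. ball z \<rho> \<subseteq> D \<and> (\<forall>r. 0 < r \<and> r < \<rho> \<longrightarrow> circle_avg H z r = H z))"

lemma sphere_subset_ball: "r < \<rho> \<Longrightarrow> sphere z r \<subseteq> ball z \<rho>"
  by auto

lemma mean_harmonic_subset:
  assumes "mean_harmonic D H" "D' \<subseteq> D" "open D'"
  shows "mean_harmonic D' H"
  unfolding mean_harmonic_def
proof (intro conjI ballI)
  show "continuous_on D' H" using assms continuous_on_subset by (auto simp: mean_harmonic_def)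
  fix z assume z: "z \<in> D'"
  then obtain \<rho> where \<rho>: "\<rho> > 0" "\<forall>r. 0 < r \<and> r < \<rho> \<longrightarrow> circle_avg H z r = H z"
    using assms(1,2) unfolding mean_harmonic_def by blast
  obtain \<rho>' where \<rho>': "\<rho>' > 0" "ball z \<rho>' \<subseteq> D'" using openE[OF assms(3) z] by blast
  show "\<exists>\<rho>>0. ball z \<rho> \<subseteq> D' \<and> (\<forall>r. 0 < r \<and> r < \<rho> \<longrightarrow> circle_avg H z r = H z)"
    using \<rho> \<rho>' by (intro exI[of _ "min \<rho> \<rho>'"]) (auto simp: subset_iff)
qed

lemma mean_harmonic_add:
  assumes "mean_harmonic D H" "mean_harmonic D K"
  shows "mean_harmonic D (\<lambda>z. H z + K z)"
  unfolding mean_harmonic_def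
proof (intro conjI ballI)
  have c: "continuous_on D H" "continuous_on D K" using assms by (auto simp: mean_harmonic_def)
  then show "continuous_on D (\<lambda>z. H z + K z)" by (intro continuous_intros)
  fix z assume "z \<in> D"
  obtain \<rho> where 1: "\<rho> > 0" "ball z \<rho> \<subseteq> D" "\<forall>r. 0 < r \<and> r < \<rho> \<longrightarrow> circle_avg H z r = H z"
    using assms(1) \<open>z \<in> D\<close> unfolding mean_harmonic_def by blast
  obtain \<rho>' where 2: "\<rho>' > 0" "ball z \<rho>' \<subseteq> D" "\<forall>r. 0 < r \<and> r < \<rho>' \<longrightarrow> circle_avg K z r = K z"
    using assms(2) \<open>z \<in> D\<close> unfolding mean_harmonic_def by blast
  note \<rho> = 1 2
  have "circle_avg (\<lambda>z. H z + K z) z r = H z + K z" if "0 < r" "r < min \<rho> \<rho>'" for r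
  proof -
    have "sphere z r \<subseteq> D" using sphere_subset_ball[of r \<rho> z] that \<rho> by auto
    then have "circle_avg (\<lambda>z. H z + K z) z r = circle_avg H z r + circle_avg K z r"
      using that by (intro circle_avg_add continuous_on_subset[OF c(1)] continuous_on_subset[OF c(2)]) auto
    then show ?thesis using \<rho> that by simp
  qed
  then show "\<exists>\<rho>>0. ball z \<rho> \<subseteq> D \<and> (\<forall>r. 0 < r \<and> r < \<rho> \<longrightarrow> circle_avg (\<lambda>z. H z + K z) z r = H z + K z)"
    using \<rho> by (intro exI[of _ "min \<rho> \<rho>'"]) auto
qed

lemma mean_harmonic_const: "open D \<Longrightarrow> mean_harmonic D (\<lambda>_. c)"
  unfolding mean_harmonic_def circle_avg_const using openE[of D] by (metis continuous_on_const)

lemma mean_harmonic_mult: "mean_harmonic D H \<Longrightarrow> mean_harmonic D (\<lambda>z. c * H z)"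
  unfolding mean_harmonic_def by (fastforce intro!: continuous_intros)

text \<open>
  Adding \<open>\<delta> |z|\<^sup>2\<close> to \<open>u - H\<close> makes the submean inequality strict, which excludes an interior maximum
  without any connectedness argument.
\<close>

theorem maximum_principle:
  fixes u :: "complex \<Rightarrow> ereal" and H :: "complex \<Rightarrow> real"
  assumes D: "open D" "bounded D" and H: "mean_harmonic D H"
    and fin: "\<And>z. z \<in> D \<Longrightarrow> u z < \<infinity>"
    and usc: "\<And>z a. z \<in> D \<Longrightarrow> u z < a \<Longrightarrow> \<forall>\<^sub>F w in at z within D. u w < a"
    and sub: "\<And>z. z \<in> D \<Longrightarrow> submean_at u z"
    and bdry: "\<And>x \<epsilon>. x \<in> frontier D \<Longrightarrow> 0 < \<epsilon> \<Longrightarrow> \<forall>\<^sub>F w in at x within D. u w \<le> ereal (H w + \<epsilon>)"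
    and z1: "z1 \<in> D"
  shows "u z1 \<le> ereal (H z1)"
proof (rule ccontr)
  assume "\<not> u z1 \<le> ereal (H z1)"
  then have "ereal (H z1) < u z1" by (simp only: not_le)
  from ereal_dense2[OF this]
  obtain v where v: "ereal (H z1) < ereal v" "ereal v < u z1" by blast
  obtain R where R: "\<And>z. z \<in> D \<Longrightarrow> cmod z \<le> R" "R \<ge> 0"
    using D(2) bounded_pos[of D] by (metis less_imp_le)
  \<comment> \<open>The excess at \<open>z1\<close> is more than \<open>2 \<eta>\<close>, the
    perturbation is at most \<open>\<eta>\<close> on \<open>D\<close>, and the boundary condition is
    used with error \<open>\<eta> / 2\<close>. Near the boundary the perturbed difference
    \<open>g\<close> is thus at most \<open>3/2 \<eta>\<close>, below its supremum.\<close>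
  define \<eta> where "\<eta> = (v - H z1) / 2"
  have \<eta>: "\<eta> > 0" using v by (simp add: \<eta>_def)
  define \<delta> where "\<delta> = \<eta> / (R\<^sup>2 + 1)"
  have \<delta>: "\<delta> > 0" "\<delta> * R\<^sup>2 \<le> \<eta>"
  proof -
    have p: "R\<^sup>2 + 1 > 0" by (simp add: add_nonneg_pos)
    then show "\<delta> > 0" using \<eta> by (simp add: \<delta>_def)
    have "R\<^sup>2 / (R\<^sup>2 + 1) \<le> 1" using p by simp
    then have "\<eta> * (R\<^sup>2 / (R\<^sup>2 + 1)) \<le> \<eta> * 1" using \<eta> by (intro mult_left_mono) auto
    then show "\<delta> * R\<^sup>2 \<le> \<eta>" by (simp add: \<delta>_def)
  qed
  have sq: "\<delta> * (cmod z)\<^sup>2 \<le> \<eta>" if "z \<in> D" for z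
  proof -
    have "\<delta> * (cmod z)\<^sup>2 \<le> \<delta> * R\<^sup>2" using \<delta> R(1)[OF that] R(2) by (intro mult_left_mono power_mono) auto
    then show ?thesis using \<delta> by linarith
  qed
  define K where "K z = H z - \<delta> * (cmod z)\<^sup>2" for z
  have Hc: "continuous_on D H" using H by (simp add: mean_harmonic_def)
  have Kc: "continuous_on D K" unfolding K_def using Hc by (intro continuous_intros)
  define g where "g z = u z - ereal (K z)" for z
  define M where "M = (SUP z\<in>D. g z)"
  have g_lt: "g z < a \<longleftrightarrow> u z < a + ereal (K z)" for z a
    unfolding g_def by (cases "u z"; cases a) (auto simp: less_diff_eq)
  \<comment> \<open>A maximising sequence accumulates in the closure of \<open>D\<close>. The
    boundary estimate excludes a limit on the frontier, and upper semicontinuity makes an interior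
    limit a maximum point.\<close>
  have "\<exists>f::nat \<Rightarrow> ereal. incseq f \<and> range f \<subseteq> g ` D \<and> Sup (g ` D) = (SUP i. f i)"
    using z1 by (intro Sup_countable_SUP) auto
  then obtain f :: "nat \<Rightarrow> ereal" where f: "incseq f" "range f \<subseteq> g ` D" "M = (SUP i. f i)"
    unfolding M_def by blast
  then have "\<forall>n. \<exists>z. z \<in> D \<and> f n = g z" by blast
  then obtain zs where zs: "\<And>n. zs n \<in> D" "\<And>n. f n = g (zs n)" by metis
  have lim: "(\<lambda>n. g (zs n)) \<longlonglongrightarrow> M" using LIMSEQ_SUP[OF f(1)] unfolding zs(2)[symmetric] f(3) .
  have "compact (closure D)" using D by simp
  moreover have "\<forall>n. zs n \<in> closure D" using zs(1) closure_subset by blast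
  ultimately obtain x s where x: "x \<in> closure D" "strict_mono s" "(zs \<circ> s) \<longlonglongrightarrow> x"
    unfolding compact_def by metis
  have lims: "(\<lambda>n. g (zs (s n))) \<longlonglongrightarrow> M" using LIMSEQ_subseq_LIMSEQ[OF lim x(2)] by (simp add: o_def)
  have zx: "(\<lambda>n. zs (s n)) \<longlonglongrightarrow> x" using x(3) by (simp add: o_def)
  have gM: "g z \<le> M" if "z \<in> D" for z unfolding M_def using that by (intro SUP_upper)
  have "ereal (2 * \<eta>) < g z1"
  proof -
    have "ereal (2 * \<eta>) = ereal v - ereal (H z1)" by (simp add: \<eta>_def)
    also have "\<dots> < u z1 - ereal (H z1)" using v by (cases "u z1") auto
    also have "\<dots> \<le> g z1" unfolding g_def K_def using \<delta> by (intro ereal_minus_mono) auto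
    finally show ?thesis .
  qed
  then have M: "ereal (2 * \<eta>) < M" using gM[OF z1] by simp
  have "x \<in> D"
  proof (rule ccontr)
    assume "x \<notin> D"
    then have "x \<in> frontier D" using x(1) D by (simp add: frontier_def interior_open)
    then have "\<forall>\<^sub>F w in at x within D. u w \<le> ereal (H w + \<eta> / 2)" using \<eta> by (intro bdry) auto
    moreover have "filterlim (\<lambda>n. zs (s n)) (at x within D) sequentially"
      using zx zs(1) \<open>x \<notin> D\<close> unfolding filterlim_at by (auto intro!: always_eventually)
    ultimately have "\<forall>\<^sub>F n in sequentially. u (zs (s n)) \<le> ereal (H (zs (s n)) + \<eta> / 2)"
      by (rule eventually_compose_filterlim)
    then have "\<forall>\<^sub>F n in sequentially. g (zs (s n)) \<le> ereal (3 / 2 * \<eta>)"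
    proof eventually_elim
      case (elim n)
      have "g (zs (s n)) \<le> ereal (H (zs (s n)) + \<eta> / 2) - ereal (K (zs (s n)))"
        unfolding g_def using elim by (intro ereal_minus_mono) auto
      also have "\<dots> \<le> ereal (3 / 2 * \<eta>)" using sq[OF zs(1), of "s n"] by (simp add: K_def)
      finally show ?case .
    qed
    then have "M \<le> ereal (3 / 2 * \<eta>)" using lims by (intro tendsto_upperbound[OF lims]) auto
    then have "M \<le> ereal (2 * \<eta>)" using \<eta> by (elim order_trans) simp
    with M show False by simp
  qed
  have gx: "g x = M"
  proof (rule antisym[OF gM[OF \<open>x \<in> D\<close>]], rule ccontr)
    assume "\<not> M \<le> g x"
    then have "g x < M" by (simp only: not_le)
    from ereal_dense2[OF this] obtain a where a: "g x < ereal a" "ereal a < M" by blast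
    then have "u x < ereal (a + K x)" by (simp add: g_lt)
    from ereal_dense2[OF this] obtain b where b: "u x < ereal b" "ereal b < ereal (a + K x)" by blast
    have e1: "\<forall>\<^sub>F w in at x within D. u w < ereal b" using usc[OF \<open>x \<in> D\<close> b(1)] .
    have "(K \<longlongrightarrow> K x) (at x within D)" using Kc \<open>x \<in> D\<close> by (simp add: continuous_on_def)
    then have e2: "\<forall>\<^sub>F w in at x within D. b - a < K w" using b by (intro order_tendstoD) auto
    from e1 e2 have "\<forall>\<^sub>F w in at x within D. g w < ereal a"
    proof eventually_elim
      case (elim w)
      then have "u w < ereal a + ereal (K w)" by (cases "u w") auto
      then show ?case by (simp add: g_lt)
    qed
    then have "\<forall>\<^sub>F w in nhds x. w \<in> D \<longrightarrow> g w < ereal a"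
      using a(1) unfolding eventually_at_filter by (auto elim!: eventually_mono)
    then have "\<forall>\<^sub>F n in sequentially. zs (s n) \<in> D \<longrightarrow> g (zs (s n)) < ereal a"
      using zx by (rule eventually_compose_filterlim)
    then have "\<forall>\<^sub>F n in sequentially. g (zs (s n)) \<le> ereal a" using zs(1) by (auto elim!: eventually_mono)
    then have "M \<le> ereal a" by (intro tendsto_upperbound[OF lims]) auto
    with a(2) show False by simp
  qed
  have "M < \<infinity>" using gx fin[OF \<open>x \<in> D\<close>] by (cases "u x") (auto simp: g_def)
  then obtain m where m: "M = ereal m" using M by (cases M) auto
  have ule: "u w \<le> ereal (m + K w)" if "w \<in> D" for w
    using gM[OF that] unfolding g_def m by (cases "u w") (auto simp: algebra_simps)
  have ux: "u x = ereal (m + K x)" using gx unfolding g_def m by (cases "u x") (auto simp: algebra_simps)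
  obtain \<rho> where \<rho>: "\<rho> > 0" "\<And>r k. 0 < r \<Longrightarrow> r < \<rho> \<Longrightarrow> continuous_on (sphere x r) k \<Longrightarrow>
      (\<forall>w\<in>sphere x r. u w \<le> ereal (k w)) \<Longrightarrow> u x \<le> ereal (circle_avg k x r)"
    using sub[OF \<open>x \<in> D\<close>] unfolding submean_at_def by blast
  obtain \<rho>' where \<rho>': "\<rho>' > 0" "ball x \<rho>' \<subseteq> D" "\<And>r. 0 < r \<Longrightarrow> r < \<rho>' \<Longrightarrow> circle_avg H x r = H x"
    using H \<open>x \<in> D\<close> unfolding mean_harmonic_def by blast
  define r where "r = min \<rho> \<rho>' / 2"
  have r: "0 < r" "r < \<rho>" "r < \<rho>'" using \<rho> \<rho>' by (auto simp: r_def min_def)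
  have sD: "sphere x r \<subseteq> D" using sphere_subset_ball[OF r(3), of x] \<rho>'(2) by blast
  have "continuous_on (sphere x r) (\<lambda>w. m + K w)"
    using sD by (intro continuous_intros continuous_on_subset[OF Kc])
  then have "u x \<le> ereal (circle_avg (\<lambda>w. m + K w) x r)"
    using ule sD by (intro \<rho>(2) r) auto
  also have "circle_avg (\<lambda>w. m + K w) x r = circle_avg (\<lambda>w. m + (H w + (- \<delta>) * (cmod w)\<^sup>2)) x r"
    by (simp add: K_def)
  also have "\<dots> = m + (H x + (- \<delta>) * ((cmod x)\<^sup>2 + r\<^sup>2))"
  proof -
    have cH: "continuous_on (sphere x r) H" using sD by (rule continuous_on_subset[OF Hc])
    have cq: "continuous_on (sphere x r) (\<lambda>w. (- \<delta>) * (cmod w)\<^sup>2)" by (intro continuous_intros)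
    have cs: "continuous_on (sphere x r) (\<lambda>w. H w + (- \<delta>) * (cmod w)\<^sup>2)"
      using cH cq by (intro continuous_on_add)
    have "circle_avg (\<lambda>w. m + (H w + (- \<delta>) * (cmod w)\<^sup>2)) x r
        = circle_avg (\<lambda>_. m) x r + (circle_avg H x r + circle_avg (\<lambda>w. (- \<delta>) * (cmod w)\<^sup>2) x r)"
      using r by (simp only: circle_avg_add[OF continuous_on_const cs less_imp_le[OF r(1)]]
          circle_avg_add[OF cH cq less_imp_le[OF r(1)]])
    also have "circle_avg (\<lambda>w. (- \<delta>) * (cmod w)\<^sup>2) x r = (- \<delta>) * ((cmod x)\<^sup>2 + r\<^sup>2)"
      unfolding circle_avg_mult[where f = "\<lambda>w. (cmod w)\<^sup>2"] by (simp only: circle_avg_norm_square[OF r(1)])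
    finally show ?thesis unfolding circle_avg_const \<rho>'(3)[OF r(1,3)] .
  qed
  \<comment> \<open>The circle mean of \<open>K\<close> falls short of \<open>K x\<close> by exactly
    \<open>\<delta> * r^2\<close>, while the submean inequality at the maximum allows no
    shortfall.\<close>
  finally have "m + K x \<le> m + (H x + (- \<delta>) * ((cmod x)\<^sup>2 + r\<^sup>2))" unfolding ux by simp
  then have "\<delta> * r\<^sup>2 \<le> 0" by (simp add: K_def algebra_simps)
  with \<delta>(1) r(1) show False by (simp add: mult_le_0_iff)
qed

text \<open>The domain is cut off at radius \<open>R + 1\<close>; the extra 1 places a whole
  neighbourhood of the new boundary circle in the range of the hypothesis at infinity.\<close>

corollary maximum_principle_unbounded:
  fixes u :: "complex \<Rightarrow> ereal" and H :: "complex \<Rightarrow> real"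
  assumes D: "open D" and H: "mean_harmonic D H"
    and fin: "\<And>z. z \<in> D \<Longrightarrow> u z < \<infinity>"
    and usc: "\<And>z a. z \<in> D \<Longrightarrow> u z < a \<Longrightarrow> \<forall>\<^sub>F w in at z within D. u w < a"
    and sub: "\<And>z. z \<in> D \<Longrightarrow> submean_at u z"
    and bdry: "\<And>x \<epsilon>. x \<in> frontier D \<Longrightarrow> 0 < \<epsilon> \<Longrightarrow> \<forall>\<^sub>F w in at x within D. u w \<le> ereal (H w + \<epsilon>)"
    and inf: "\<And>z. z \<in> D \<Longrightarrow> R \<le> cmod z \<Longrightarrow> u z \<le> ereal (H z)"
    and z1: "z1 \<in> D"
  shows "u z1 \<le> ereal (H z1)"
proof (cases "R \<le> cmod z1")
  case True
  then show ?thesis using inf z1 by simp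
next
  case False
  define D' where "D' = D \<inter> ball 0 (R + 1)"
  have D': "open D'" "bounded D'" "D' \<subseteq> D" using D by (auto simp: D'_def bounded_Int)
  show ?thesis
  proof (rule maximum_principle[OF D'(1,2)])
    show "mean_harmonic D' H" using mean_harmonic_subset[OF H D'(3,1)] .
    show "z1 \<in> D'" using z1 False by (simp add: D'_def)
    fix x and \<epsilon> :: real assume x: "x \<in> frontier D'" and \<epsilon>: "0 < \<epsilon>"
    have "x \<in> frontier D \<or> x \<in> frontier (ball 0 (R + 1))"
      using x frontier_Int_subset[of D "ball 0 (R + 1)"] by (auto simp: D'_def)
    then show "\<forall>\<^sub>F w in at x within D'. u w \<le> ereal (H w + \<epsilon>)"
    proof
      assume "x \<in> frontier D"
      from bdry[OF this \<epsilon>] at_le[OF D'(3), of x] show ?thesis by (rule filter_leD[rotated])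
    next
      assume x: "x \<in> frontier (ball 0 (R + 1))"
      have "x \<in> sphere 0 (R + 1)" 
      proof (cases "R + 1 > 0")
        case True then show ?thesis using x by simp
      next
        case False then have "ball 0 (R + 1) = ({} :: complex set)" by simp
        then show ?thesis using x by (simp only: frontier_empty empty_iff)
      qed
      then have "\<forall>\<^sub>F w in nhds x. R < cmod w"
        by (intro order_tendstoD(1)[of _ "cmod x"] tendsto_intros filterlim_ident) auto
      then have "\<forall>\<^sub>F w in at x within D'. w \<in> D' \<and> R < cmod w"
        unfolding eventually_at_filter by (auto elim: eventually_mono)
      then show ?thesis
      proof eventually_elim
        case (elim w)
        then have "u w \<le> ereal (H w)" using inf D'(3) by auto
        also have "\<dots> \<le> ereal (H w + \<epsilon>)" using \<epsilon> by simp
        finally show ?case .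
      qed
    qed
  next
    fix z a assume "z \<in> D'" "u z < a"
    then have "\<forall>\<^sub>F w in at z within D. u w < a" using usc D'(3) by auto
    then show "\<forall>\<^sub>F w in at z within D'. u w < a" using at_le[OF D'(3), of z] by (rule filter_leD[rotated])
  qed (use fin sub D'(3) in auto)
qed

text \<open>Because \<open>ln 0 = 0\<close>, this is the mathematical potential only where
  \<open>z\<close> carries no mass of \<open>\<mu>\<close>, and it is relied on only there.\<close>

definition log_pot :: "complex measure \<Rightarrow> complex \<Rightarrow> real" where
  "log_pot \<mu> z = (\<integral>t. ln (cmod (z - t)) \<partial>\<mu>)"

lemma ln_cmod_measurable [measurable]: "(\<lambda>t. ln (cmod (z - t))) \<in> borel_measurable borel"
  by measurable

lemma log_pot_eq_trunc_pot:
  assumes "\<mu> \<in> borel_probabilities_on K" "\<And>t. t \<in> K \<Longrightarrow> e \<le> cmod (z - t)"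
  shows "log_pot \<mu> z = trunc_pot \<mu> e z"
  unfolding log_pot_def trunc_pot_def using assms(2)
  by (intro bp_integral_cong[OF assms(1)]) (auto simp: trunc_log_eq_ln)

text \<open>On a small ball away from \<open>K\<close> the truncation is inactive, so the potential
  is the Lipschitz function \<open>trunc_pot \<mu> d\<close>. Its circle mean is an energy;
  exchanging the two measures leaves the potential of the circle, which is \<open>ln |z - t|\<close>
  for every \<open>t\<close> in \<open>K\<close>.\<close>

lemma mean_harmonic_log_pot:
  assumes "\<mu> \<in> borel_probabilities_on K" "bounded K" "closed K"
  shows "mean_harmonic (- K) (log_pot \<mu>)"
proof -
  have loc: "\<exists>d>0. ball z (2 * d) \<subseteq> - K \<and> (\<forall>w\<in>ball z d. log_pot \<mu> w = trunc_pot \<mu> d w)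
      \<and> (\<forall>r. 0 < r \<and> r < d \<longrightarrow> circle_avg (log_pot \<mu>) z r = log_pot \<mu> z)" if z: "z \<in> - K" for z
  proof -
    obtain e where e: "e > 0" "ball z e \<subseteq> - K" using assms(3) z openE[of "- K" z] by (auto simp: open_Compl)
    define d where "d = e / 2"
    have d: "d > 0" "ball z (2 * d) \<subseteq> - K" using e by (auto simp: d_def)
    have far: "2 * d \<le> cmod (z - t)" if "t \<in> K" for t
      using d(2) that by (force simp: dist_norm)
    have eq: "log_pot \<mu> w = trunc_pot \<mu> d w" if "w \<in> ball z d" for w
    proof (rule log_pot_eq_trunc_pot[OF assms(1)])
      fix t assume "t \<in> K"
      have "cmod (z - t) \<le> cmod (z - w) + cmod (w - t)" using norm_triangle_ineq[of "z - w" "w - t"] by simp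
      then show "d \<le> cmod (w - t)" using far[OF \<open>t \<in> K\<close>] that by (simp add: dist_norm)
    qed
    have "circle_avg (log_pot \<mu>) z r = log_pot \<mu> z" if r: "0 < r" "r < d" for r
    proof -
      have c: "circle_measure z r \<in> borel_probabilities_on (sphere z r)" using r by (intro circle_measure_bp) auto
      have "circle_avg (log_pot \<mu>) z r = circle_avg (trunc_pot \<mu> d) z r"
        using r by (intro Bochner_Integration.integral_cong refl eq) (simp add: dist_norm norm_mult)
      also have "\<dots> = trunc_energy \<mu> (circle_measure z r) d"
        unfolding trunc_energy_def using trunc_pot_measurable[OF assms(1,2) d(1)] by (simp add: integral_circle_measure)
      also have "\<dots> = trunc_energy (circle_measure z r) \<mu> d"
        using c assms d by (intro trunc_energy_commute[OF assms(1,2) c]) auto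
      also have "\<dots> = log_pot \<mu> z" unfolding trunc_energy_def log_pot_def
      proof (rule bp_integral_cong[OF assms(1)])
        show "trunc_pot (circle_measure z r) d \<in> borel_measurable borel" using d by (intro trunc_pot_measurable[OF c]) auto
        fix t assume "t \<in> K"
        then have f: "2 * d \<le> cmod (z - t)" using far by simp
        then have "trunc_pot (circle_measure z r) d t = trunc_log r z t" using r d by (intro trunc_pot_circle_measure_eq) auto
        then show "trunc_pot (circle_measure z r) d t = ln (cmod (z - t))" using f r d by (simp add: trunc_log_eq_ln)
      qed simp
      finally show ?thesis .
    qed
    then show ?thesis using d eq by blast
  qed
  show ?thesis unfolding mean_harmonic_def
  proof (intro conjI ballI)
    show "continuous_on (- K) (log_pot \<mu>)"
    proof (rule continuous_at_imp_continuous_on, rule ballI)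
      fix z assume "z \<in> - K"
      then obtain d where d: "d > 0" "\<forall>w\<in>ball z d. log_pot \<mu> w = trunc_pot \<mu> d w" using loc by blast
      have "continuous_on (ball z d) (log_pot \<mu>)"
        using d continuous_on_trunc_pot[OF assms(1,2) d(1), of "ball z d"] by (subst continuous_on_cong[OF refl]) auto
      then show "isCont (log_pot \<mu>) z" using d by (simp add: continuous_on_eq_continuous_at)
    qed
    fix z assume "z \<in> - K"
    then obtain d where d: "d > 0" "ball z (2 * d) \<subseteq> - K" "\<forall>r. 0 < r \<and> r < d \<longrightarrow> circle_avg (log_pot \<mu>) z r = log_pot \<mu> z"
      using loc by blast
    moreover have "ball z d \<subseteq> ball z (2 * d)" using d by (intro subset_ball) auto
    ultimately show "\<exists>\<rho>>0. ball z \<rho> \<subseteq> - K \<and> (\<forall>r. 0 < r \<and> r < \<rho> \<longrightarrow> circle_avg (log_pot \<mu>) z r = log_pot \<mu> z)" by blast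
  qed
qed

lemma log_pot_growth:
  assumes "\<mu> \<in> borel_probabilities_on K" "\<And>t. t \<in> K \<Longrightarrow> cmod t \<le> R" "R < cmod z" "0 \<le> R"
  shows "ln (cmod z - R) \<le> log_pot \<mu> z" "log_pot \<mu> z \<le> ln (cmod z + R)"
proof -
  have b: "cmod z - R \<le> cmod (z - t)" "cmod (z - t) \<le> cmod z + R" if "t \<in> K" for t
    using norm_triangle_ineq2[of z t] norm_triangle_ineq4[of z t] assms(2)[OF that] by auto
  have m: "ln (cmod z - R) \<le> ln (cmod (z - t))" "ln (cmod (z - t)) \<le> ln (cmod z + R)" if "t \<in> K" for t
    using b[OF that] assms(3,4) by (auto intro!: ln_mono)
  have i: "integrable \<mu> (\<lambda>t. ln (cmod (z - t)))"
  proof (rule bp_integrable[OF assms(1), where B = "\<bar>ln (cmod z - R)\<bar> + \<bar>ln (cmod z + R)\<bar>"])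
    fix t assume "t \<in> K"
    then show "\<bar>ln (cmod (z - t))\<bar> \<le> \<bar>ln (cmod z - R)\<bar> + \<bar>ln (cmod z + R)\<bar>" using m[of t] by linarith
  qed simp
  show "ln (cmod z - R) \<le> log_pot \<mu> z" unfolding log_pot_def
    using m by (intro bp_integral_ge_const[OF assms(1) i]) auto
  show "log_pot \<mu> z \<le> ln (cmod z + R)" unfolding log_pot_def
    using m by (intro bp_integral_le_const[OF assms(1) i]) auto
qed

lemma submean_at_const: "submean_at (\<lambda>_. ereal c) z"
  unfolding submean_at_def
proof (intro exI[of _ 1] conjI allI impI)
  fix r k assume r: "0 < r \<and> r < (1::real)" and k: "continuous_on (sphere z r) k" "\<forall>w\<in>sphere z r. ereal c \<le> ereal (k w)"
  have "circle_avg (\<lambda>_. c) z r \<le> circle_avg k z r" using r k by (intro circle_avg_mono) auto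
  then show "ereal c \<le> ereal (circle_avg k z r)" by (simp only: circle_avg_const ereal_less_eq)
qed simp

section \<open>Frostman's theorem\<close>

lemma closed_ball_away: "closed S \<Longrightarrow> x \<notin> S \<Longrightarrow> \<exists>r>0. ball x r \<subseteq> - S"
  using open_contains_ball[of "- S"] by (simp add: open_Compl)

definition measure_support :: "complex measure \<Rightarrow> complex set" where
  "measure_support \<mu> = {x. \<forall>r>0. 0 < measure \<mu> (ball x r)}"

lemma closed_measure_support:
  assumes "\<mu> \<in> borel_probabilities_on S"
  shows "closed (measure_support \<mu>)"
proof -
  interpret prob_space \<mu> using bpD[OF assms] by blast
  have "open (- measure_support \<mu>)"
  proof (rule openI)
    fix x assume "x \<in> - measure_support \<mu>"
    then obtain r where r: "r > 0" "measure \<mu> (ball x r) = 0"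
      unfolding measure_support_def by (auto simp: not_less measure_le_0_iff)
    have "y \<in> - measure_support \<mu>" if y: "y \<in> ball x (r / 2)" for y
    proof -
      have "ball y (r / 2) \<subseteq> ball x r"
      proof
        fix w assume "w \<in> ball y (r / 2)"
        then show "w \<in> ball x r" using y dist_triangle[of x w y] by (simp add: dist_commute)
      qed
      then have "measure \<mu> (ball y (r / 2)) \<le> measure \<mu> (ball x r)"
        using bpD[OF assms] by (intro finite_measure_mono) auto
      then have "\<not> 0 < measure \<mu> (ball y (r / 2))" using r by simp
      then show ?thesis using r unfolding measure_support_def by force
    qed
    then have "ball x (r / 2) \<subseteq> - measure_support \<mu>" by blast
    then show "\<exists>e>0. ball x e \<subseteq> - measure_support \<mu>" using r(1) half_gt_zero by blast
  qed
  then show ?thesis by (simp add: closed_def)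
qed

lemma measure_support_subset:
  assumes "\<mu> \<in> borel_probabilities_on S" "closed S"
  shows "measure_support \<mu> \<subseteq> S"
proof
  fix x assume x: "x \<in> measure_support \<mu>"
  note \<mu> = bpD[OF assms(1)]
  interpret prob_space \<mu> by fact
  show "x \<in> S"
  proof (rule ccontr)
    assume "x \<notin> S"
    then obtain r where r: "r > 0" "ball x r \<subseteq> - S" using closed_ball_away[OF assms(2)] by blast
    have "AE t in \<mu>. t \<notin> ball x r" using \<mu>(6) by eventually_elim (use r in auto)
    then have "measure \<mu> (ball x r) = 0" using prob_eq_0[of "ball x r"] \<mu>(2) by simp
    moreover have "0 < measure \<mu> (ball x r)" using x r(1) unfolding measure_support_def by blast
    ultimately show False by simp
  qed
qed

text \<open>The complement of the support is a union of null balls, and by Lindelof countably many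
  of them cover it.\<close>

lemma bp_measure_support:
  assumes "\<mu> \<in> borel_probabilities_on S"
  shows "\<mu> \<in> borel_probabilities_on (measure_support \<mu>)"
proof -
  note \<mu> = bpD[OF assms]
  interpret prob_space \<mu> by fact
  define F where "F = {ball x r |x r. 0 < r \<and> measure \<mu> (ball x r) = 0}"
  have "- measure_support \<mu> \<subseteq> \<Union>F"
  proof
    fix x assume "x \<in> - measure_support \<mu>"
    then obtain r where "r > 0" "measure \<mu> (ball x r) = 0"
      unfolding measure_support_def by (auto simp: not_less measure_le_0_iff)
    then show "x \<in> \<Union>F" unfolding F_def by (intro UnionI[of "ball x r"]) auto
  qed
  obtain F' where F': "F' \<subseteq> F" "countable F'" "\<Union>F' = \<Union>F"
    using Lindelof[of F] unfolding F_def by auto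
  have "AE t in \<mu>. t \<notin> B" if "B \<in> F'" for B
  proof -
    obtain x r where "B = ball x r" "measure \<mu> (ball x r) = 0" using F'(1) \<open>B \<in> F'\<close> unfolding F_def by blast
    then show ?thesis using prob_eq_0[of B] \<mu>(2) by simp
  qed
  then have "AE t in \<mu>. \<forall>B\<in>F'. t \<notin> B" using F'(2) by (simp add: AE_ball_countable)
  then have "AE t in \<mu>. t \<in> measure_support \<mu>"
    by eventually_elim (use F'(3) \<open>- measure_support \<mu> \<subseteq> \<Union>F\<close> in auto)
  then show ?thesis using \<mu> closed_measure_support[OF assms] by (intro bpI) auto
qed

lemma bp_nonempty: "\<mu> \<in> borel_probabilities_on S \<Longrightarrow> S \<noteq> {}"
  using bpD(4) by fastforce

text \<open>Monotone convergence for the increasing functions \<open>- trunc_log\<close>: a finite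
  limit of the truncated potentials yields both integrability and the value. Since \<open>z\<close>
  is not an atom, the value \<open>ln 0 = 0\<close> does not matter.\<close>

lemma log_pot_limit:
  assumes bp: "\<mu> \<in> borel_probabilities_on S" and bd: "bounded S" and na: "measure \<mu> {z} = 0"
    and l: "(\<lambda>n. trunc_pot \<mu> (1 / Suc n) z) \<longlonglongrightarrow> l"
  shows "integrable \<mu> (\<lambda>t. ln (cmod (z - t)))" and "log_pot \<mu> z = l"
proof -
  note \<mu> = bpD[OF bp]
  interpret prob_space \<mu> by fact
  have ne: "AE t in \<mu>. t \<noteq> z" using na prob_eq_0[of "{z}"] \<mu>(2) by simp
  have pt: "(\<lambda>n. - trunc_log (1 / Suc n) z t) \<longlonglongrightarrow> - ln (cmod (z - t))" if "t \<noteq> z" for t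
  proof -
    have "\<forall>\<^sub>F n in sequentially. 1 / Suc n < cmod (z - t)"
      using that by (intro order_tendstoD(2)[OF LIMSEQ_Suc[OF lim_1_over_n]]) auto
    then have "\<forall>\<^sub>F n in sequentially. - trunc_log (1 / Suc n) z t = - ln (cmod (z - t))"
      by eventually_elim (simp add: trunc_log_eq_ln)
    then show ?thesis by (rule tendsto_eventually)
  qed
  have a: "\<And>n. integrable \<mu> (\<lambda>t. - trunc_log (1 / Suc n) z t)" using integrable_trunc_log(2)[OF bp bd] by simp
  have b: "AE t in \<mu>. mono (\<lambda>n. - trunc_log (1 / Suc n) z t)"
    by (auto simp: mono_def intro!: trunc_log_mono divide_left_mono)
  have c: "AE t in \<mu>. (\<lambda>n. - trunc_log (1 / Suc n) z t) \<longlonglongrightarrow> - ln (cmod (z - t))"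
    using ne by eventually_elim (rule pt)
  have d: "(\<lambda>n. (\<integral>t. - trunc_log (1 / Suc n) z t \<partial>\<mu>)) \<longlonglongrightarrow> - l"
    using tendsto_minus[OF l] by (simp only: trunc_pot_def Bochner_Integration.integral_minus)
  have e: "(\<lambda>t. - ln (cmod (z - t))) \<in> borel_measurable \<mu>"
    by (intro bp_measurable[OF bp] borel_measurable_uminus ln_cmod_measurable)
  show i: "integrable \<mu> (\<lambda>t. ln (cmod (z - t)))"
    using integrable_monotone_convergence[OF a b c d e] by simp
  show "log_pot \<mu> z = l"
    using integral_monotone_convergence[OF a b c d e] i by (simp add: log_pot_def)
qed

lemma circle_measure_finite_energy:
  assumes "0 < r" "0 < e" shows "ln r \<le> trunc_energy (circle_measure a r) (circle_measure a r) e"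
proof -
  have c: "circle_measure a r \<in> borel_probabilities_on (sphere a r)" using assms by (intro circle_measure_bp) auto
  have "ln r \<le> trunc_pot (circle_measure a r) e t" for t
    using trunc_pot_circle_measure_ge[OF assms, of a t] trunc_log_ge[OF assms(1), of a t] by simp
  then show ?thesis unfolding trunc_energy_def
    using assms by (intro bp_integral_ge_const[OF c] integrable_trunc_pot[OF c _ c]) auto
qed

text \<open>Jensen's formula without truncation, now also for \<open>t\<close> on the
  circle.\<close>

lemma
  assumes "0 < r"
  shows circle_measure_no_atom: "measure (circle_measure a r) {t} = 0"
    and integrable_circle_measure_ln: "integrable (circle_measure a r) (\<lambda>z. ln (cmod (t - z)))"
    and log_pot_circle_measure: "log_pot (circle_measure a r) t = trunc_log r a t"
proof -
  have c: "circle_measure a r \<in> borel_probabilities_on (sphere a r)" using assms by (intro circle_measure_bp) auto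
  show na: "measure (circle_measure a r) {t} = 0"
    using circle_measure_finite_energy[OF assms] by (intro finite_energy_no_atom[OF c]) auto
  show "integrable (circle_measure a r) (\<lambda>z. ln (cmod (t - z)))" "log_pot (circle_measure a r) t = trunc_log r a t"
    using log_pot_limit[OF c _ na trunc_pot_circle_measure_tendsto[OF assms]] by auto
qed

context equilibrium
begin

text \<open>The value at \<open>z\<close> is compared with that at a nearest point \<open>y\<close>
  of the support. Every \<open>t\<close> in the support satisfies
  \<open>|y - t| \<le> 2 |z - t|\<close>, so mass near \<open>x\<close> costs at most
  \<open>ln 2 \<le> 1\<close> per unit, and there is little of it because \<open>\<mu>\<close> has
  no atoms. Distant mass costs little by a Lipschitz estimate. Nothing depends on the truncation
  \<open>e\<close>.\<close>

lemma near_support: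
  assumes x: "x \<in> measure_support \<mu>" and \<epsilon>: "0 < \<epsilon>"
  shows "\<exists>\<delta>>0. \<forall>z\<in>ball x \<delta>. \<forall>e>0. V - \<epsilon> \<le> trunc_pot \<mu> e z"
proof -
  define K where "K = measure_support \<mu>"
  have K: "\<mu> \<in> borel_probabilities_on K" "closed K" "bounded K" "x \<in> K"
    using bp_measure_support[OF bp] closed_measure_support[OF bp] measure_support_subset[OF bp compact_imp_closed[OF compact]] bd x
    by (auto simp: K_def intro: bounded_subset)
  obtain \<rho> where \<rho>: "\<rho> > 0" "measure \<mu> (ball x \<rho>) < \<epsilon> / 2"
    using no_atom_small_ball[OF bp no_atom, of "\<epsilon> / 2" x] \<epsilon> by auto
  define B where "B = ball x \<rho>"
  \<comment> \<open>The first bound keeps \<open>y\<close> and \<open>z\<close> at distance at least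
    \<open>\<rho> / 2\<close> from every \<open>t\<close> off the ball \<open>B\<close>; the second
    makes the Lipschitz error there at most \<open>\<epsilon> / 2\<close>.\<close>
  define \<delta> where "\<delta> = min (\<rho> / 8) (\<rho> * \<epsilon> / 4)"
  have \<delta>: "\<delta> > 0" "\<delta> \<le> \<rho> / 8" "\<delta> \<le> \<rho> * \<epsilon> / 4" using \<rho> \<epsilon> by (auto simp: \<delta>_def)
  have "V - \<epsilon> \<le> trunc_pot \<mu> e z" if z: "z \<in> ball x \<delta>" and e: "0 < e" for z e
  proof -
    obtain y where y: "y \<in> K" "\<And>t. t \<in> K \<Longrightarrow> dist z y \<le> dist z t"
      using distance_attains_inf[of K z] K by blast
    have zy: "cmod (z - y) < \<delta>" using y(2)[OF K(4)] z by (simp add: dist_norm norm_minus_commute)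
    have xz: "cmod (x - z) < \<delta>" using z by (simp add: dist_norm)
    have pt: "trunc_log e y t \<le> trunc_log e z t + (indicator B t * 1 + \<epsilon> / 2)" if t: "t \<in> K" for t
    proof (cases "t \<in> B")
      case True
      have "cmod (y - t) \<le> cmod (y - z) + cmod (z - t)" using norm_triangle_ineq[of "y - z" "z - t"] by simp
      also have "cmod (y - z) \<le> cmod (z - t)" using y(2)[OF t] by (simp add: dist_norm norm_minus_commute)
      finally have "max e (cmod (y - t)) \<le> 2 * max e (cmod (z - t))" using e by (auto simp: max_def)
      then have "trunc_log e y t \<le> ln (2 * max e (cmod (z - t)))"
        unfolding trunc_log_def using e by (intro ln_mono) (auto simp: less_max_iff_disj)
      also have "\<dots> = ln 2 + trunc_log e z t" unfolding trunc_log_def using e by (intro ln_mult_pos) (auto simp: less_max_iff_disj)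
      also have "ln 2 \<le> (1::real)" using ln_le_minus_one[of 2] by simp
      finally show ?thesis using True \<epsilon> by simp
    next
      case False
      then have xt: "\<rho> \<le> cmod (x - t)" by (simp add: B_def dist_norm)
      have "cmod (x - t) \<le> cmod (x - z) + cmod (z - t)" using norm_triangle_ineq[of "x - z" "z - t"] by simp
      then have zt: "\<rho> / 2 \<le> cmod (z - t)" using xt xz \<delta> by linarith
      have "cmod (x - t) \<le> cmod (x - z) + cmod (z - y) + cmod (y - t)"
        using norm_triangle_ineq[of "x - z" "z - t"] norm_triangle_ineq[of "z - y" "y - t"] by simp
      then have yt: "\<rho> / 2 \<le> cmod (y - t)" using xt xz zy \<delta> by linarith
      have "trunc_log e y t - trunc_log e z t \<le> \<bar>max e (cmod (y - t)) - max e (cmod (z - t))\<bar> / (\<rho> / 2)"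
        unfolding trunc_log_def using \<rho> zt yt by (intro ln_diff_le_divide) auto
      also have "\<dots> \<le> cmod (y - z) / (\<rho> / 2)"
      proof (rule divide_right_mono)
        have "\<bar>cmod (y - t) - cmod (z - t)\<bar> \<le> cmod (y - z)"
          using norm_triangle_ineq3[of "y - t" "z - t"] by simp
        then show "\<bar>max e (cmod (y - t)) - max e (cmod (z - t))\<bar> \<le> cmod (y - z)" by (auto simp: max_def)
      qed (use \<rho> in simp)
      also have "\<dots> \<le> (\<rho> * \<epsilon> / 4) / (\<rho> / 2)"
        using zy \<delta> \<rho> by (intro divide_right_mono) (auto simp: norm_minus_commute)
      also have "\<dots> = \<epsilon> / 2" using \<rho> by (simp add: field_simps)
      finally show ?thesis using False by simp
    qed
    have Bm: "B \<in> sets borel" by (simp add: B_def)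
    have iB: "integrable \<mu> (\<lambda>t. indicator B t * (1::real))"
      using bp_integrable_indicator[OF bp Bm, of "\<lambda>_. 1"] finite_measure.integrable_const[OF bpD(8)[OF bp], of 1] by simp
    have ic: "integrable \<mu> (\<lambda>t. \<epsilon> / 2)" using finite_measure.integrable_const[OF bpD(8)[OF bp]] .
    have "V \<le> trunc_pot \<mu> e y" using y(1) e by (intro trunc_pot_ge_on_support) (auto simp: K_def measure_support_def)
    also have "\<dots> \<le> (\<integral>t. trunc_log e z t + (indicator B t * 1 + \<epsilon> / 2) \<partial>\<mu>)"
      unfolding trunc_pot_def using pt iB ic integrable_trunc_log(2)[OF bp bd e]
      by (intro bp_integral_mono[OF K(1)] Bochner_Integration.integrable_add integrable_trunc_log[OF bp bd e]) auto
    also have "\<dots> = trunc_pot \<mu> e z + ((\<integral>t. indicator B t * (1::real) \<partial>\<mu>) + (\<integral>t. \<epsilon> / 2 \<partial>\<mu>))"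
      unfolding trunc_pot_def
      by (subst Bochner_Integration.integral_add[OF integrable_trunc_log(2)[OF bp bd e] Bochner_Integration.integrable_add[OF iB ic]],
          subst Bochner_Integration.integral_add[OF iB ic]) simp
    also have "(\<integral>t. indicator B t * (1::real) \<partial>\<mu>) = measure \<mu> B"
      using Bm bpD[OF bp] by simp
    also have "(\<integral>t. \<epsilon> / 2 \<partial>\<mu>) = \<epsilon> / 2" by (rule bp_const[OF bp])
    finally show ?thesis using \<rho>(2) by (simp add: B_def)
  qed
  then show ?thesis using \<delta>(1) by blast
qed

lemma log_pot_le_trunc_pot_away:
  assumes "\<mu> \<in> borel_probabilities_on K" "closed K" "bounded K" "z \<notin> K" "0 < e"
  shows "log_pot \<mu> z \<le> trunc_pot \<mu> e z" "\<exists>d>0. log_pot \<mu> z = trunc_pot \<mu> d z"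
proof -
  obtain d where d: "d > 0" "ball z d \<subseteq> - K" using closed_ball_away[OF assms(2,4)] by blast
  have eq: "log_pot \<mu> z = trunc_pot \<mu> d' z" if "d' \<le> d" for d'
    using d that by (intro log_pot_eq_trunc_pot[OF assms(1)]) (force simp: dist_norm)
  show "\<exists>d>0. log_pot \<mu> z = trunc_pot \<mu> d z" using d eq by blast
  have "log_pot \<mu> z = trunc_pot \<mu> (min d e) z" by (rule eq) simp
  also have "\<dots> \<le> trunc_pot \<mu> e z" using d assms by (intro trunc_pot_mono[OF assms(1,3)]) auto
  finally show "log_pot \<mu> z \<le> trunc_pot \<mu> e z" .
qed

text \<open>Off the support the constant \<open>V\<close> is compared with the harmonic potential.
  \<open>near_support\<close> supplies the boundary condition at every point, so the plain maximum
  principle suffices.\<close>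

theorem frostman:
  assumes e: "0 < e"
  shows "V \<le> trunc_pot \<mu> e z"
proof (cases "z \<in> measure_support \<mu>")
  case True
  then show ?thesis using e by (intro trunc_pot_ge_on_support) (auto simp: measure_support_def)
next
  case False
  define K where "K = measure_support \<mu>"
  have K: "\<mu> \<in> borel_probabilities_on K" "closed K" "bounded K"
    using bp_measure_support[OF bp] closed_measure_support[OF bp] measure_support_subset[OF bp compact_imp_closed[OF compact]] bd
    by (auto simp: K_def intro: bounded_subset)
  obtain R where R: "R > 0" "\<And>t. t \<in> K \<Longrightarrow> cmod t \<le> R" using K(3) bounded_pos by metis
  have "ereal V \<le> ereal (log_pot \<mu> z)"
  \<comment> \<open>Beyond radius \<open>R + exp V\<close> the potential is at least
    \<open>ln (exp V)\<close>.\<close>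
  proof (rule maximum_principle_unbounded[where D = "- K" and u = "\<lambda>_. ereal V" and R = "R + exp V"])
    show "open (- K)" using K by (simp add: open_Compl)
    show "mean_harmonic (- K) (log_pot \<mu>)" using K by (intro mean_harmonic_log_pot)
    show "z \<in> - K" using False by (simp add: K_def)
    show "submean_at (\<lambda>_. ereal V) z" for z by (rule submean_at_const)
    fix w assume w: "R + exp V \<le> cmod w"
    have Rw: "R < cmod w" using w exp_gt_zero[of V] by linarith
    have "V = ln (exp V)" by simp
    also have "\<dots> \<le> ln (cmod w - R)" using w by (intro ln_mono) auto
    also have "\<dots> \<le> log_pot \<mu> w" using R(1) Rw by (intro log_pot_growth(1)[OF K(1) R(2)]) auto
    finally show "ereal V \<le> ereal (log_pot \<mu> w)" by simp
  next
    fix x and \<epsilon> :: real assume x: "x \<in> frontier (- K)" and \<epsilon>: "0 < \<epsilon>"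
    then have "x \<in> K" using K(2) frontier_subset_closed by auto
    then obtain \<delta> where \<delta>: "\<delta> > 0" "\<And>w e. w \<in> ball x \<delta> \<Longrightarrow> 0 < e \<Longrightarrow> V - \<epsilon> \<le> trunc_pot \<mu> e w"
      using near_support[OF _ \<epsilon>, of x] by (auto simp: K_def)
    show "\<forall>\<^sub>F w in at x within - K. ereal V \<le> ereal (log_pot \<mu> w + \<epsilon>)"
      unfolding eventually_at
    proof (intro exI[of _ \<delta>] conjI ballI impI \<delta>(1))
      fix w assume w: "w \<in> - K" "w \<noteq> x \<and> dist w x < \<delta>"
      then obtain d where d: "d > 0" "log_pot \<mu> w = trunc_pot \<mu> d w"
        using log_pot_le_trunc_pot_away(2)[OF K, of w 1] by auto
      then show "ereal V \<le> ereal (log_pot \<mu> w + \<epsilon>)"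
        using \<delta>(2)[of w d] w by (simp add: dist_commute)
    qed
  qed auto
  also have "\<dots> \<le> ereal (trunc_pot \<mu> e z)"
    using False e log_pot_le_trunc_pot_away(1)[OF K] by (simp add: K_def)
  finally show ?thesis by simp
qed

text \<open>As the truncation tends to 0 the truncated potentials decrease and stay above
  \<open>V\<close>, so they converge at every point and the potential is finite everywhere.\<close>

lemma
  shows integrable_ln: "integrable \<mu> (\<lambda>t. ln (cmod (z - t)))"
    and trunc_pot_tendsto_log_pot: "(\<lambda>n. trunc_pot \<mu> (1 / Suc n) z) \<longlonglongrightarrow> log_pot \<mu> z"
proof -
  have "decseq (\<lambda>n. trunc_pot \<mu> (1 / Suc n) z)"
    unfolding decseq_def by (auto intro!: trunc_pot_mono[OF bp bd] divide_left_mono)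
  then obtain l where l: "(\<lambda>n. trunc_pot \<mu> (1 / Suc n) z) \<longlonglongrightarrow> l"
    using decseq_convergent[of _ V] frostman by (metis divide_pos_pos of_nat_0_less_iff zero_less_Suc zero_less_one)
  from log_pot_limit[OF bp bd no_atom this] l
  show "integrable \<mu> (\<lambda>t. ln (cmod (z - t)))" "(\<lambda>n. trunc_pot \<mu> (1 / Suc n) z) \<longlonglongrightarrow> log_pot \<mu> z" by auto
qed

lemma log_pot_ge: "V \<le> log_pot \<mu> z"
  using trunc_pot_tendsto_log_pot[of z] frostman by (intro tendsto_lowerbound[OF trunc_pot_tendsto_log_pot]) auto

lemma log_pot_le_trunc_pot:
  assumes "0 < e" shows "log_pot \<mu> z \<le> trunc_pot \<mu> e z"
proof (rule tendsto_upperbound[OF trunc_pot_tendsto_log_pot])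
  have "\<forall>\<^sub>F n in sequentially. 1 / Suc n < e"
    using assms by (intro order_tendstoD(2)[OF LIMSEQ_Suc[OF lim_1_over_n]]) auto
  then show "\<forall>\<^sub>F n in sequentially. trunc_pot \<mu> (1 / Suc n) z \<le> trunc_pot \<mu> e z"
    by eventually_elim (auto intro!: trunc_pot_mono[OF bp bd])
qed simp

lemma log_pot_usc:
  assumes "log_pot \<mu> z < a"
  shows "\<forall>\<^sub>F w in nhds z. log_pot \<mu> w < a"
proof -
  have "\<forall>\<^sub>F n in sequentially. trunc_pot \<mu> (1 / Suc n) z < a"
    using order_tendstoD(2)[OF trunc_pot_tendsto_log_pot assms] .
  then obtain n where n: "trunc_pot \<mu> (1 / Suc n) z < a" by (auto simp: eventually_sequentially)
  have "isCont (trunc_pot \<mu> (1 / Suc n)) z"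
    using continuous_on_trunc_pot[OF bp bd, of "1 / Suc n" UNIV] continuous_on_eq_continuous_at[of UNIV] by auto
  then have "\<forall>\<^sub>F w in nhds z. trunc_pot \<mu> (1 / Suc n) w < a"
    using n by (intro order_tendstoD) (simp_all add: isCont_def tendsto_at_iff_tendsto_nhds)
  then show ?thesis
  proof eventually_elim
    case (elim w)
    then show ?case using log_pot_le_trunc_pot[of "1 / Suc n" w] by simp
  qed
qed

lemma log_pot_measurable [measurable]: "log_pot \<mu> \<in> borel_measurable borel"
proof (rule borel_measurable_LIMSEQ_real)
  show "(\<lambda>n. trunc_pot \<mu> (1 / Suc n) z) \<longlonglongrightarrow> log_pot \<mu> z" for z by (rule trunc_pot_tendsto_log_pot)
  show "trunc_pot \<mu> (1 / Suc n) \<in> borel_measurable borel" for n by (rule trunc_pot_measurable[OF bp bd]) simp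
qed

lemma
  assumes \<sigma>: "\<sigma> \<in> borel_probabilities_on T" "bounded T"
  shows integrable_log_pot: "integrable \<sigma> (log_pot \<mu>)"
    and trunc_energy_tendsto: "(\<lambda>n. trunc_energy \<mu> \<sigma> (1 / Suc n)) \<longlonglongrightarrow> (\<integral>z. log_pot \<mu> z \<partial>\<sigma>)"
proof -
  let ?w = "\<lambda>z. \<bar>V\<bar> + \<bar>trunc_pot \<mu> 1 z\<bar>"
  have w: "integrable \<sigma> ?w"
    using integrable_trunc_pot[OF bp bd \<sigma>, of 1] finite_measure.integrable_const[OF bpD(8)[OF \<sigma>(1)], of "\<bar>V\<bar>"] by auto
  have b: "norm (trunc_pot \<mu> (1 / Suc n) z) \<le> ?w z" for n z
  proof -
    have "V \<le> trunc_pot \<mu> (1 / Suc n) z" by (rule frostman) simp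
    moreover have "trunc_pot \<mu> (1 / Suc n) z \<le> trunc_pot \<mu> 1 z" by (rule trunc_pot_mono[OF bp bd]) auto
    ultimately show ?thesis by auto
  qed
  have m: "log_pot \<mu> \<in> borel_measurable \<sigma>" "\<And>n. trunc_pot \<mu> (1 / Suc n) \<in> borel_measurable \<sigma>"
    by (intro bp_measurable[OF \<sigma>(1)] log_pot_measurable trunc_pot_measurable[OF bp bd] divide_pos_pos; simp)+
  have l: "AE z in \<sigma>. (\<lambda>n. trunc_pot \<mu> (1 / Suc n) z) \<longlonglongrightarrow> log_pot \<mu> z" using trunc_pot_tendsto_log_pot by simp
  have bb: "\<And>n. AE z in \<sigma>. norm (trunc_pot \<mu> (1 / Suc n) z) \<le> ?w z" using b by simp
  show "integrable \<sigma> (log_pot \<mu>)" using integrable_dominated_convergence[OF m w l bb] .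
  show "(\<lambda>n. trunc_energy \<mu> \<sigma> (1 / Suc n)) \<longlonglongrightarrow> (\<integral>z. log_pot \<mu> z \<partial>\<sigma>)"
    unfolding trunc_energy_def using integral_dominated_convergence[OF m w l bb] .
qed

text \<open>The same truncated energies have two limits: one by dominated convergence on the circle,
  the other, with the measures exchanged, by Jensen's formula.\<close>

lemma integral_log_pot_circle_measure:
  assumes "0 < r" shows "(\<integral>z. log_pot \<mu> z \<partial>circle_measure a r) = trunc_pot \<mu> r a"
proof -
  have "circle_measure a r \<in> borel_probabilities_on (sphere a r)" using assms by (intro circle_measure_bp) auto
  from trunc_energy_tendsto[OF this] trunc_energy_circle_measure_tendsto[OF bp bd assms, of a]
  show ?thesis by (auto intro: LIMSEQ_unique)
qed

lemma integral_log_pot_le: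
  assumes \<sigma>: "\<sigma> \<in> borel_probabilities_on E" and A: "\<And>e. 0 < e \<Longrightarrow> A \<le> trunc_energy \<sigma> \<sigma> e"
  shows "(\<integral>z. log_pot \<mu> z \<partial>\<sigma>) \<le> V"
proof (rule variational[OF \<sigma> A])
  fix e :: real assume e: "0 < e"
  show "(\<integral>z. log_pot \<mu> z \<partial>\<sigma>) \<le> trunc_energy \<mu> \<sigma> e"
    unfolding trunc_energy_def using log_pot_le_trunc_pot[OF e]
    by (intro bp_integral_mono[OF \<sigma> integrable_log_pot[OF \<sigma> bd] integrable_trunc_pot[OF bp bd \<sigma> bd e]])
qed

text \<open>Conditioning \<open>\<sigma>\<close> on the part of \<open>E\<close> where the potential
  is at least \<open>V + 1 / Suc n\<close> would give a measure of finite energy with mean potential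
  above \<open>V\<close>, against the variational inequality. So a measure of finite energy does not
  charge the exceptional set.\<close>

lemma log_pot_le_AE:
  assumes \<sigma>: "\<sigma> \<in> borel_probabilities_on T" "bounded T" and A: "\<And>e. 0 < e \<Longrightarrow> A \<le> trunc_energy \<sigma> \<sigma> e"
  shows "AE z in \<sigma>. z \<in> E \<longrightarrow> log_pot \<mu> z = V"
proof -
  note s = bpD[OF \<sigma>(1)]
  interpret S: prob_space \<sigma> by fact
  have Em: "E \<in> sets borel" using bpD[OF bp] by simp
  have nul: "measure \<sigma> {z \<in> E. V + 1 / Suc n \<le> log_pot \<mu> z} = 0" for n
  proof (rule ccontr)
    let ?A = "{z \<in> E. V + 1 / Suc n \<le> log_pot \<mu> z}"
    have "{z. V + 1 / Suc n \<le> log_pot \<mu> z} \<in> sets borel" by measurable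
    from sets.Int[OF Em this] have Am: "?A \<in> sets borel" by (simp add: Int_def)
    assume "measure \<sigma> ?A \<noteq> 0"
    then have pos: "0 < measure \<sigma> ?A" by (simp add: zero_less_measure_iff)
    define \<nu> where "\<nu> = uniform_measure \<sigma> ?A"
    have \<nu>': "\<nu> \<in> borel_probabilities_on (T \<inter> ?A)"
      unfolding \<nu>_def by (rule uniform_measure_bp[OF \<sigma>(1) Am pos])
    then have \<nu>: "\<nu> \<in> borel_probabilities_on E" by (rule bp_mono) (use Em in auto)
    obtain C where C: "\<And>e. 0 < e \<Longrightarrow> C \<le> trunc_energy \<nu> \<nu> e"
      using uniform_measure_finite_energy[OF \<sigma> Am pos A] unfolding \<nu>_def by blast
    have "V + 1 / Suc n \<le> (\<integral>z. log_pot \<mu> z \<partial>\<nu>)"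
      by (rule bp_integral_ge_const[OF \<nu>' integrable_log_pot[OF \<nu> bd]]) auto
    also have "\<dots> \<le> V" by (rule integral_log_pot_le[OF \<nu> C])
    finally have "1 / Suc n \<le> (0::real)" by linarith
    then show False by (simp add: divide_le_0_iff)
  qed
  have "AE z in \<sigma>. \<not> (z \<in> E \<and> V + 1 / Suc n \<le> log_pot \<mu> z)" for n
  proof -
    have "{z. V + 1 / Suc n \<le> log_pot \<mu> z} \<in> sets borel" by measurable
    from sets.Int[OF Em this] have "{z \<in> E. V + 1 / Suc n \<le> log_pot \<mu> z} \<in> sets \<sigma>" by (simp add: Int_def s)
    then show ?thesis using nul[of n] S.prob_eq_0 by auto
  qed
  then have "AE z in \<sigma>. \<forall>n. \<not> (z \<in> E \<and> V + 1 / Suc n \<le> log_pot \<mu> z)" unfolding AE_all_countable by blast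
  then show ?thesis
  proof eventually_elim
    case (elim z)
    show ?case
    proof (rule impI, rule antisym[OF _ log_pot_ge], rule ccontr)
      assume "z \<in> E" "\<not> log_pot \<mu> z \<le> V"
      then obtain n where "1 / Suc n < log_pot \<mu> z - V" using nat_approx_posE[of "log_pot \<mu> z - V"] by auto
      then show False using elim \<open>z \<in> E\<close> by (metis less_diff_eq add.commute less_imp_le)
    qed
  qed
qed

lemma log_pot_circle_measure_AE:
  assumes "0 < r" shows "AE z in circle_measure a r. z \<in> E \<longrightarrow> log_pot \<mu> z = V"
  using assms circle_measure_bp[of r a] circle_measure_finite_energy[OF assms] by (intro log_pot_le_AE) auto

lemma mean_harmonic_log_pot': "mean_harmonic (- E) (log_pot \<mu>)"
  using mean_harmonic_log_pot[OF bp bd compact_imp_closed[OF compact]] .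

end

section \<open>Weak compactness\<close>

text \<open>
  Schoenberg's plane-filling curve reduces weak compactness of measures in the plane to Helly's theorem on the line.
\<close>

definition plateau :: "real \<Rightarrow> real" where
  "plateau t = min 1 (max 0 (1/2 - cos (pi * t)))"

lemma plateau_bounds: "0 \<le> plateau t" "plateau t \<le> 1"
  by (auto simp: plateau_def)

lemma plateau_shift: "plateau (2 * of_int k + t) = plateau t"
proof -
  have "cos (pi * (2 * of_int k + t)) = cos (pi * t + 2 * pi * of_int k)" by (simp add: algebra_simps)
  also have "\<dots> = cos (pi * t)" by (simp add: cos_add)
  finally show ?thesis by (simp add: plateau_def)
qed

lemma cos_ge_half:
  assumes "0 \<le> s" "s \<le> 1/3" shows "1/2 \<le> cos (pi * s)"
proof -
  have "pi * s \<le> pi / 3" using assms(2) mult_left_mono[of s "1/3" pi] by simp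
  then have "cos (pi / 3) \<le> cos (pi * s)"
    using assms pi_gt_zero by (intro cos_monotone_0_pi_le) (auto intro: order_trans)
  then show ?thesis by (simp add: cos_60)
qed

lemma plateau_0: "0 \<le> s \<Longrightarrow> s \<le> 1/3 \<Longrightarrow> plateau s = 0"
  using cos_ge_half[of s] by (simp add: plateau_def)

lemma plateau_1:
  assumes "2/3 \<le> s" "s \<le> 1" shows "plateau s = 1"
proof -
  have "cos (pi * s) = - cos (pi * (1 - s))" by (simp add: right_diff_distrib cos_diff)
  also have "\<dots> \<le> - 1/2" using cos_ge_half[of "1 - s"] assms by simp
  finally show ?thesis by (simp add: plateau_def)
qed

text \<open>If \<open>t\<close> has only the ternary digits 0 and 2, coordinate \<open>j\<close>
  reads those at the positions \<open>2 * n + j\<close> as binary digits.\<close>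

definition schoenberg :: "nat \<Rightarrow> real \<Rightarrow> real" where
  "schoenberg j t = (\<Sum>n. (1/2)^(Suc n) * plateau (3^(2*n+j) * t))"

lemma schoenberg_term: "norm ((1/2)^(Suc n) * plateau s) \<le> (1/2::real)^(Suc n)"
  using plateau_bounds[of s] by (simp add: mult_left_le)

lemma half_sums: "(\<lambda>n. (1/2::real)^(Suc n)) sums 1"
  by (rule power_half_series)

lemma schoenberg_continuous: "continuous_on UNIV (schoenberg j)"
proof (rule uniform_limit_theorem)
  show "uniform_limit UNIV (\<lambda>n t. \<Sum>i<n. (1/2)^(Suc i) * plateau (3^(2*i+j) * t)) (schoenberg j) sequentially"
    unfolding schoenberg_def[abs_def]
    by (rule Weierstrass_m_test[OF schoenberg_term sums_summable[OF half_sums]])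
qed (auto simp: plateau_def intro!: always_eventually continuous_intros)

lemma schoenberg_bounds: "0 \<le> schoenberg j t" "schoenberg j t \<le> 1"
proof -
  have s: "summable (\<lambda>n. (1/2)^(Suc n) * plateau (3^(2*n+j) * t))"
    by (rule summable_comparison_test'[OF sums_summable[OF half_sums] schoenberg_term])
  show "0 \<le> schoenberg j t" unfolding schoenberg_def
    using plateau_bounds by (intro suminf_nonneg s) auto
  have "schoenberg j t \<le> (\<Sum>n. (1/2)^(Suc n))" unfolding schoenberg_def
    using plateau_bounds by (intro suminf_le s sums_summable[OF half_sums] mult_left_le) auto
  then show "schoenberg j t \<le> 1" using sums_unique[OF half_sums] by simp
qed

lemma third_sums: "(\<lambda>n. 2 * (1/3::real)^(Suc n)) sums 1"
proof -
  have "(\<lambda>n. (2/3) * (1/3::real)^n) sums ((2/3) * (1 / (1 - 1/3)))"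
    by (intro sums_mult geometric_sums) simp
  then show ?thesis by simp
qed

text \<open>Multiplication by \<open>3^m\<close> turns the digits before position \<open>m\<close>,
  all 0 or 2, into an even integer, which the period removes. Digit \<open>m\<close> and the tail
  then place the argument in \<open>[0, 1/3]\<close> or in \<open>[2/3, 1]\<close>.\<close>

lemma plateau_ternary:
  fixes c :: "nat \<Rightarrow> nat"
  assumes c: "\<And>k. c k \<le> 1"
  defines "t \<equiv> (\<Sum>k. 2 * real (c k) * (1/3)^(Suc k))"
  shows "plateau (3^m * t) = real (c m)" and "0 \<le> t" and "t \<le> 1"
proof -
  let ?f = "\<lambda>k. 2 * real (c k) * (1/3::real)^(Suc k)"
  have fb: "0 \<le> ?f k" "?f k \<le> 2 * (1/3)^(Suc k)" for k
    using c[of k] by (auto simp: mult_left_le_one_le)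
  have s: "summable ?f"
    by (rule summable_comparison_test'[OF sums_summable[OF third_sums]]) (use fb in auto)
  have tail: "0 \<le> (\<Sum>k. ?f (k + p))" "(\<Sum>k. ?f (k + p)) \<le> (1/3)^p" for p
  proof -
    have sp: "summable (\<lambda>k. ?f (k + p))" using s by (rule summable_ignore_initial_segment)
    show "0 \<le> (\<Sum>k. ?f (k + p))" using fb by (intro suminf_nonneg sp) auto
    have s3: "(\<lambda>k. (1/3)^p * (2 * (1/3::real)^(Suc k))) sums ((1/3)^p * 1)" by (intro sums_mult third_sums)
    have "(\<Sum>k. ?f (k + p)) \<le> (\<Sum>k. (1/3)^p * (2 * (1/3::real)^(Suc k)))"
    proof (intro suminf_le sp sums_summable[OF s3])
      fix k show "?f (k + p) \<le> (1/3)^p * (2 * (1/3::real)^(Suc k))"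
        using fb(2)[of "k + p"] by (simp add: power_add mult_ac)
    qed
    then show "(\<Sum>k. ?f (k + p)) \<le> (1/3)^p" using sums_unique[OF s3] by simp
  qed
  show "0 \<le> t" "t \<le> 1" using tail[of 0] by (auto simp: t_def)
  have split: "t = (\<Sum>k. ?f (k + Suc m)) + (\<Sum>k<Suc m. ?f k)"
    unfolding t_def by (rule suminf_split_initial_segment[OF s])
  define I where "I = (\<Sum>k<m. int (c k) * 3^(m - Suc k))"
  have pw: "3^m * (1/3::real)^(Suc k) = 3^(m - Suc k)" if "k < m" for k
  proof -
    have "(3::real)^m = 3^(m - Suc k) * 3^(Suc k)" using that by (simp only: power_add[symmetric]) simp
    then show ?thesis by (simp add: power_divide)
  qed
  have "3^m * (\<Sum>k<m. ?f k) = 2 * of_int I"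
    unfolding I_def of_int_sum sum_distrib_left
  proof (intro sum.cong refl)
    fix k assume "k \<in> {..<m}"
    then show "3^m * ?f k = 2 * of_int (int (c k) * 3^(m - Suc k))" using pw[of k] by (simp add: mult_ac)
  qed
  then have eq: "3^m * t = 2 * of_int I + (2/3 * real (c m) + 3^m * (\<Sum>k. ?f (k + Suc m)))"
    unfolding split by (simp add: algebra_simps power_divide)
  define r where "r = 3^m * (\<Sum>k. ?f (k + Suc m))"
  have "r \<le> 3^m * (1/3)^(Suc m)" unfolding r_def by (intro mult_left_mono tail) auto
  then have r: "0 \<le> r" "r \<le> 1/3" using tail(1)[of "Suc m"] by (auto simp: r_def power_divide)
  have "plateau (3^m * t) = plateau (2/3 * real (c m) + r)"
    unfolding eq r_def[symmetric] by (rule plateau_shift)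
  also have "\<dots> = real (c m)"
  proof (cases "c m = 0")
    case True then show ?thesis using plateau_0 r by simp
  next
    case False then have "c m = 1" using c[of m] by simp
    then show ?thesis using plateau_1[of "2/3 + r"] r by simp
  qed
  finally show "plateau (3^m * t) = real (c m)" .
qed

definition bin_digit :: "real \<Rightarrow> nat \<Rightarrow> nat" where
  "bin_digit x n = nat (\<lfloor>2^(Suc n) * x\<rfloor> - 2 * \<lfloor>2^n * x\<rfloor>)"

lemma bin_digit_eq: "int (bin_digit x n) = \<lfloor>2^(Suc n) * x\<rfloor> - 2 * \<lfloor>2^n * x\<rfloor>"
  and bin_digit_le: "bin_digit x n \<le> 1"
proof -
  define y where "y = 2^n * x"
  have eq: "2^(Suc n) * x = 2 * y" by (simp add: y_def)
  have "2 * \<lfloor>y\<rfloor> \<le> \<lfloor>2 * y\<rfloor>" "\<lfloor>2 * y\<rfloor> \<le> 2 * \<lfloor>y\<rfloor> + 1" by linarith+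
  then show "int (bin_digit x n) = \<lfloor>2^(Suc n) * x\<rfloor> - 2 * \<lfloor>2^n * x\<rfloor>" "bin_digit x n \<le> 1"
    unfolding bin_digit_def eq y_def[symmetric] by auto
qed

lemma bin_digit_sums:
  assumes "0 \<le> x" "x < 1"
  shows "(\<lambda>n. (1/2)^(Suc n) * real (bin_digit x n)) sums x"
proof -
  have ps: "(\<Sum>n<N. (1/2)^(Suc n) * real (bin_digit x n)) = real_of_int \<lfloor>2^N * x\<rfloor> / 2^N" for N
  proof (induction N)
    case 0 then show ?case using assms by (simp add: floor_eq_iff)
  next
    case (Suc N)
    have "real (bin_digit x N) = real_of_int (\<lfloor>2^(Suc N) * x\<rfloor> - 2 * \<lfloor>2^N * x\<rfloor>)"
      using bin_digit_eq[of x N] by (metis of_int_of_nat_eq)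
    then show ?case using Suc by (simp add: field_simps)
  qed
  have "(\<lambda>N. real_of_int \<lfloor>2^N * x\<rfloor> / 2^N) \<longlonglongrightarrow> x"
  proof (rule tendsto_sandwich[OF always_eventually always_eventually])
    show "\<forall>N. x - (1/2)^N \<le> real_of_int \<lfloor>2^N * x\<rfloor> / 2^N"
    proof
      fix N
      have "2^N * x - 1 \<le> real_of_int \<lfloor>2^N * x\<rfloor>" by linarith
      then have "(2^N * x - 1) / 2^N \<le> real_of_int \<lfloor>2^N * x\<rfloor> / 2^N" by (intro divide_right_mono) auto
      then show "x - (1/2)^N \<le> real_of_int \<lfloor>2^N * x\<rfloor> / 2^N" by (simp add: diff_divide_distrib power_divide)
    qed
    show "\<forall>N. real_of_int \<lfloor>2^N * x\<rfloor> / 2^N \<le> x"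
    proof
      fix N
      have "real_of_int \<lfloor>2^N * x\<rfloor> \<le> 2^N * x" by linarith
      then show "real_of_int \<lfloor>2^N * x\<rfloor> / 2^N \<le> x" by (simp add: divide_le_eq mult.commute)
    qed
    have "(\<lambda>N. x - (1/2)^N) \<longlonglongrightarrow> x - 0" by (intro tendsto_intros LIMSEQ_power_zero) auto
    then show "(\<lambda>N. x - (1/2)^N) \<longlonglongrightarrow> x" by simp
  qed simp
  then show ?thesis unfolding sums_def ps .
qed

text \<open>Interleave the digits: those of \<open>x\<close> go to the even ternary positions, those
  of \<open>y\<close> to the odd ones.\<close>

lemma schoenberg_surj:
  assumes "0 \<le> x" "x < 1" "0 \<le> y" "y < 1"
  shows "\<exists>t\<in>{0..1}. schoenberg 0 t = x \<and> schoenberg 1 t = y"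
proof -
  define c where "c k = (if even k then bin_digit x (k div 2) else bin_digit y (k div 2))" for k :: nat
  have c: "c k \<le> 1" for k using bin_digit_le by (simp add: c_def)
  define t where "t = (\<Sum>k. 2 * real (c k) * (1/3)^(Suc k))"
  note p = plateau_ternary[of c, OF c, folded t_def]
  have "schoenberg 0 t = (\<Sum>n. (1/2)^(Suc n) * real (bin_digit x n))"
    "schoenberg 1 t = (\<Sum>n. (1/2)^(Suc n) * real (bin_digit y n))"
    unfolding schoenberg_def p(1) by (auto simp: c_def)
  then show ?thesis
    using p(2,3) bin_digit_sums[OF assms(1,2)] bin_digit_sums[OF assms(3,4)]
    by (intro bexI[of _ t]) (auto simp: sums_iff)
qed

lemma plane_filling_curve:
  assumes "0 < R"
  shows "\<exists>\<phi>::real \<Rightarrow> complex. continuous_on UNIV \<phi> \<and> bounded (range \<phi>) \<and> (\<forall>z. cmod z < R \<longrightarrow> (\<exists>t\<in>{0..1}. \<phi> t = z))"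
proof (intro exI conjI allI impI)
  define \<phi> where "\<phi> t = Complex (2 * R * schoenberg 0 t - R) (2 * R * schoenberg 1 t - R)" for t
  show "continuous_on UNIV \<phi>" unfolding \<phi>_def
    by (intro continuous_on_Complex continuous_intros schoenberg_continuous)
  have b: "\<bar>2 * R * schoenberg j t - R\<bar> \<le> R" for j t
  proof -
    have "0 \<le> 2 * R * schoenberg j t" "2 * R * schoenberg j t \<le> 2 * R * 1"
      using assms schoenberg_bounds by (auto intro!: mult_left_mono)
    then show ?thesis by auto
  qed
  have "cmod (\<phi> t) \<le> R + R" for t
    using cmod_le[of "\<phi> t"] b[of 0 t] b[of 1 t] by (simp add: \<phi>_def)
  then show "bounded (range \<phi>)" unfolding bounded_iff by blast
  fix z assume z: "cmod z < R"
  have r: "0 \<le> (w + R) / (2 * R)" "(w + R) / (2 * R) < 1" if "\<bar>w\<bar> < R" for w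
    using that assms by (auto simp: divide_less_eq)
  obtain t where t: "t \<in> {0..1}" "schoenberg 0 t = (Re z + R) / (2 * R)" "schoenberg 1 t = (Im z + R) / (2 * R)"
    using schoenberg_surj[OF r[of "Re z"] r[of "Im z"]] z abs_Re_le_cmod[of z] abs_Im_le_cmod[of z] by auto
  then show "\<exists>t\<in>{0..1}. \<phi> t = z" using assms by (intro bexI[of _ t]) (auto simp: \<phi>_def complex_eq_iff)
qed

text \<open>A measurable right inverse \<open>sel\<close> of the curve transports the measures to an
  interval, where Helly's theorem applies; the limit is carried back along the curve. Composition
  with the curve keeps test functions bounded and continuous.\<close>

theorem weak_compactness:
  assumes "compact E" and \<mu>: "\<And>n. \<mu> n \<in> borel_probabilities_on E"
  shows "\<exists>s \<sigma>. strict_mono (s :: nat \<Rightarrow> nat) \<and> \<sigma> \<in> borel_probabilities_on E \<and>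
    (\<forall>f :: complex \<Rightarrow> real. continuous_on UNIV f \<longrightarrow> (\<lambda>n. integral\<^sup>L (\<mu> (s n)) f) \<longlonglongrightarrow> integral\<^sup>L \<sigma> f)"
proof -
  have E: "closed E" "bounded E" "E \<noteq> {}" "E \<in> sets borel"
    using assms bp_nonempty[OF \<mu>] by (auto simp: compact_imp_closed compact_imp_bounded)
  obtain R where R: "R > 0" "\<And>z. z \<in> E \<Longrightarrow> cmod z < R"
    using E(2) bounded_pos_less[of E] by blast
  obtain \<phi> :: "real \<Rightarrow> complex" where \<phi>: "continuous_on UNIV \<phi>" "bounded (range \<phi>)"
    "\<And>z. cmod z < R \<Longrightarrow> \<exists>t\<in>{0..1}. \<phi> t = z" using plane_filling_curve[OF R(1)] by blast
  \<comment> \<open>Choosing the least parameter makes \<open>sel\<close> Borel: for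
    \<open>0 \<le> a\<close>, the points of \<open>E\<close> with \<open>sel z \<le> a\<close> are
    those in the compact image of \<open>{0..min 1 a}\<close>.\<close>
  define sel where "sel z = (if z \<in> E then Inf {t\<in>{0..1}. \<phi> t = z} else 0)" for z
  have sel: "sel z \<in> {0..1}" "\<phi> (sel z) = z" "\<And>t. t \<in> {0..1} \<Longrightarrow> \<phi> t = z \<Longrightarrow> sel z \<le> t" if z: "z \<in> E" for z
  proof -
    let ?A = "{t\<in>{0..1}. \<phi> t = z}"
    have ne: "?A \<noteq> {}" using \<phi>(3)[OF R(2)[OF z]] by auto
    have bb: "bdd_below ?A" by (rule bdd_belowI[of _ 0]) auto
    have "?A = {0..1} \<inter> \<phi> -` {z}" by auto
    then have "closed ?A"
      using continuous_closed_vimage[of "{z}" \<phi>] \<phi>(1) by (auto simp: continuous_on_eq_continuous_at intro!: closed_Int)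
    then have "Inf ?A \<in> ?A" using closed_contains_Inf[OF ne bb] by blast
    then show "sel z \<in> {0..1}" "\<phi> (sel z) = z" using z by (auto simp: sel_def)
    show "sel z \<le> t" if "t \<in> {0..1}" "\<phi> t = z" for t
      using z that bb by (auto simp: sel_def intro!: cInf_lower)
  qed
  have sel01: "0 \<le> sel z" "sel z \<le> 1" for z using sel(1)[of z] by (cases "z \<in> E"; auto simp: sel_def)+
  have selm: "sel \<in> borel_measurable borel"
  proof (rule borel_measurableI_le)
    fix a :: real
    show "{z \<in> space borel. sel z \<le> a} \<in> sets borel"
    proof (cases "a < 0")
      case True
      then have "{z. sel z \<le> a} = {}" using sel01(1) by (auto simp: not_le intro: less_le_trans)
      then show ?thesis by simp
    next
      case False
      have "{z. sel z \<le> a} = - E \<union> (E \<inter> \<phi> ` {0..min 1 a})"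
      proof (intro set_eqI iffI)
        fix z assume "z \<in> {z. sel z \<le> a}"
        then show "z \<in> - E \<union> (E \<inter> \<phi> ` {0..min 1 a})"
          using sel(1,2)[of z] by (cases "z \<in> E") (auto intro!: image_eqI[of z \<phi> "sel z"])
      next
        fix z assume "z \<in> - E \<union> (E \<inter> \<phi> ` {0..min 1 a})"
        then show "z \<in> {z. sel z \<le> a}"
        proof
          assume "z \<in> - E" then show ?thesis using False by (simp add: sel_def)
        next
          assume "z \<in> E \<inter> \<phi> ` {0..min 1 a}"
          then obtain t where "z \<in> E" "t \<in> {0..1}" "t \<le> a" "\<phi> t = z" by auto
          then show ?thesis using sel(3)[of z t] by auto
        qed
      qed
      moreover have "compact (\<phi> ` {0..min 1 a})"
        by (intro compact_continuous_image continuous_on_subset[OF \<phi>(1)]) auto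
      ultimately show ?thesis using E(4) by (auto simp: compact_imp_closed)
    qed
  qed
  define \<kappa> where "\<kappa> n = distr (\<mu> n) borel sel" for n
  have selmu: "sel \<in> borel_measurable (\<mu> n)" for n using bp_measurable[OF \<mu> selm] .
  have \<kappa>: "real_distribution (\<kappa> n)" for n
    unfolding real_distribution_def real_distribution_axioms_def \<kappa>_def
    using prob_space.prob_space_distr[OF bpD(1)[OF \<mu>] selmu] by simp
  \<comment> \<open>Tightness is phrased with half-open intervals; the left end -1 keeps the
    parameter 0 inside.\<close>
  have \<kappa>1: "measure (\<kappa> n) {- 1<..1} = 1" for n
  proof -
    have "- 1 < sel z" for z using sel01(1)[of z] by linarith
    then have "sel -` {- 1<..1} \<inter> space (\<mu> n) = UNIV"
      using sel01 bpD(3)[OF \<mu>] by auto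
    then show ?thesis unfolding \<kappa>_def using selmu bpD(7)[OF \<mu>] by (simp add: measure_distr)
  qed
  have "tight \<kappa>" unfolding tight_def
  proof (intro conjI allI impI)
    fix \<epsilon> :: real assume "0 < \<epsilon>"
    then show "\<exists>a b. a < b \<and> (\<forall>n. 1 - \<epsilon> < measure (\<kappa> n) {a<..b})"
      using \<kappa>1 by (intro exI[of _ "- 1"] exI[of _ 1]) auto
  qed (rule \<kappa>)
  from tight_imp_convergent_subsubsequence[OF this strict_mono_id]
  obtain s M where s: "strict_mono (s :: nat \<Rightarrow> nat)" and M: "real_distribution M" and conv: "weak_conv_m (\<kappa> \<circ> id \<circ> s) M"
    by blast
  interpret M: real_distribution M by (rule M)
  have conv: "weak_conv_m (\<lambda>n. \<kappa> (s n)) M" using conv by (simp add: o_def)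
  have \<phi>m: "\<phi> \<in> borel_measurable borel" by (rule borel_measurable_continuous_onI[OF \<phi>(1)])
  then have \<phi>M: "\<phi> \<in> borel_measurable M" by simp
  define \<sigma> where "\<sigma> = distr M borel \<phi>"
  have lim: "(\<lambda>n. integral\<^sup>L (\<mu> (s n)) f) \<longlonglongrightarrow> integral\<^sup>L \<sigma> f" if f: "continuous_on UNIV f" for f :: "complex \<Rightarrow> real"
  proof -
    have fm: "f \<in> borel_measurable borel" by (rule borel_measurable_continuous_onI[OF f])
    have c: "continuous_on UNIV (\<lambda>t. f (\<phi> t))" by (rule continuous_on_compose2[OF f \<phi>(1)]) auto
    then have ic: "isCont (\<lambda>t. f (\<phi> t)) t" for t by (simp add: continuous_on_eq_continuous_at)
    obtain B where "\<forall>t\<in>range \<phi>. \<bar>f t\<bar> \<le> B" using bounded_imp_bounded_continuous[OF \<phi>(2) f] by blast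
    then have B: "norm (f (\<phi> t)) \<le> B" for t by simp
    have "(\<lambda>n. integral\<^sup>L (\<kappa> (s n)) (\<lambda>t. f (\<phi> t))) \<longlonglongrightarrow> integral\<^sup>L M (\<lambda>t. f (\<phi> t))"
      by (rule weak_conv_imp_integral_bdd_continuous_conv[OF \<kappa> M conv ic B])
    moreover have "integral\<^sup>L (\<kappa> n) (\<lambda>t. f (\<phi> t)) = integral\<^sup>L (\<mu> n) f" for n
    proof -
      have fp: "(\<lambda>t. f (\<phi> t)) \<in> borel_measurable borel" by (rule borel_measurable_continuous_onI[OF c])
      have "integral\<^sup>L (\<kappa> n) (\<lambda>t. f (\<phi> t)) = (\<integral>z. f (\<phi> (sel z)) \<partial>\<mu> n)"
        unfolding \<kappa>_def by (rule integral_distr[OF selmu fp])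
      also have "\<dots> = integral\<^sup>L (\<mu> n) f"
        using sel(2) measurable_compose[OF selm fp] by (intro bp_integral_cong[OF \<mu> _ fm]) auto
      finally show ?thesis .
    qed
    moreover have "integral\<^sup>L M (\<lambda>t. f (\<phi> t)) = integral\<^sup>L \<sigma> f"
      unfolding \<sigma>_def by (rule integral_distr[OF \<phi>M fm, symmetric])
    ultimately show ?thesis by simp
  qed
  have "\<sigma> \<in> borel_probabilities_on E"
  proof (rule bpI)
    show ps: "prob_space \<sigma>" unfolding \<sigma>_def by (rule M.prob_space_distr[OF \<phi>M])
    show ss: "sets \<sigma> = sets borel" by (simp add: \<sigma>_def)
    show "E \<in> sets borel" by fact
    \<comment> \<open>The curve fills more than \<open>E\<close>, so the limit might leave
      \<open>E\<close>. The truncated distance to \<open>E\<close> has integral 0 along the sequence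
      and hence in the limit.\<close>
    define f where "f z = min 1 (infdist z E)" for z
    have fc: "continuous_on UNIV f" unfolding f_def by (intro continuous_intros)
    have "integral\<^sup>L (\<mu> n) f = 0" for n
    proof -
      have "AE z in \<mu> n. f z = 0" using bpD(6)[OF \<mu>] by eventually_elim (simp add: f_def)
      then show ?thesis by (rule integral_eq_zero_AE)
    qed
    then have i0: "integral\<^sup>L \<sigma> f = 0" using lim[OF fc] LIMSEQ_unique[OF _ tendsto_const] by fastforce
    interpret S: prob_space \<sigma> by (rule ps)
    have fm: "f \<in> borel_measurable \<sigma>"
      using borel_measurable_continuous_onI[OF fc] measurable_cong_sets[OF ss refl] by blast
    have f0: "0 \<le> f z" "f z \<le> 1" for z by (auto simp: f_def infdist_nonneg)
    have "integrable \<sigma> f" using fm f0 by (intro S.integrable_const_bound[where B = 1]) auto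
    then have "AE z in \<sigma>. f z = 0" using i0 f0 by (subst (asm) integral_nonneg_eq_0_iff_AE) auto
    then show "AE z in \<sigma>. z \<in> E"
    proof eventually_elim
      case (elim z)
      then have "infdist z E = 0" using infdist_nonneg[of z E] by (auto simp: f_def min_def split: if_splits)
      then show ?case using E in_closed_iff_infdist_zero by blast
    qed
  qed
  then show ?thesis using s lim by blast
qed

text \<open>Weak convergence gives pointwise convergence, and the common Lipschitz constant
  \<open>1 / e\<close> reduces uniformity to a finite net of \<open>E\<close>.\<close>

lemma trunc_pot_weak_uniform:
  assumes E: "compact E" and \<mu>: "\<And>n. \<mu> n \<in> borel_probabilities_on E" and \<sigma>: "\<sigma> \<in> borel_probabilities_on E"
    and lim: "\<And>f :: complex \<Rightarrow> real. continuous_on UNIV f \<Longrightarrow> (\<lambda>n. integral\<^sup>L (\<mu> n) f) \<longlonglongrightarrow> integral\<^sup>L \<sigma> f"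
    and e: "0 < e" and \<epsilon>: "0 < \<epsilon>"
  shows "\<forall>\<^sub>F n in sequentially. \<forall>z\<in>E. \<bar>trunc_pot (\<mu> n) e z - trunc_pot \<sigma> e z\<bar> < \<epsilon>"
proof -
  have bd: "bounded E" using E by (rule compact_imp_bounded)
  define d where "d = e * \<epsilon> / 3"
  have d: "d > 0" using e \<epsilon> by (simp add: d_def)
  have "\<exists>C. finite C \<and> C \<subseteq> E \<and> E \<subseteq> (\<Union>c\<in>C. ball c d)"
    using seq_compact_imp_totally_bounded[of E] E d by (simp add: compact_eq_seq_compact_metric)
  then obtain C where C: "finite C" "C \<subseteq> E" "E \<subseteq> (\<Union>c\<in>C. ball c d)" by blast
  have "\<forall>\<^sub>F n in sequentially. \<forall>c\<in>C. \<bar>trunc_pot (\<mu> n) e c - trunc_pot \<sigma> e c\<bar> < \<epsilon> / 3"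
  proof (intro eventually_ball_finite C(1) ballI)
    fix c
    have "(\<lambda>n. trunc_pot (\<mu> n) e c) \<longlonglongrightarrow> trunc_pot \<sigma> e c"
      unfolding trunc_pot_def by (rule lim[OF continuous_on_trunc_log[OF e]])
    from tendstoD[OF this, of "\<epsilon> / 3"] \<epsilon>
    show "\<forall>\<^sub>F n in sequentially. \<bar>trunc_pot (\<mu> n) e c - trunc_pot \<sigma> e c\<bar> < \<epsilon> / 3" by (simp add: dist_real_def)
  qed
  then show ?thesis
  proof eventually_elim
    case (elim n)
    show ?case
    proof
      fix z assume "z \<in> E"
      then obtain c where c: "c \<in> C" "z \<in> ball c d" using C(3) by blast
      have "cmod (z - c) / e < d / e" using c(2) e by (intro divide_strict_right_mono) (auto simp: dist_norm norm_minus_commute)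
      then have l: "cmod (z - c) / e < \<epsilon> / 3" using e by (simp add: d_def)
      have "\<bar>trunc_pot (\<mu> n) e z - trunc_pot (\<mu> n) e c\<bar> < \<epsilon> / 3" "\<bar>trunc_pot \<sigma> e z - trunc_pot \<sigma> e c\<bar> < \<epsilon> / 3"
        using trunc_pot_Lipschitz[OF \<mu> bd e, of n z c] trunc_pot_Lipschitz[OF \<sigma> bd e, of z c] l by linarith+
      moreover have "\<bar>trunc_pot (\<mu> n) e c - trunc_pot \<sigma> e c\<bar> < \<epsilon> / 3" using elim c(1) by blast
      ultimately show "\<bar>trunc_pot (\<mu> n) e z - trunc_pot \<sigma> e z\<bar> < \<epsilon>" by linarith
    qed
  qed
qed

text \<open>Both measures of the energy vary. One is replaced by its limit using uniform convergence
  of the potentials; the other is then tested against the fixed continuous function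
  \<open>trunc_pot \<sigma> e\<close>.\<close>

lemma trunc_energy_weak:
  assumes E: "compact E" and \<mu>: "\<And>n. \<mu> n \<in> borel_probabilities_on E" and \<sigma>: "\<sigma> \<in> borel_probabilities_on E"
    and lim: "\<And>f :: complex \<Rightarrow> real. continuous_on UNIV f \<Longrightarrow> (\<lambda>n. integral\<^sup>L (\<mu> n) f) \<longlonglongrightarrow> integral\<^sup>L \<sigma> f"
    and e: "0 < e"
  shows "(\<lambda>n. trunc_energy (\<mu> n) (\<mu> n) e) \<longlonglongrightarrow> trunc_energy \<sigma> \<sigma> e"
proof -
  have bd: "bounded E" using E by (rule compact_imp_bounded)
  have 1: "(\<lambda>n. trunc_energy \<sigma> (\<mu> n) e) \<longlonglongrightarrow> trunc_energy \<sigma> \<sigma> e"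
    unfolding trunc_energy_def by (rule lim[OF continuous_on_trunc_pot[OF \<sigma> bd e]])
  have "(\<lambda>n. trunc_energy (\<mu> n) (\<mu> n) e - trunc_energy \<sigma> (\<mu> n) e) \<longlonglongrightarrow> 0"
  proof (rule tendstoI)
    fix \<epsilon> :: real assume "0 < \<epsilon>"
    then have "\<forall>\<^sub>F n in sequentially. \<forall>z\<in>E. \<bar>trunc_pot (\<mu> n) e z - trunc_pot \<sigma> e z\<bar> < \<epsilon> / 2"
      by (intro trunc_pot_weak_uniform[OF E \<mu> \<sigma> lim e]) auto
    then show "\<forall>\<^sub>F n in sequentially. dist (trunc_energy (\<mu> n) (\<mu> n) e - trunc_energy \<sigma> (\<mu> n) e) 0 < \<epsilon>"
    proof eventually_elim
      case (elim n)
      have i: "integrable (\<mu> n) (trunc_pot (\<mu> n) e)" "integrable (\<mu> n) (trunc_pot \<sigma> e)"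
        using integrable_trunc_pot[OF \<mu> bd \<mu> bd e] integrable_trunc_pot[OF \<sigma> bd \<mu> bd e] by auto
      have eq: "trunc_energy (\<mu> n) (\<mu> n) e - trunc_energy \<sigma> (\<mu> n) e = (\<integral>z. trunc_pot (\<mu> n) e z - trunc_pot \<sigma> e z \<partial>\<mu> n)"
        unfolding trunc_energy_def using i by simp
      have d: "trunc_pot (\<mu> n) e z - trunc_pot \<sigma> e z \<le> \<epsilon> / 2" "- (\<epsilon> / 2) \<le> trunc_pot (\<mu> n) e z - trunc_pot \<sigma> e z" if "z \<in> E" for z
      proof -
        have "\<bar>trunc_pot (\<mu> n) e z - trunc_pot \<sigma> e z\<bar> < \<epsilon> / 2" using elim that by blast
        then show "trunc_pot (\<mu> n) e z - trunc_pot \<sigma> e z \<le> \<epsilon> / 2" "- (\<epsilon> / 2) \<le> trunc_pot (\<mu> n) e z - trunc_pot \<sigma> e z"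
          by linarith+
      qed
      note id = Bochner_Integration.integrable_diff[OF i]
      have "(\<integral>z. trunc_pot (\<mu> n) e z - trunc_pot \<sigma> e z \<partial>\<mu> n) \<le> \<epsilon> / 2" "- (\<epsilon> / 2) \<le> (\<integral>z. trunc_pot (\<mu> n) e z - trunc_pot \<sigma> e z \<partial>\<mu> n)"
        using bp_integral_le_const[OF \<mu> id d(1)] bp_integral_ge_const[OF \<mu> id d(2)] by blast+
      then show ?case unfolding eq using \<open>0 < \<epsilon>\<close> by (auto simp: dist_real_def)
    qed
  qed
  from tendsto_add[OF this 1] show ?thesis by simp
qed

section \<open>Leja points and the generalised maximum principle\<close>

text \<open>A maximising sequence has a weak limit. For each fixed \<open>e\<close> the truncated
  energy is weakly continuous, so the lower bounds \<open>V - 1 / Suc n\<close> pass to the limit as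
  \<open>V\<close>.\<close>

lemma equilibrium_exists:
  assumes E: "compact E" and \<sigma>0: "\<sigma>0 \<in> borel_probabilities_on E" "\<And>e. 0 < e \<Longrightarrow> A0 \<le> trunc_energy \<sigma>0 \<sigma>0 e"
  shows "\<exists>V \<mu>. equilibrium E V \<mu>"
proof -
  have bd: "bounded E" using E by (rule compact_imp_bounded)
  define W where "W = {A. \<exists>\<sigma>\<in>borel_probabilities_on E. \<forall>e>0. A \<le> trunc_energy \<sigma> \<sigma> e}"
  have ne: "W \<noteq> {}" using \<sigma>0 by (auto simp: W_def)
  obtain c where c: "c \<ge> 0" "\<And>z t. z \<in> E \<Longrightarrow> t \<in> E \<Longrightarrow> trunc_log 1 z t \<le> c"
    using trunc_log_bounded_above[OF bd bd] by (metis order_refl zero_less_one)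
  have "A \<le> c" if AW: "A \<in> W" for A
  proof -
    obtain \<sigma> where "\<sigma> \<in> borel_probabilities_on E" "\<forall>e>0. A \<le> trunc_energy \<sigma> \<sigma> e" using AW unfolding W_def by blast
    then have \<sigma>: "\<sigma> \<in> borel_probabilities_on E" "A \<le> trunc_energy \<sigma> \<sigma> 1" by simp_all
    have "trunc_pot \<sigma> 1 z \<le> c" if "z \<in> E" for z
      unfolding trunc_pot_def using c that by (intro bp_integral_le_const[OF \<sigma>(1)] integrable_trunc_log[OF \<sigma>(1) bd]) auto
    then have "trunc_energy \<sigma> \<sigma> 1 \<le> c"
      unfolding trunc_energy_def by (intro bp_integral_le_const[OF \<sigma>(1)] integrable_trunc_pot[OF \<sigma>(1) bd \<sigma>(1) bd]) auto
    then show ?thesis using \<sigma>(2) by simp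
  qed
  then have bdd: "bdd_above W" by (rule bdd_aboveI)
  define V where "V = Sup W"
  have "\<exists>\<sigma>. \<sigma> \<in> borel_probabilities_on E \<and> (\<forall>e>0. V - 1 / Suc n \<le> trunc_energy \<sigma> \<sigma> e)" for n
  proof -
    have "V - 1 / Suc n < Sup W" by (simp add: V_def)
    then obtain A where "A \<in> W" "V - 1 / Suc n < A" using less_cSup_iff[OF ne bdd] by blast
    then show ?thesis unfolding W_def by (force intro: order_trans less_imp_le)
  qed
  then obtain \<sigma> where \<sigma>: "\<And>n. \<sigma> n \<in> borel_probabilities_on E" "\<And>n e. 0 < e \<Longrightarrow> V - 1 / Suc n \<le> trunc_energy (\<sigma> n) (\<sigma> n) e"
    by metis
  obtain s \<mu> where s: "strict_mono (s :: nat \<Rightarrow> nat)" "\<mu> \<in> borel_probabilities_on E"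
    "\<And>f :: complex \<Rightarrow> real. continuous_on UNIV f \<Longrightarrow> (\<lambda>n. integral\<^sup>L (\<sigma> (s n)) f) \<longlonglongrightarrow> integral\<^sup>L \<mu> f"
    using weak_compactness[of E \<sigma>, OF E \<sigma>(1)] by blast
  have "equilibrium E V \<mu>"
  proof
    show "compact E" "\<mu> \<in> borel_probabilities_on E" by fact+
    show "V \<le> trunc_energy \<mu> \<mu> e" if e: "0 < e" for e
    proof (rule LIMSEQ_le)
      show "(\<lambda>n. trunc_energy (\<sigma> (s n)) (\<sigma> (s n)) e) \<longlonglongrightarrow> trunc_energy \<mu> \<mu> e" by (rule trunc_energy_weak[OF E \<sigma>(1) s(2,3) e])
      have "(\<lambda>n. V - 1 / Suc n) \<longlonglongrightarrow> V - 0" by (intro tendsto_intros LIMSEQ_Suc[OF lim_1_over_n])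
      from LIMSEQ_subseq_LIMSEQ[OF this s(1)]
      show "(\<lambda>n. V - 1 / Suc (s n)) \<longlonglongrightarrow> V" by (simp add: o_def)
      show "\<exists>N. \<forall>n\<ge>N. V - 1 / Suc (s n) \<le> trunc_energy (\<sigma> (s n)) (\<sigma> (s n)) e" using \<sigma>(2)[OF e] by blast
    qed
    show "A \<le> V" if "\<rho> \<in> borel_probabilities_on E" "\<And>e. 0 < e \<Longrightarrow> A \<le> trunc_energy \<rho> \<rho> e" for \<rho> A
      unfolding V_def using that by (intro cSup_upper bdd) (auto simp: W_def)
  qed
  then show ?thesis by blast
qed

text \<open>
  A Leja sequence chooses each point so as to maximise the product of the distances to its predecessors.
  The double product of all distances is then the product of the maxima \<open>leja_max\<close>.
\<close>

definition leja_pick :: "complex set \<Rightarrow> (complex \<Rightarrow> real) \<Rightarrow> complex" where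
  "leja_pick P g = (SOME w. w \<in> P \<and> (\<forall>z\<in>P. g z \<le> g w))"

primrec leja_prod :: "complex set \<Rightarrow> nat \<Rightarrow> complex \<Rightarrow> real" where
  "leja_prod P 0 = (\<lambda>z. 1)"
| "leja_prod P (Suc n) = (\<lambda>z. leja_prod P n z * cmod (z - leja_pick P (leja_prod P n)))"

definition leja :: "complex set \<Rightarrow> nat \<Rightarrow> complex" where
  "leja P n = leja_pick P (leja_prod P n)"

lemma leja_prod_eq: "leja_prod P n z = (\<Prod>j<n. cmod (z - leja P j))"
  by (induction n) (auto simp: leja_def)

lemma continuous_on_leja_prod: "continuous_on A (leja_prod P n)"
  unfolding leja_prod_eq[abs_def] by (intro continuous_intros)

definition leja_max :: "complex set \<Rightarrow> nat \<Rightarrow> real" where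
  "leja_max P n = leja_prod P n (leja P n)"

lemma
  assumes "compact P" "P \<noteq> {}"
  shows leja_in: "leja P n \<in> P" and leja_prod_le: "z \<in> P \<Longrightarrow> leja_prod P n z \<le> leja_max P n"
proof -
  have "\<exists>w. w \<in> P \<and> (\<forall>z\<in>P. leja_prod P n z \<le> leja_prod P n w)"
    using continuous_attains_sup[OF assms continuous_on_leja_prod] by blast
  then have "leja P n \<in> P \<and> (\<forall>z\<in>P. leja_prod P n z \<le> leja_prod P n (leja P n))"
    unfolding leja_def leja_pick_def by (rule someI_ex)
  then show "leja P n \<in> P" "z \<in> P \<Longrightarrow> leja_prod P n z \<le> leja_max P n" by (auto simp: leja_max_def)
qed

lemma leja_max_pos_mono:
  assumes "compact P" "P \<noteq> {}" "0 < leja_max P m" "n \<le> m"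
  shows "0 < leja_max P n"
proof -
  have "\<forall>j<m. 0 < cmod (leja P m - leja P j)"
    using assms(3) by (auto simp: leja_max_def leja_prod_eq less_le prod_nonneg)
  then have "0 < leja_prod P n (leja P m)" using assms(4) by (auto simp: leja_prod_eq intro!: prod_pos)
  also have "\<dots> \<le> leja_max P n" using leja_in[OF assms(1,2)] by (intro leja_prod_le assms)
  finally show ?thesis .
qed

definition empirical :: "(nat \<Rightarrow> complex) \<Rightarrow> nat \<Rightarrow> complex measure" where
  "empirical w n = distr (measure_pmf (pmf_of_set {..<n})) borel w"

lemma
  assumes "0 < n"
  shows integral_empirical: "f \<in> borel_measurable borel \<Longrightarrow> (\<integral>z. f z \<partial>empirical w n) = (\<Sum>j<n. f (w j)) / real n"
    and empirical_bp: "P \<in> sets borel \<Longrightarrow> (\<And>j. j < n \<Longrightarrow> w j \<in> P) \<Longrightarrow> empirical w n \<in> borel_probabilities_on P"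
proof -
  have ne: "{..<n} \<noteq> {}" using assms by auto
  show "(\<integral>z. f z \<partial>empirical w n) = (\<Sum>j<n. f (w j)) / real n" if "f \<in> borel_measurable borel" for f :: "complex \<Rightarrow> real"
    unfolding empirical_def using that ne
    by (subst integral_distr) (auto simp: integral_pmf_of_set)
  show "empirical w n \<in> borel_probabilities_on P" if "P \<in> sets borel" "\<And>j. j < n \<Longrightarrow> w j \<in> P"
  proof (rule bpI)
    show "prob_space (empirical w n)" unfolding empirical_def
      by (intro prob_space.prob_space_distr prob_space_measure_pmf) simp
    show "AE t in empirical w n. t \<in> P"
      unfolding empirical_def using that ne
      by (subst AE_distr_iff) (auto simp: AE_measure_pmf_iff set_pmf_of_set)
  qed (use that in \<open>auto simp: empirical_def\<close>)
qed

lemma double_sum_symmetric: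
  fixes a :: "nat \<Rightarrow> nat \<Rightarrow> real"
  assumes "\<And>i j. a i j = a j i"
  shows "(\<Sum>i<n. \<Sum>j<n. a i j) = (\<Sum>i<n. a i i) + 2 * (\<Sum>i<n. \<Sum>j<i. a i j)"
proof (induction n)
  case (Suc n)
  have "(\<Sum>i<Suc n. \<Sum>j<Suc n. a i j) = (\<Sum>i<n. \<Sum>j<n. a i j) + (\<Sum>i<n. a i n) + (\<Sum>j<n. a n j) + a n n"
    by (simp add: sum.distrib)
  also have "(\<Sum>i<n. a i n) = (\<Sum>j<n. a n j)" using assms by (intro sum.cong) auto
  finally show ?case using Suc by simp
qed simp

lemma empirical_energy:
  assumes n: "0 < n" and e: "0 < e"
  shows "trunc_energy (empirical w n) (empirical w n) e
    = ((\<Sum>i<n. trunc_log e (w i) (w i)) + 2 * (\<Sum>i<n. \<Sum>j<i. trunc_log e (w i) (w j))) / (real n)\<^sup>2"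
proof -
  have bp: "empirical w n \<in> borel_probabilities_on (w ` {..<n})"
    by (rule empirical_bp[OF n]) (auto intro: finite_imp_closed borel_closed)
  have bd: "bounded (w ` {..<n})" by (intro finite_imp_bounded) auto
  have p: "trunc_pot (empirical w n) e z = (\<Sum>j<n. trunc_log e z (w j)) / real n" for z
    unfolding trunc_pot_def by (rule integral_empirical[OF n trunc_log_measurable])
  have "trunc_energy (empirical w n) (empirical w n) e = (\<Sum>i<n. trunc_pot (empirical w n) e (w i)) / real n"
    unfolding trunc_energy_def by (rule integral_empirical[OF n trunc_pot_measurable[OF bp bd e]])
  also have "\<dots> = (\<Sum>i<n. \<Sum>j<n. trunc_log e (w i) (w j)) / (real n)\<^sup>2"
    unfolding p by (simp add: sum_divide_distrib[symmetric] power2_eq_square)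
  also have "(\<Sum>i<n. \<Sum>j<n. trunc_log e (w i) (w j)) = (\<Sum>i<n. trunc_log e (w i) (w i)) + 2 * (\<Sum>i<n. \<Sum>j<i. trunc_log e (w i) (w j))"
    by (rule double_sum_symmetric[OF trunc_log_commute])
  finally show ?thesis .
qed

text \<open>For each \<open>i\<close> the logarithms of the distances to the earlier points add up
  to \<open>ln (leja_max P i)\<close>, at least about \<open>i * A\<close>, so the off-diagonal sum
  is about \<open>A * m^2\<close>; truncation only increases it. The diagonal contributes at least
  \<open>m * ln e\<close>, which division by \<open>m^2\<close> removes in the limit.\<close>

lemma leja_limit_energy:
  assumes P: "compact P" "P \<noteq> {}" and pos: "\<And>n. 0 < leja_max P n"
    and A: "\<And>n. n0 \<le> n \<Longrightarrow> real n * A \<le> ln (leja_max P n)"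
    and k: "\<And>n. 0 < k n" "filterlim k at_top sequentially"
    and \<sigma>: "\<sigma> \<in> borel_probabilities_on P"
    and lim: "\<And>f :: complex \<Rightarrow> real. continuous_on UNIV f \<Longrightarrow> (\<lambda>n. integral\<^sup>L (empirical (leja P) (k n)) f) \<longlonglongrightarrow> integral\<^sup>L \<sigma> f"
    and e: "0 < e"
  shows "A \<le> trunc_energy \<sigma> \<sigma> e"
proof -
  let ?w = "leja P"
  have bp: "empirical ?w (k n) \<in> borel_probabilities_on P" for n
    using P leja_in[OF P] by (intro empirical_bp[OF k(1)]) (auto intro: compact_imp_closed borel_closed)
  have conv: "(\<lambda>n. trunc_energy (empirical ?w (k n)) (empirical ?w (k n)) e) \<longlonglongrightarrow> trunc_energy \<sigma> \<sigma> e"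
    by (rule trunc_energy_weak[OF P(1) bp \<sigma> lim e])
  \<comment> \<open>The total error from the indices below \<open>n0\<close>, where no lower bound
    is assumed.\<close>
  define C where "C = (\<Sum>i<n0. \<bar>ln (leja_max P i) - real i * A\<bar>)"
  have lb: "(real m * ln e + (A * (real m * (real m - 1)) - 2 * C)) / (real m)\<^sup>2 \<le> trunc_energy (empirical ?w m) (empirical ?w m) e"
    if m: "0 < m" for m
  proof -
    have ln_T: "ln (leja_max P i) \<le> (\<Sum>j<i. trunc_log e (?w i) (?w j))" for i
    proof -
      have ne: "?w i \<noteq> ?w j" if "j < i" for j
      proof
        assume "?w i = ?w j"
        then have "leja_prod P i (?w i) = 0"
          unfolding leja_prod_eq using that by (intro prod_zero bexI[of _ j]) auto
        then show False using pos[of i] by (simp add: leja_max_def)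
      qed
      have "ln (leja_max P i) = (\<Sum>j<i. ln (cmod (?w i - ?w j)))"
        unfolding leja_max_def leja_prod_eq using ne by (subst ln_prod) auto
      also have "\<dots> \<le> (\<Sum>j<i. trunc_log e (?w i) (?w j))" using ne by (intro sum_mono trunc_log_ge_ln) auto
      finally show ?thesis .
    qed
    have "(\<Sum>i<m. - (if i < n0 then \<bar>ln (leja_max P i) - real i * A\<bar> else 0)) \<le> (\<Sum>i<m. ln (leja_max P i) - real i * A)"
    proof (rule sum_mono)
      fix i
      show "- (if i < n0 then \<bar>ln (leja_max P i) - real i * A\<bar> else 0) \<le> ln (leja_max P i) - real i * A"
        using A[of i] abs_ge_minus_self[of "ln (leja_max P i) - real i * A"] by (cases "i < n0") auto
    qed
    moreover have "(\<Sum>i<m. (if i < n0 then \<bar>ln (leja_max P i) - real i * A\<bar> else 0)) \<le> C"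
    proof -
      have "(\<Sum>i<m. (if i < n0 then \<bar>ln (leja_max P i) - real i * A\<bar> else 0))
          = (\<Sum>i\<in>{i\<in>{..<m}. i < n0}. \<bar>ln (leja_max P i) - real i * A\<bar>)"
        by (rule sum.inter_filter[symmetric]) simp
      also have "\<dots> \<le> C" unfolding C_def by (intro sum_mono2) auto
      finally show ?thesis .
    qed
    ultimately have "- C \<le> (\<Sum>i<m. ln (leja_max P i)) - A * (\<Sum>i<m. real i)"
      by (simp add: sum_negf sum_subtractf sum_distrib_left mult.commute)
    moreover have "(\<Sum>i<m. real i) = real m * (real m - 1) / 2"
      by (induction m) (auto simp: field_simps)
    moreover have "(\<Sum>i<m. ln (leja_max P i)) \<le> (\<Sum>i<m. \<Sum>j<i. trunc_log e (?w i) (?w j))"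
      by (intro sum_mono ln_T)
    ultimately have S: "A * (real m * (real m - 1)) - 2 * C \<le> 2 * (\<Sum>i<m. \<Sum>j<i. trunc_log e (?w i) (?w j))"
      by (simp add: algebra_simps)
    have "(\<Sum>i<m. ln e) \<le> (\<Sum>i<m. trunc_log e (?w i) (?w i))" by (intro sum_mono trunc_log_ge e)
    then have "real m * ln e \<le> (\<Sum>i<m. trunc_log e (?w i) (?w i))" by simp
    then show ?thesis unfolding empirical_energy[OF m e] using S by (intro divide_right_mono add_mono) auto
  qed
  have "(\<lambda>m. (real m * ln e + (A * (real m * (real m - 1)) - 2 * C)) / (real m)\<^sup>2) \<longlonglongrightarrow> A"
  proof -
    have i: "(\<lambda>m. 1 / real m) \<longlonglongrightarrow> 0" by (rule lim_1_over_n)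
    have "(\<lambda>m. (1 / real m) * ln e + (A * (1 - 1 / real m) - 2 * C * (1 / real m) * (1 / real m)))
        \<longlonglongrightarrow> 0 * ln e + (A * (1 - 0) - 2 * C * 0 * 0)"
      by (intro tendsto_intros i)
    moreover have "\<forall>\<^sub>F m in sequentially. (1 / real m) * ln e + (A * (1 - 1 / real m) - 2 * C * (1 / real m) * (1 / real m))
       = (real m * ln e + (A * (real m * (real m - 1)) - 2 * C)) / (real m)\<^sup>2"
      using eventually_gt_at_top[of 0]
      by eventually_elim (simp add: field_simps power2_eq_square)
    ultimately show ?thesis by (simp add: tendsto_cong)
  qed
  from filterlim_compose[OF this k(2)] conv
  show ?thesis by (rule LIMSEQ_le) (use lb[OF k(1)] in auto)
qed

text \<open>If the maxima stayed above \<open>exp (n * B)\<close>, a weak limit of the empirical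
  measures would have energy at least \<open>B\<close>. On a set of capacity zero \<open>B\<close>
  is arbitrary, which yields polynomials that are tiny there; on \<open>E\<close> the choice
  \<open>B = V + \<eta>\<close> bounds the norms.\<close>

lemma leja_max_small:
  assumes P: "compact P" "P \<noteq> {}" and no: "\<And>\<sigma>. \<sigma> \<in> borel_probabilities_on P \<Longrightarrow> \<exists>e>0. trunc_energy \<sigma> \<sigma> e < B"
  shows "\<exists>n\<ge>n0. 0 < n \<and> leja_max P n < exp (real n * B)"
proof (rule ccontr)
  assume "\<not> ?thesis"
  then have ge: "exp (real n * B) \<le> leja_max P n" if "max 1 n0 \<le> n" for n using that by (force simp: not_less)
  have pos: "0 < leja_max P n" for n
  proof (rule leja_max_pos_mono[OF P])
    show "0 < leja_max P (max n (max 1 n0))"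
      using ge[of "max n (max 1 n0)"] exp_gt_zero by (metis less_le_trans max.cobounded2)
  qed simp
  have A: "real n * B \<le> ln (leja_max P n)" if "max 1 n0 \<le> n" for n
    using ge[OF that] pos[of n] by (simp add: ln_ge_iff)
  have bp: "empirical (leja P) (Suc n) \<in> borel_probabilities_on P" for n
    using P leja_in[OF P] by (intro empirical_bp) (auto intro: compact_imp_closed borel_closed)
  obtain s \<sigma> where s: "strict_mono (s :: nat \<Rightarrow> nat)" "\<sigma> \<in> borel_probabilities_on P"
    "\<And>f :: complex \<Rightarrow> real. continuous_on UNIV f \<Longrightarrow> (\<lambda>n. integral\<^sup>L (empirical (leja P) (Suc (s n))) f) \<longlonglongrightarrow> integral\<^sup>L \<sigma> f"
    using weak_compactness[of P "\<lambda>n. empirical (leja P) (Suc n)", OF P(1) bp] by blast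
  have fl: "filterlim (\<lambda>n. Suc (s n)) at_top sequentially"
    using filterlim_compose[OF filterlim_Suc filterlim_subseq[OF s(1)]] .
  have "B \<le> trunc_energy \<sigma> \<sigma> e" if "0 < e" for e
    by (rule leja_limit_energy[OF P pos A zero_less_Suc fl s(2,3) that])
  with no[OF s(2)] show False by force
qed

lemma log_pot_empirical:
  assumes "0 < n" "\<And>j. j < n \<Longrightarrow> z \<noteq> w j"
  shows "log_pot (empirical w n) z = ln (\<Prod>j<n. cmod (z - w j)) / real n"
  unfolding log_pot_def using assms ln_prod[of "{..<n}" "\<lambda>j. cmod (z - w j)"]
  by (subst integral_empirical[OF assms(1)]) auto

context equilibrium
begin

text \<open>
  The majorant \<open>H\<close> is enlarged by \<open>\<epsilon> (U - V) + (\<epsilon>/2) (L - s)\<close>, where \<open>s\<close> is the normalised logarithm of a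
  polynomial that is tiny on the exceptional set \<open>P\<close>: this is nonnegative near the boundary, large near \<open>P\<close>, and
  tends to \<open>\<infinity>\<close> at \<open>\<infinity>\<close>.
\<close>

theorem generalised_maximum_principle:
  fixes u :: "complex \<Rightarrow> ereal" and H :: "complex \<Rightarrow> real"
  assumes D: "open D" "D \<subseteq> - E" "frontier D \<subseteq> E" and H: "mean_harmonic D H"
    and fin: "\<And>z. z \<in> D \<Longrightarrow> u z < \<infinity>"
    and usc: "\<And>z a. z \<in> D \<Longrightarrow> u z < a \<Longrightarrow> \<forall>\<^sub>F w in at z within D. u w < a"
    and sub: "\<And>z. z \<in> D \<Longrightarrow> submean_at u z"
    and P: "compact P" "P \<subseteq> E" and polar: "\<And>\<sigma> A. \<sigma> \<in> borel_probabilities_on P \<Longrightarrow> \<exists>e>0. trunc_energy \<sigma> \<sigma> e < A"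
    and bdry: "\<And>x \<epsilon>. x \<in> frontier D \<Longrightarrow> x \<notin> P \<Longrightarrow> 0 < \<epsilon> \<Longrightarrow> \<forall>\<^sub>F w in at x within D. u w \<le> ereal (H w + \<epsilon>)"
    and near: "\<And>x. x \<in> frontier D \<Longrightarrow> x \<in> P \<Longrightarrow> \<forall>\<^sub>F w in at x within D. u w \<le> ereal (H w + C)"
    and inf: "\<And>z. z \<in> D \<Longrightarrow> R \<le> cmod z \<Longrightarrow> u z \<le> ereal (H z + C')"
    and z1: "z1 \<in> D"
  shows "u z1 \<le> ereal (H z1)"
proof -
  obtain R0 where R0: "R0 \<ge> 1" "\<And>t. t \<in> E \<Longrightarrow> cmod t \<le> R0"
  proof -
    obtain b where "\<And>t. t \<in> E \<Longrightarrow> cmod t \<le> b" using bd bounded_iff by metis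
    then show ?thesis by (intro that[of "max 1 b"]) (auto simp: le_max_iff_disj)
  qed
  have Ecl: "closed E" using compact by (rule compact_imp_closed)
  have z1E: "z1 \<notin> E" using z1 D by auto
  then obtain d0 where d0: "d0 > 0" "ball z1 d0 \<subseteq> - E" using closed_ball_away[OF Ecl] by blast
  define d where "d = min 1 d0"
  have d: "0 < d" "d \<le> 1" "\<And>t. t \<in> E \<Longrightarrow> d \<le> cmod (z1 - t)"
    using d0 by (auto simp: d_def dist_norm subset_iff not_less min_le_iff_disj)
  \<comment> \<open>\<open>L\<close> bounds \<open>s\<close> near the frontier, where
    \<open>|w| < R0 + 1\<close>, and so makes the correction nonnegative there.\<close>
  define L where "L = ln (2 * R0 + 1)"
  \<comment> \<open>\<open>s\<close> is the logarithm of a Leja polynomial of \<open>P\<close>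
    divided by its degree. Its upper bound and its lower bound at \<open>z1\<close> are independent
    of \<open>B\<close>, which matters because \<open>B\<close> grows as \<open>\<epsilon>\<close>
    shrinks.\<close>
  have corr: "\<exists>s. mean_harmonic D s \<and> (\<forall>w\<in>D. s w \<le> ln (cmod w + R0)) \<and> ln d \<le> s z1 \<and>
      (\<forall>x\<in>P. \<forall>\<^sub>F w in at x within D. s w \<le> - B)" for B
  proof (cases "P = {}")
    case True
    have "0 \<le> ln (cmod w + R0)" for w using R0(1) by (intro ln_ge_zero) (simp add: add_increasing)
    then show ?thesis using True d D(1) by (intro exI[of _ "\<lambda>_. 0"]) (auto intro: mean_harmonic_const)
  next
    case False
    obtain n where n: "0 < n" "leja_max P n < exp (real n * (- B))"
      using leja_max_small[where B = "- B" and ?n0.0 = 0, OF P(1) False polar] by blast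
    define \<tau> where "\<tau> = empirical (leja P) n"
    have \<tau>: "\<tau> \<in> borel_probabilities_on P" unfolding \<tau>_def
      using P(1) leja_in[OF P(1) False] by (intro empirical_bp[OF n(1)]) (auto intro: compact_imp_closed borel_closed)
    have Pb: "bounded P" "closed P" using P(1) by (auto simp: compact_imp_bounded compact_imp_closed)
    have DP: "D \<subseteq> - P" using D P by auto
    have int: "integrable \<tau> (\<lambda>t. ln (cmod (w - t)))" for w
      unfolding \<tau>_def empirical_def
      by (subst integrable_distr_eq) (auto intro!: integrable_measure_pmf_finite simp: set_pmf_of_set lessThan_empty_iff n)
    have 1: "mean_harmonic D (log_pot \<tau>)"
      using mean_harmonic_subset[OF mean_harmonic_log_pot[OF \<tau> Pb] DP D(1)] .
    have 2: "log_pot \<tau> w \<le> ln (cmod w + R0)" if "w \<in> D" for w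
      unfolding log_pot_def
    proof (rule bp_integral_le_const[OF \<tau> int])
      fix t assume t: "t \<in> P"
      then have "w \<noteq> t" using DP that by auto
      moreover have "cmod (w - t) \<le> cmod w + R0" using norm_triangle_ineq4[of w t] R0(2)[of t] t P by auto
      ultimately show "ln (cmod (w - t)) \<le> ln (cmod w + R0)" by (intro ln_mono) auto
    qed
    have 3: "ln d \<le> log_pot \<tau> z1"
      unfolding log_pot_def
    proof (rule bp_integral_ge_const[OF \<tau> int])
      fix t assume "t \<in> P"
      then show "ln d \<le> ln (cmod (z1 - t))" using d(1,3) P(2) by (intro ln_mono) auto
    qed
    have 4: "\<forall>\<^sub>F w in at x within D. log_pot \<tau> w \<le> - B" if x: "x \<in> P" for x
    proof -
      have "leja_prod P n x < exp (real n * (- B))" using leja_prod_le[OF P(1) False x] n(2) by (rule le_less_trans)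
      moreover have "(leja_prod P n \<longlongrightarrow> leja_prod P n x) (at x within D)"
        using continuous_on_leja_prod[of UNIV P n] by (metis UNIV_I continuous_on_def tendsto_within_subset top_greatest)
      ultimately have "\<forall>\<^sub>F w in at x within D. leja_prod P n w < exp (real n * (- B))" by (intro order_tendstoD)
      moreover have "\<forall>\<^sub>F w in at x within D. w \<in> D" by (simp add: eventually_at_filter)
      ultimately show ?thesis
      proof eventually_elim
        case (elim w)
        have ne: "w \<noteq> leja P j" for j using elim(2) DP leja_in[OF P(1) False] by blast
        have "log_pot \<tau> w = ln (leja_prod P n w) / real n"
          unfolding \<tau>_def leja_prod_eq by (rule log_pot_empirical[OF n(1) ne])
        moreover have "0 < leja_prod P n w" unfolding leja_prod_eq using ne by (intro prod_pos) auto
        then have "ln (leja_prod P n w) \<le> real n * (- B)" using elim(1) by (metis less_imp_le ln_exp ln_mono exp_gt_zero)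
        ultimately show ?case using n(1) by (simp add: divide_le_eq mult.commute)
      qed
    qed
    show ?thesis using 1 2 3 4 by blast
  qed
  \<comment> \<open>The correction at \<open>z1\<close> is at most \<open>\<epsilon> * Q\<close>,
    and \<open>Q\<close> is free of \<open>\<epsilon>\<close>.\<close>
  define Q where "Q = (log_pot \<mu> z1 - V) + (L - ln d) / 2"
  have main: "u z1 \<le> ereal (H z1 + \<epsilon> * Q)" if \<epsilon>: "0 < \<epsilon>" for \<epsilon>
  proof -
    define B where "B = 2 * \<bar>C\<bar> / \<epsilon> + \<bar>L\<bar>"
    obtain s where s: "mean_harmonic D s" "\<And>w. w \<in> D \<Longrightarrow> s w \<le> ln (cmod w + R0)" "ln d \<le> s z1"
      "\<And>x. x \<in> P \<Longrightarrow> \<forall>\<^sub>F w in at x within D. s w \<le> - B" using corr[of B] by blast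
    define G where "G w = \<epsilon> * (log_pot \<mu> w + (- V)) + (\<epsilon> / 2) * (L + (- 1) * s w)" for w
    have Gh: "mean_harmonic D (\<lambda>w. H w + G w)"
      unfolding G_def using mean_harmonic_subset[OF mean_harmonic_log_pot' D(2,1)] s(1) D(1) H
      by (intro mean_harmonic_add mean_harmonic_mult mean_harmonic_const) auto
    have G_ge: "(\<epsilon> / 2) * (L - s w) \<le> G w" for w
      using \<epsilon> log_pot_ge[of w] by (simp add: G_def)
    have loc: "\<forall>\<^sub>F w in at x within D. w \<in> D \<and> s w \<le> L" if "x \<in> frontier D" for x
    proof -
      have "cmod x < R0 + 1" using that D(3) R0(2)[of x] by auto
      then have "\<forall>\<^sub>F w in nhds x. cmod w < R0 + 1"
        by (intro order_tendstoD(2)[of _ "cmod x"] tendsto_intros filterlim_ident)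
      then have "\<forall>\<^sub>F w in at x within D. w \<in> D \<and> cmod w < R0 + 1"
        unfolding eventually_at_filter by (auto elim: eventually_mono)
      then show ?thesis
      proof eventually_elim
        case (elim w)
        then have "s w \<le> ln (cmod w + R0)" using s(2) by blast
        also have "\<dots> \<le> L" unfolding L_def using elim R0(1) by (intro ln_mono) (auto intro: add_nonneg_pos)
        finally show ?case using elim by blast
      qed
    qed
    \<comment> \<open>The growth of \<open>s\<close> cancels half of the growth of
      \<open>\<epsilon>\<close> times the potential. \<open>M\<close> is the level of
      \<open>ln (|z| - R0)\<close> from which the remaining half outweighs
      \<open>C'\<close>.\<close>
    define M where "M = (2 / \<epsilon>) * (C' + \<epsilon> * V) + ln 2 - L"
    define R1 where "R1 = max (3 * R0) (max R (R0 + exp M))"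
    have "u z1 \<le> ereal (H z1 + G z1)"
    proof (rule maximum_principle_unbounded[OF D(1) Gh fin usc sub _ _ z1, where R = R1])
      fix x and \<delta> :: real assume x: "x \<in> frontier D" and \<delta>: "0 < \<delta>"
      show "\<forall>\<^sub>F w in at x within D. u w \<le> ereal (H w + G w + \<delta>)"
      proof (cases "x \<in> P")
        case False
        from bdry[OF x False \<delta>] loc[OF x] show ?thesis
        proof eventually_elim
          case (elim w)
          have "0 \<le> G w" using G_ge[of w] elim(2) \<epsilon> by (meson diff_ge_0_iff_ge mult_nonneg_nonneg half_gt_zero less_imp_le order_trans)
          then have "ereal (H w + \<delta>) \<le> ereal (H w + G w + \<delta>)" by simp
          then show ?case using elim(1) by (rule order_trans[rotated])
        qed
      next
        case True
        from near[OF x True] s(4)[OF True] show ?thesis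
        proof eventually_elim
          case (elim w)
          have "2 * \<bar>C\<bar> / \<epsilon> \<le> L - s w" using elim(2) by (simp add: B_def)
          then have "(\<epsilon> / 2) * (2 * \<bar>C\<bar> / \<epsilon>) \<le> (\<epsilon> / 2) * (L - s w)" using \<epsilon> by (intro mult_left_mono) auto
          then have "C \<le> G w" using G_ge[of w] \<epsilon> by simp
          then have "ereal (H w + C) \<le> ereal (H w + G w + \<delta>)" using \<delta> by simp
          then show ?case using elim(1) by (rule order_trans[rotated])
        qed
      qed
    next
      fix z assume z: "z \<in> D" "R1 \<le> cmod z"
      have zR: "3 * R0 \<le> cmod z" "R \<le> cmod z" "R0 + exp M \<le> cmod z" using z(2) by (auto simp: R1_def)
      have p: "ln (cmod z - R0) \<le> log_pot \<mu> z" using zR R0 by (intro log_pot_growth(1)[OF bp R0(2)]) auto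
      have "M = ln (exp M)" by simp
      also have "\<dots> \<le> ln (cmod z - R0)" using zR by (intro ln_mono) auto
      finally have M: "M \<le> ln (cmod z - R0)" .
      have "s z \<le> ln (cmod z + R0)" using s(2) z(1) by blast
      also have "\<dots> \<le> ln (2 * (cmod z - R0))" using zR R0 by (intro ln_mono) auto
      also have "\<dots> = ln 2 + ln (cmod z - R0)" using zR R0 by (intro ln_mult_pos) auto
      finally have sz: "s z \<le> ln 2 + ln (cmod z - R0)" .
      define l where "l = ln (cmod z - R0)"
      have "C' = \<epsilon> * (M - V) + (\<epsilon> / 2) * (L - (ln 2 + M))" using \<epsilon> by (simp add: M_def field_simps)
      also have "\<dots> = (\<epsilon> / 2) * M - \<epsilon> * V + (\<epsilon> / 2) * (L - ln 2)" by (simp add: field_simps)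
      also have "\<dots> \<le> (\<epsilon> / 2) * l - \<epsilon> * V + (\<epsilon> / 2) * (L - ln 2)" using M \<epsilon> by (simp add: l_def)
      also have "\<dots> = \<epsilon> * (l - V) + (\<epsilon> / 2) * (L - (ln 2 + l))" by (simp add: field_simps)
      also have "\<dots> \<le> G z" unfolding G_def using p sz \<epsilon> by (intro add_mono mult_left_mono) (auto simp: l_def)
      finally have "ereal (H z + C') \<le> ereal (H z + G z)" by simp
      then show "u z \<le> ereal (H z + G z)" using inf[OF z(1) zR(2)] by (rule order_trans[rotated])
    qed
    also have "G z1 \<le> \<epsilon> * Q"
    proof -
      have "G z1 \<le> \<epsilon> * (log_pot \<mu> z1 - V) + (\<epsilon> / 2) * (L - ln d)" unfolding G_def using s(3) \<epsilon> by simp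
      then show ?thesis by (simp add: Q_def field_simps)
    qed
    finally show ?thesis by (simp add: mono_def)
  qed
  have "Q \<ge> 0"
  proof -
    have "ln d \<le> 0" using d by simp
    moreover have "0 \<le> L" unfolding L_def using R0 by (intro ln_ge_zero) auto
    ultimately show ?thesis using log_pot_ge[of z1] by (simp add: Q_def)
  qed
  show ?thesis
  proof (rule ereal_le_epsilon2)
    fix \<delta> :: real assume \<delta>: "0 < \<delta>"
    have "u z1 \<le> ereal (H z1 + (\<delta> / (Q + 1)) * Q)" using \<delta> \<open>Q \<ge> 0\<close> by (intro main) auto
    also have "\<dots> \<le> ereal (H z1 + \<delta>)"
    proof -
      have "\<delta> * (Q / (Q + 1)) \<le> \<delta> * 1" using \<delta> \<open>Q \<ge> 0\<close> by (intro mult_left_mono) auto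
      then show ?thesis by simp
    qed
    finally show "u z1 \<le> ereal (H z1) + ereal \<delta>" by simp
  qed
qed

end

section \<open>Uniqueness of the equilibrium measure\<close>

lemma submean_at_harmonic:
  assumes "mean_harmonic D H" "z \<in> D"
  shows "submean_at (\<lambda>w. ereal (H w)) z"
proof -
  obtain \<rho> where \<rho>: "\<rho> > 0" "ball z \<rho> \<subseteq> D" "\<forall>r. 0 < r \<and> r < \<rho> \<longrightarrow> circle_avg H z r = H z"
    using assms unfolding mean_harmonic_def by blast
  have Hc: "continuous_on D H" using assms by (simp add: mean_harmonic_def)
  have "ereal (H z) \<le> ereal (circle_avg k z r)"
    if "0 < r" "r < \<rho>" "continuous_on (sphere z r) k" "\<forall>w\<in>sphere z r. ereal (H w) \<le> ereal (k w)" for r k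
  proof -
    have "sphere z r \<subseteq> D" using sphere_subset_ball[OF that(2), of z] \<rho>(2) by blast
    then have "circle_avg H z r \<le> circle_avg k z r"
      using that by (intro circle_avg_mono continuous_on_subset[OF Hc]) auto
    then show ?thesis using \<rho>(3) that by simp
  qed
  then show ?thesis unfolding submean_at_def using \<rho>(1) by blast
qed

lemma usc_continuous:
  fixes H :: "complex \<Rightarrow> real"
  assumes "continuous_on D H" "z \<in> D" "ereal (H z) < a"
  shows "\<forall>\<^sub>F w in at z within D. ereal (H w) < a"
proof -
  have "((\<lambda>w. ereal (H w)) \<longlongrightarrow> ereal (H z)) (at z within D)"
    using assms by (intro tendsto_intros) (simp add: continuous_on_def)
  then show ?thesis using assms(3) by (rule order_tendstoD(2))
qed

context equilibrium
begin

text \<open>Upper semicontinuity makes the set compact. A measure of finite energy on it would have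
  mean potential at least \<open>V + \<eta>\<close>, against
  \<open>integral_log_pot_le\<close>.\<close>

lemma polar_superlevel:
  assumes "0 < \<eta>"
  defines "P \<equiv> {x\<in>E. V + \<eta> \<le> log_pot \<mu> x}"
  shows "compact P" and "\<sigma> \<in> borel_probabilities_on P \<Longrightarrow> \<exists>e>0. trunc_energy \<sigma> \<sigma> e < A"
proof -
  have "open {x. log_pot \<mu> x < V + \<eta>}"
  proof (subst open_subopen, rule ballI)
    fix x assume "x \<in> {x. log_pot \<mu> x < V + \<eta>}"
    then have "\<forall>\<^sub>F w in nhds x. log_pot \<mu> w < V + \<eta>" by (intro log_pot_usc) simp
    then show "\<exists>T. open T \<and> x \<in> T \<and> T \<subseteq> {x. log_pot \<mu> x < V + \<eta>}"
      unfolding eventually_nhds by blast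
  qed
  then have "closed (- {x. log_pot \<mu> x < V + \<eta>})" by (rule closed_Compl)
  moreover have "P = E \<inter> - {x. log_pot \<mu> x < V + \<eta>}" by (auto simp: P_def)
  ultimately show cP: "compact P" using compact by (simp add: compact_Int_closed)
  assume \<sigma>: "\<sigma> \<in> borel_probabilities_on P"
  show "\<exists>e>0. trunc_energy \<sigma> \<sigma> e < A"
  proof (rule ccontr)
    assume "\<not> ?thesis"
    then have A: "\<And>e. 0 < e \<Longrightarrow> A \<le> trunc_energy \<sigma> \<sigma> e" by force
    have \<sigma>E: "\<sigma> \<in> borel_probabilities_on E"
      by (rule bp_mono[OF \<sigma>]) (use bpD(5)[OF bp] in \<open>auto simp: P_def\<close>)
    have "V + \<eta> \<le> (\<integral>z. log_pot \<mu> z \<partial>\<sigma>)"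
      by (rule bp_integral_ge_const[OF \<sigma> integrable_log_pot[OF \<sigma>E bd]]) (auto simp: P_def)
    also have "\<dots> \<le> V" by (rule integral_log_pot_le[OF \<sigma>E A])
    finally show False using assms by simp
  qed
qed

lemma frontier_compl: "frontier (- E) \<subseteq> E"
  using compact_imp_closed[OF compact] frontier_subset_closed by auto

lemma radius:
  obtains R where "1 \<le> R" "\<And>t. t \<in> E \<Longrightarrow> cmod t \<le> R"
proof -
  obtain b where "\<And>t. t \<in> E \<Longrightarrow> cmod t \<le> b" using bd bounded_iff by metis
  then show ?thesis by (intro that[of "max 1 b"]) (auto simp: le_max_iff_disj)
qed

lemma log_pot_le_near:
  assumes "\<And>t. t \<in> E \<Longrightarrow> cmod t \<le> R" "1 \<le> R" "cmod w \<le> R + 1"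
  shows "log_pot \<mu> w \<le> ln (2 * R + 1)"
proof -
  have "log_pot \<mu> w \<le> trunc_pot \<mu> 1 w" by (rule log_pot_le_trunc_pot) simp
  also have "\<dots> \<le> ln (max 1 (2 * R + 1))"
    unfolding trunc_pot_def
  proof (rule bp_integral_le_const[OF bp integrable_trunc_log(2)[OF bp bd]])
    fix t assume "t \<in> E"
    then have "cmod (w - t) \<le> 2 * R + 1" using assms norm_triangle_ineq4[of w t] by force
    then show "trunc_log 1 w t \<le> ln (max 1 (2 * R + 1))" by (intro trunc_log_le) auto
  qed simp
  also have "max 1 (2 * R + 1) = 2 * R + 1" using assms by simp
  finally show ?thesis .
qed

end

text \<open>At frontier points off the exceptional set of \<open>\<nu>\<close> its potential is
  below \<open>V + \<eta>\<close>, while that of \<open>\<mu>\<close> is at least \<open>V\<close>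
  everywhere. All components of the complement are treated at once.\<close>

lemma equilibrium_log_pot_le:
  assumes "equilibrium E V \<mu>" "equilibrium E V \<nu>" and z: "z \<notin> E"
  shows "log_pot \<nu> z \<le> log_pot \<mu> z"
proof (rule field_le_epsilon)
  fix \<eta> :: real assume \<eta>: "0 < \<eta>"
  interpret M: equilibrium E V \<mu> by fact
  interpret N: equilibrium E V \<nu> by fact
  obtain R where R: "1 \<le> R" "\<And>t. t \<in> E \<Longrightarrow> cmod t \<le> R" using M.radius by blast
  define P where "P = {x\<in>E. V + \<eta> \<le> log_pot \<nu> x}"
  have oE: "open (- E)" using compact_imp_closed[OF M.compact] by (rule open_Compl)
  have "ereal (log_pot \<nu> z) \<le> ereal (log_pot \<mu> z + \<eta>)"
  proof (rule M.generalised_maximum_principle[where D = "- E" and P = P and u = "\<lambda>z. ereal (log_pot \<nu> z)"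
        and C = "ln (2 * R + 1) - V" and R = "3 * R" and C' = "ln 2"])
    show "mean_harmonic (- E) (\<lambda>z. log_pot \<mu> z + \<eta>)"
      by (intro mean_harmonic_add M.mean_harmonic_log_pot' mean_harmonic_const oE)
    show "frontier (- E) \<subseteq> E" by (rule M.frontier_compl)
    show "compact P" "P \<subseteq> E" using N.polar_superlevel(1)[OF \<eta>] by (auto simp: P_def)
    show "\<exists>e>0. trunc_energy \<sigma> \<sigma> e < A" if "\<sigma> \<in> borel_probabilities_on P" for \<sigma> A
      using N.polar_superlevel(2)[OF \<eta>] that by (simp add: P_def)
    show "submean_at (\<lambda>z. ereal (log_pot \<nu> z)) w" if "w \<in> - E" for w
      using submean_at_harmonic[OF N.mean_harmonic_log_pot' that] .
    show "\<forall>\<^sub>F w in at x within - E. ereal (log_pot \<nu> w) < a" if "x \<in> - E" "ereal (log_pot \<nu> x) < a" for x a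
      using N.mean_harmonic_log_pot' that by (intro usc_continuous) (auto simp: mean_harmonic_def)
    show "\<forall>\<^sub>F w in at x within - E. ereal (log_pot \<nu> w) \<le> ereal (log_pot \<mu> w + \<eta> + \<epsilon>)"
      if "x \<in> frontier (- E)" "x \<notin> P" "0 < \<epsilon>" for x \<epsilon>
    proof -
      have "log_pot \<nu> x < V + \<eta>" using that M.frontier_compl by (auto simp: P_def)
      from N.log_pot_usc[OF this] have "\<forall>\<^sub>F w in at x within - E. log_pot \<nu> w < V + \<eta>"
        unfolding eventually_at_filter by (auto elim: eventually_mono)
      then show ?thesis
      proof eventually_elim
        case (elim w)
        then show ?case using M.log_pot_ge[of w] that(3) by simp
      qed
    qed
    show "\<forall>\<^sub>F w in at x within - E. ereal (log_pot \<nu> w) \<le> ereal (log_pot \<mu> w + \<eta> + (ln (2 * R + 1) - V))"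
      if "x \<in> frontier (- E)" for x
    proof -
      have "cmod x < R + 1" using that M.frontier_compl R(2)[of x] by auto
      then have "\<forall>\<^sub>F w in nhds x. cmod w < R + 1"
        by (intro order_tendstoD(2)[of _ "cmod x"] tendsto_intros filterlim_ident)
      then have "\<forall>\<^sub>F w in at x within - E. cmod w < R + 1"
        unfolding eventually_at_filter by (auto elim: eventually_mono)
      then show ?thesis
      proof eventually_elim
        case (elim w)
        then have "log_pot \<nu> w \<le> ln (2 * R + 1)" using R by (intro N.log_pot_le_near) auto
        then show ?case using M.log_pot_ge[of w] \<eta> by simp
      qed
    qed
    \<comment> \<open>From radius \<open>3 * R\<close> on,
      \<open>|w| + R \<le> 2 * (|w| - R)\<close>, so the upper and lower growth bounds differ by at
      most \<open>ln 2\<close>.\<close>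
    show "ereal (log_pot \<nu> w) \<le> ereal (log_pot \<mu> w + \<eta> + ln 2)" if "3 * R \<le> cmod w" for w
    proof -
      have "log_pot \<nu> w \<le> ln (cmod w + R)" using R that by (intro log_pot_growth(2)[OF N.bp R(2)]) auto
      also have "\<dots> \<le> ln (2 * (cmod w - R))" using R that by (intro ln_mono) auto
      also have "\<dots> = ln 2 + ln (cmod w - R)" using R that by (intro ln_mult_pos) auto
      also have "ln (cmod w - R) \<le> log_pot \<mu> w" using R that by (intro log_pot_growth(1)[OF M.bp R(2)]) auto
      finally show ?thesis using \<eta> by simp
    qed
  qed (use z oE in auto)
  then show "log_pot \<nu> z \<le> log_pot \<mu> z + \<eta>" by simp
qed

section \<open>Recovering a measure from its truncated potentials\<close>

lemma nn_integral_lborel_shift: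
  fixes k :: "complex \<Rightarrow> ennreal"
  assumes "k \<in> borel_measurable borel"
  shows "(\<integral>\<^sup>+a. k (a - t) \<partial>lborel) = (\<integral>\<^sup>+a. k a \<partial>lborel)"
proof -
  have "(\<integral>\<^sup>+a. k (a - t) \<partial>lborel) = (\<integral>\<^sup>+a. k (a - t) \<partial>distr lborel borel ((+) t))"
    by (simp add: lborel_distr_plus)
  also have "\<dots> = (\<integral>\<^sup>+a. k a \<partial>lborel)" using assms by (subst nn_integral_distr) auto
  finally show ?thesis .
qed

text \<open>
  The differences \<open>trunc_log (2 r) a - trunc_log r a\<close> are tents around \<open>a\<close>; averaging \<open>f\<close> against them
  over all \<open>a\<close> approximates \<open>f\<close> uniformly as \<open>r\<close> tends to 0.
\<close>

lemma trunc_pot_eq_imp_integral_le: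
  fixes f :: "complex \<Rightarrow> real"
  assumes \<mu>: "\<mu> \<in> borel_probabilities_on S" and \<nu>: "\<nu> \<in> borel_probabilities_on S" and S: "bounded S"
    and eq: "\<And>a r. 0 < r \<Longrightarrow> trunc_pot \<mu> r a = trunc_pot \<nu> r a"
    and f: "\<And>x. 0 \<le> f x" "\<And>x y. \<bar>f x - f y\<bar> \<le> L * dist x y" "0 \<le> L"
  shows "(\<integral>\<^sup>+x. ennreal (f x) \<partial>\<mu>) \<le> (\<integral>\<^sup>+x. ennreal (f x) \<partial>\<nu>)"
proof (rule ennreal_le_epsilon)
  fix \<epsilon> :: real assume \<epsilon>: "0 < \<epsilon>"
  \<comment> \<open>The tents vanish beyond distance \<open>2 * r\<close>, so averaging changes
    \<open>f\<close> by at most \<open>2 * L * r\<close>; this error occurs once for each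
    measure.\<close>
  define r where "r = \<epsilon> / (4 * L + 1)"
  have r: "r > 0" "4 * L * r \<le> \<epsilon>"
  proof -
    show "r > 0" using \<epsilon> f(3) by (simp add: r_def)
    have "\<epsilon> * (4 * L / (4 * L + 1)) \<le> \<epsilon> * 1" using \<epsilon> f(3) by (intro mult_left_mono) auto
    then show "4 * L * r \<le> \<epsilon>" by (simp add: r_def mult_ac)
  qed
  have "L-lipschitz_on UNIV f" using f by (intro lipschitz_onI) (auto simp: dist_real_def)
  then have fm: "f \<in> borel_measurable borel"
    using lipschitz_on_continuous_on by (blast intro: borel_measurable_continuous_onI)
  define \<tau> where "\<tau> a t = trunc_log (2 * r) a t - trunc_log r a t" for a t
  define k where "k z = ennreal (ln (max (2 * r) (cmod z)) - ln (max r (cmod z)))" for z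
  have km: "k \<in> borel_measurable borel" unfolding k_def by measurable
  have \<tau>k: "ennreal (\<tau> a t) = k (a - t)" for a t by (simp add: \<tau>_def k_def trunc_log_def)
  have \<tau>0: "0 \<le> \<tau> a t" for a t using r by (simp add: \<tau>_def trunc_log_mono)
  have \<tau>far: "\<tau> a t = 0" if "2 * r \<le> dist a t" for a t using that r by (simp add: \<tau>_def trunc_log_def dist_norm max_def)
  define c where "c = (\<integral>\<^sup>+z. k z \<partial>lborel)"
  have c_fin: "c < \<infinity>"
  proof -
    have "k z \<le> ennreal (ln 2) * indicator (ball 0 (2 * r)) z" for z
    proof (cases "cmod z < 2 * r")
      case True
      have "ln (2 * r) = ln 2 + ln r" using r by (intro ln_mult_pos) auto
      moreover have "ln (max (2 * r) (cmod z)) = ln (2 * r)" using True by (simp add: max_def)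
      moreover have "ln r \<le> ln (max r (cmod z))" using r by (intro ln_mono) auto
      ultimately show ?thesis using True by (auto simp: k_def intro!: ennreal_leI)
    next
      case False
      then show ?thesis using r by (simp add: k_def max_def)
    qed
    then have "c \<le> (\<integral>\<^sup>+z. ennreal (ln 2) * indicator (ball 0 (2 * r)) (z::complex) \<partial>lborel)"
      unfolding c_def by (intro nn_integral_mono) auto
    also have "\<dots> = ennreal (ln 2) * emeasure lborel (ball (0::complex) (2 * r))" by (subst nn_integral_cmult_indicator) auto
    also have "\<dots> < \<infinity>" using emeasure_lborel_ball_finite[of "0::complex" "2 * r"] by (simp add: ennreal_mult_less_top)
    finally show ?thesis .
  qed
  have c_pos: "c \<noteq> 0"
  proof -
    have "ennreal (ln 2) * indicator (ball 0 r) z \<le> k z" for z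
    proof (cases "cmod z < r")
      case True
      have "ln (2 * r) = ln 2 + ln r" using r by (intro ln_mult_pos) auto
      then show ?thesis using True r by (simp add: k_def max_def)
    qed simp
    then have "(\<integral>\<^sup>+z. ennreal (ln 2) * indicator (ball 0 r) (z::complex) \<partial>lborel) \<le> c"
      unfolding c_def by (intro nn_integral_mono) auto
    moreover have "(\<integral>\<^sup>+z. ennreal (ln 2) * indicator (ball 0 r) (z::complex) \<partial>lborel)
        = ennreal (ln 2) * emeasure lborel (ball (0::complex) r)" by (subst nn_integral_cmult_indicator) auto
    moreover have "emeasure lborel (ball (0::complex) r) \<noteq> 0"
      using content_ball_pos[OF r(1), of "0::complex"] by (auto simp: measure_def)
    ultimately show ?thesis by (auto simp: ennreal_eq_0_iff)
  qed
  define F where "F t = (\<integral>\<^sup>+a. ennreal (f a) * ennreal (\<tau> a t) \<partial>lborel)" for t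
  have cint: "(\<integral>\<^sup>+a. ennreal (\<tau> a t) \<partial>lborel) = c" for t
    unfolding \<tau>k c_def by (rule nn_integral_lborel_shift[OF km])
  have \<tau>m: "(\<lambda>a. ennreal (\<tau> a t)) \<in> borel_measurable borel" for t
    unfolding \<tau>k using km by measurable
  have \<tau>m2: "(\<lambda>x. ennreal (\<tau> (fst x) (snd x))) \<in> borel_measurable (borel \<Otimes>\<^sub>M borel)"
    unfolding \<tau>_def trunc_log_def by measurable
  have loc: "f a * \<tau> a t \<le> (f t + 2 * L * r) * \<tau> a t" "f t * \<tau> a t \<le> (f a + 2 * L * r) * \<tau> a t" for a t
  proof -
    have "f a * \<tau> a t \<le> (f t + 2 * L * r) * \<tau> a t \<and> f t * \<tau> a t \<le> (f a + 2 * L * r) * \<tau> a t"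
    proof (cases "2 * r \<le> dist a t")
      case True then show ?thesis using \<tau>far by simp
    next
      case False
      then have "L * dist a t \<le> L * (2 * r)" using f(3) by (intro mult_left_mono) auto
      then have "f a \<le> f t + 2 * L * r" "f t \<le> f a + 2 * L * r" using f(2)[of a t] by (auto simp: abs_le_iff)
      then show ?thesis using \<tau>0 by (auto intro!: mult_right_mono)
    qed
    then show "f a * \<tau> a t \<le> (f t + 2 * L * r) * \<tau> a t" "f t * \<tau> a t \<le> (f a + 2 * L * r) * \<tau> a t" by auto
  qed
  have F1: "F t \<le> ennreal (f t + 2 * L * r) * c" for t
  proof -
    have "F t \<le> (\<integral>\<^sup>+a. ennreal (f t + 2 * L * r) * ennreal (\<tau> a t) \<partial>lborel)"
      unfolding F_def
    proof (rule nn_integral_mono)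
      fix a
      have "ennreal (f a) * ennreal (\<tau> a t) = ennreal (f a * \<tau> a t)" using f \<tau>0 by (simp add: ennreal_mult)
      also have "\<dots> \<le> ennreal ((f t + 2 * L * r) * \<tau> a t)" using loc(1) by (rule ennreal_leI)
      also have "\<dots> = ennreal (f t + 2 * L * r) * ennreal (\<tau> a t)" using f \<tau>0 r by (intro ennreal_mult) auto
      finally show "ennreal (f a) * ennreal (\<tau> a t) \<le> ennreal (f t + 2 * L * r) * ennreal (\<tau> a t)" .
    qed
    also have "\<dots> = ennreal (f t + 2 * L * r) * c" using \<tau>m by (subst nn_integral_cmult) (auto simp: cint)
    finally show ?thesis .
  qed
  have F2: "ennreal (f t) * c \<le> F t + ennreal (2 * L * r) * c" for t
  proof -
    have "ennreal (f t) * c = (\<integral>\<^sup>+a. ennreal (f t) * ennreal (\<tau> a t) \<partial>lborel)"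
      using \<tau>m by (subst nn_integral_cmult) (auto simp: cint)
    also have "\<dots> \<le> (\<integral>\<^sup>+a. ennreal (f a) * ennreal (\<tau> a t) + ennreal (2 * L * r) * ennreal (\<tau> a t) \<partial>lborel)"
    proof (rule nn_integral_mono)
      fix a
      have "ennreal (f t) * ennreal (\<tau> a t) \<le> ennreal ((f a + 2 * L * r) * \<tau> a t)"
        using loc(2) f \<tau>0 by (auto simp flip: ennreal_mult intro!: ennreal_leI)
      also have "\<dots> = ennreal (f a) * ennreal (\<tau> a t) + ennreal (2 * L * r) * ennreal (\<tau> a t)"
        using f \<tau>0 r by (simp add: ennreal_mult ennreal_plus distrib_right)
      finally show "ennreal (f t) * ennreal (\<tau> a t) \<le> ennreal (f a) * ennreal (\<tau> a t) + ennreal (2 * L * r) * ennreal (\<tau> a t)" .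
    qed
    also have "\<dots> = F t + ennreal (2 * L * r) * c"
      unfolding F_def using \<tau>m fm by (subst nn_integral_add) (auto simp: nn_integral_cmult cint)
    finally show ?thesis .
  qed
  \<comment> \<open>By Fubini the averaged function sees a measure only through its truncated
    potentials.\<close>
  have FI: "(\<integral>\<^sup>+t. F t \<partial>\<rho>) = (\<integral>\<^sup>+a. ennreal (f a) * ennreal (trunc_pot \<rho> (2 * r) a - trunc_pot \<rho> r a) \<partial>lborel)"
    and Fm: "F \<in> borel_measurable \<rho>"
    if \<rho>: "\<rho> \<in> borel_probabilities_on S" for \<rho>
  proof -
    interpret R: prob_space \<rho> using bpD(1)[OF \<rho>] .
    interpret P: pair_sigma_finite lborel \<rho> ..
    have s: "sets (lborel \<Otimes>\<^sub>M \<rho>) = sets (borel \<Otimes>\<^sub>M borel)"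
      using bpD(2)[OF \<rho>] by (intro sets_pair_measure_cong) auto
    have "(\<lambda>x. ennreal (f (fst x)) * ennreal (\<tau> (fst x) (snd x))) \<in> borel_measurable (borel \<Otimes>\<^sub>M borel)"
      using \<tau>m2 fm by measurable
    then have m: "(\<lambda>x. ennreal (f (fst x)) * ennreal (\<tau> (fst x) (snd x))) \<in> borel_measurable (lborel \<Otimes>\<^sub>M \<rho>)"
      using measurable_cong_sets[OF s refl] by blast
    have "(\<integral>\<^sup>+t. F t \<partial>\<rho>) = (\<integral>\<^sup>+a. \<integral>\<^sup>+t. ennreal (f a) * ennreal (\<tau> a t) \<partial>\<rho> \<partial>lborel)"
      unfolding F_def using m by (intro P.Fubini') (simp add: case_prod_beta')
    also have "\<dots> = (\<integral>\<^sup>+a. ennreal (f a) * ennreal (trunc_pot \<rho> (2 * r) a - trunc_pot \<rho> r a) \<partial>lborel)"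
    proof (intro nn_integral_cong)
      fix a
      have i: "integrable \<rho> (trunc_log (2 * r) a)" "integrable \<rho> (trunc_log r a)"
        using r by (auto intro!: integrable_trunc_log[OF \<rho> S])
      then have it: "integrable \<rho> (\<lambda>t. \<tau> a t)" unfolding \<tau>_def by auto
      have "(\<integral>\<^sup>+t. ennreal (f a) * ennreal (\<tau> a t) \<partial>\<rho>) = ennreal (f a) * (\<integral>\<^sup>+t. ennreal (\<tau> a t) \<partial>\<rho>)"
        using it by (intro nn_integral_cmult) (auto dest: borel_measurable_integrable)
      also have "(\<integral>\<^sup>+t. ennreal (\<tau> a t) \<partial>\<rho>) = ennreal (\<integral>t. \<tau> a t \<partial>\<rho>)"
        using it \<tau>0 by (intro nn_integral_eq_integral) auto
      also have "(\<integral>t. \<tau> a t \<partial>\<rho>) = trunc_pot \<rho> (2 * r) a - trunc_pot \<rho> r a"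
        unfolding \<tau>_def trunc_pot_def using i by (intro Bochner_Integration.integral_diff)
      finally show "(\<integral>\<^sup>+t. ennreal (f a) * ennreal (\<tau> a t) \<partial>\<rho>) = ennreal (f a) * ennreal (trunc_pot \<rho> (2 * r) a - trunc_pot \<rho> r a)" .
    qed
    finally show "(\<integral>\<^sup>+t. F t \<partial>\<rho>) = (\<integral>\<^sup>+a. ennreal (f a) * ennreal (trunc_pot \<rho> (2 * r) a - trunc_pot \<rho> r a) \<partial>lborel)" .
    interpret Q: pair_sigma_finite \<rho> lborel ..
    have s': "sets (\<rho> \<Otimes>\<^sub>M lborel) = sets (borel \<Otimes>\<^sub>M borel)"
      using bpD(2)[OF \<rho>] by (intro sets_pair_measure_cong) auto
    have "(\<lambda>x. ennreal (f (snd x)) * ennreal (\<tau> (snd x) (fst x))) \<in> borel_measurable (borel \<Otimes>\<^sub>M borel)"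
      unfolding \<tau>_def trunc_log_def using fm by measurable
    then have "(\<lambda>x. ennreal (f (snd x)) * ennreal (\<tau> (snd x) (fst x))) \<in> borel_measurable (\<rho> \<Otimes>\<^sub>M lborel)"
      using measurable_cong_sets[OF s' refl] by blast
    then show "F \<in> borel_measurable \<rho>"
      unfolding F_def[abs_def] by (intro lborel.borel_measurable_nn_integral) (simp add: case_prod_beta')
  qed
  have fmr: "(\<lambda>x. ennreal (f x)) \<in> borel_measurable \<rho>" if \<rho>: "\<rho> \<in> borel_probabilities_on S" for \<rho>
    using bp_measurable[OF \<rho> measurable_compose[OF fm measurable_ennreal]] .
  have one: "(\<integral>\<^sup>+x. C \<partial>\<rho>) = C" if \<rho>: "\<rho> \<in> borel_probabilities_on S" for \<rho> C
    using prob_space.emeasure_space_1[OF bpD(1)[OF \<rho>]] by simp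
  have "c * (\<integral>\<^sup>+x. ennreal (f x) \<partial>\<mu>) = (\<integral>\<^sup>+x. ennreal (f x) * c \<partial>\<mu>)"
    using fmr[OF \<mu>] by (subst nn_integral_multc) (auto simp: mult.commute)
  also have "\<dots> \<le> (\<integral>\<^sup>+x. F x + ennreal (2 * L * r) * c \<partial>\<mu>)" by (intro nn_integral_mono F2)
  also have "\<dots> = (\<integral>\<^sup>+x. F x \<partial>\<mu>) + ennreal (2 * L * r) * c"
    using Fm[OF \<mu>] one[OF \<mu>] by (subst nn_integral_add) auto
  also have "(\<integral>\<^sup>+x. F x \<partial>\<mu>) = (\<integral>\<^sup>+x. F x \<partial>\<nu>)"
    unfolding FI[OF \<mu>] FI[OF \<nu>] using eq r by simp
  also have "(\<integral>\<^sup>+x. F x \<partial>\<nu>) \<le> (\<integral>\<^sup>+x. ennreal (f x + 2 * L * r) * c \<partial>\<nu>)" by (intro nn_integral_mono F1)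
  also have "\<dots> = (\<integral>\<^sup>+x. ennreal (f x) * c + ennreal (2 * L * r) * c \<partial>\<nu>)"
    using f r by (intro nn_integral_cong) (simp add: ennreal_plus distrib_right)
  also have "\<dots> = (\<integral>\<^sup>+x. ennreal (f x) * c \<partial>\<nu>) + (\<integral>\<^sup>+x. ennreal (2 * L * r) * c \<partial>\<nu>)"
    using fmr[OF \<nu>] by (intro nn_integral_add) auto
  also have "(\<integral>\<^sup>+x. ennreal (2 * L * r) * c \<partial>\<nu>) = ennreal (2 * L * r) * c" by (rule one[OF \<nu>])
  also have "(\<integral>\<^sup>+x. ennreal (f x) * c \<partial>\<nu>) = c * (\<integral>\<^sup>+x. ennreal (f x) \<partial>\<nu>)"
    using fmr[OF \<nu>] by (subst nn_integral_multc) (auto simp: mult.commute)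
  finally have "c * (\<integral>\<^sup>+x. ennreal (f x) \<partial>\<mu>) \<le> c * ((\<integral>\<^sup>+x. ennreal (f x) \<partial>\<nu>) + (ennreal (2 * L * r) + ennreal (2 * L * r)))"
    by (simp add: distrib_left mult.commute add.assoc)
  then have "(\<integral>\<^sup>+x. ennreal (f x) \<partial>\<mu>) \<le> (\<integral>\<^sup>+x. ennreal (f x) \<partial>\<nu>) + (ennreal (2 * L * r) + ennreal (2 * L * r))"
    using c_fin c_pos by (subst (asm) ennreal_mult_le_mult_iff) auto
  also have "ennreal (2 * L * r) + ennreal (2 * L * r) = ennreal (4 * L * r)"
    using f r by (simp flip: ennreal_plus)
  also have "(\<integral>\<^sup>+x. ennreal (f x) \<partial>\<nu>) + ennreal (4 * L * r) \<le> (\<integral>\<^sup>+x. ennreal (f x) \<partial>\<nu>) + ennreal \<epsilon>"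
    using r by (intro add_left_mono ennreal_leI) auto
  finally show "(\<integral>\<^sup>+x. ennreal (f x) \<partial>\<mu>) \<le> (\<integral>\<^sup>+x. ennreal (f x) \<partial>\<nu>) + ennreal \<epsilon>" .
qed

text \<open>Closed sets form a generating system stable under intersection, and the indicator of a
  nonempty closed set is the decreasing limit of the Lipschitz functions \<open>g n\<close>.\<close>

lemma trunc_pot_determines_measure:
  assumes \<mu>: "\<mu> \<in> borel_probabilities_on S" and \<nu>: "\<nu> \<in> borel_probabilities_on S" and S: "bounded S"
    and eq: "\<And>a r. 0 < r \<Longrightarrow> trunc_pot \<mu> r a = trunc_pot \<nu> r a"
  shows "\<mu> = \<nu>"
proof (rule measure_eqI_generator_eq[where E = "Collect closed" and \<Omega> = UNIV and A = "\<lambda>_. UNIV"])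
  show "Int_stable (Collect closed :: complex set set)" by (auto simp: Int_stable_def)
  show "sets \<mu> = sigma_sets UNIV (Collect closed)" "sets \<nu> = sigma_sets UNIV (Collect closed)"
    using bpD(2)[OF \<mu>] bpD(2)[OF \<nu>] by (simp_all add: borel_eq_closed)
  show "emeasure \<mu> UNIV \<noteq> \<infinity>"
    using prob_space.emeasure_space_1[OF bpD(1)[OF \<mu>]] bpD(3)[OF \<mu>] by simp
  fix X :: "complex set" assume "X \<in> Collect closed"
  then have X: "closed X" by simp
  have Xm: "X \<in> sets borel" using X by simp
  show "emeasure \<mu> X = emeasure \<nu> X"
  proof (cases "X = {}")
    case False
    define g where "g n x = max 0 (1 - real n * infdist x X)" for n :: nat and x
    have g01: "0 \<le> g n x" "g n x \<le> 1" for n x using infdist_nonneg[of x X] by (auto simp: g_def)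
    have gL: "\<bar>g n x - g n y\<bar> \<le> real n * dist x y" for n x y
    proof -
      have "\<bar>infdist x X - infdist y X\<bar> \<le> dist x y" by (rule infdist_triangle_abs)
      then have "real n * \<bar>infdist x X - infdist y X\<bar> \<le> real n * dist x y" by (intro mult_left_mono) auto
      then have "\<bar>real n * infdist x X - real n * infdist y X\<bar> \<le> real n * dist x y" by (simp add: abs_mult flip: right_diff_distrib)
      then show ?thesis unfolding g_def by (auto simp: max_def abs_if split: if_splits)
    qed
    have same: "(\<integral>\<^sup>+x. ennreal (g n x) \<partial>\<mu>) = (\<integral>\<^sup>+x. ennreal (g n x) \<partial>\<nu>)" for n
      using trunc_pot_eq_imp_integral_le[OF \<mu> \<nu> S eq g01(1) gL] trunc_pot_eq_imp_integral_le[OF \<nu> \<mu> S eq[symmetric] g01(1) gL]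
      by (intro antisym) auto
    have gm: "g n \<in> borel_measurable borel" for n
      unfolding g_def by (intro borel_measurable_continuous_onI continuous_intros)
    have lim: "(\<lambda>n. \<integral>\<^sup>+x. ennreal (g n x) \<partial>\<rho>) \<longlonglongrightarrow> emeasure \<rho> X" if \<rho>: "\<rho> \<in> borel_probabilities_on S" for \<rho>
    proof -
      have "(\<lambda>n. \<integral>\<^sup>+x. ennreal (g n x) \<partial>\<rho>) \<longlonglongrightarrow> (\<integral>\<^sup>+x. indicator X x \<partial>\<rho>)"
      proof (rule nn_integral_dominated_convergence[where w = "\<lambda>_. 1"])
        show "(\<lambda>x. ennreal (g n x)) \<in> borel_measurable \<rho>" for n
          using bp_measurable[OF \<rho> measurable_compose[OF gm measurable_ennreal]] .
        show "indicator X \<in> borel_measurable \<rho>" using Xm bpD(2)[OF \<rho>] by simp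
        show "(\<integral>\<^sup>+x. 1 \<partial>\<rho>) < \<infinity>" using prob_space.emeasure_space_1[OF bpD(1)[OF \<rho>]] by simp
        show "AE x in \<rho>. ennreal (g n x) \<le> 1" for n using g01 by simp
        show "AE x in \<rho>. (\<lambda>n. ennreal (g n x)) \<longlonglongrightarrow> indicator X x"
        proof (rule AE_I2)
          fix x
          show "(\<lambda>n. ennreal (g n x)) \<longlonglongrightarrow> indicator X x"
          proof (cases "x \<in> X")
            case True
            then have "g n x = 1" for n by (simp add: g_def)
            then show ?thesis using True by simp
          next
            case xX: False
            then have d: "infdist x X > 0" using X False infdist_nonneg[of x X] in_closed_iff_infdist_zero[of X x] by (auto simp: less_le)
            obtain N :: nat where N: "1 < real N * infdist x X" using ex_less_of_nat_mult[OF d] by auto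
            have "g n x = 0" if "N \<le> n" for n
            proof -
              have "real N * infdist x X \<le> real n * infdist x X" using that d by (intro mult_right_mono) auto
              then show ?thesis using N by (simp add: g_def)
            qed
            then have "\<forall>\<^sub>F n in sequentially. ennreal (g n x) = indicator X x"
              using xX by (intro eventually_sequentiallyI[of N]) simp
            then show ?thesis by (rule tendsto_eventually)
          qed
        qed
      qed simp
      then show ?thesis using Xm bpD(2)[OF \<rho>] by simp
    qed
    show ?thesis using lim[OF \<mu>] lim[OF \<nu>] unfolding same by (rule LIMSEQ_unique)
  qed simp
qed auto

text \<open>Off \<open>E\<close> the potentials agree by comparison in both directions; on
  \<open>E\<close> both equal \<open>V\<close> almost everywhere on each circle. Hence all circle
  means agree, and these are the truncated potentials.\<close>

theorem equilibrium_unique: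
  assumes "equilibrium E V \<mu>" "equilibrium E V' \<nu>"
  shows "\<mu> = \<nu>" "V = V'"
proof -
  interpret M: equilibrium E V \<mu> by fact
  interpret N': equilibrium E V' \<nu> by fact
  show VV: "V = V'"
    using M.maximal[OF N'.bp N'.energy] N'.maximal[OF M.bp M.energy] by simp
  then have "equilibrium E V \<nu>" using assms(2) by simp
  then interpret N: equilibrium E V \<nu> .
  have "trunc_pot \<mu> r a = trunc_pot \<nu> r a" if r: "0 < r" for a r
  proof -
    have "AE z in circle_measure a r. log_pot \<mu> z = log_pot \<nu> z"
      using M.log_pot_circle_measure_AE[OF r, of a] N.log_pot_circle_measure_AE[OF r, of a]
    proof eventually_elim
      case (elim z)
      show ?case
      proof (cases "z \<in> E")
        case False
        then show ?thesis
          using equilibrium_log_pot_le[OF M.equilibrium_axioms N.equilibrium_axioms]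
            equilibrium_log_pot_le[OF N.equilibrium_axioms M.equilibrium_axioms] by (intro antisym) auto
      qed (use elim in simp)
    qed
    then have "(\<integral>z. log_pot \<mu> z \<partial>circle_measure a r) = (\<integral>z. log_pot \<nu> z \<partial>circle_measure a r)"
      using M.log_pot_measurable N.log_pot_measurable by (intro integral_cong_AE) (auto simp: circle_measure_def)
    then show ?thesis using M.integral_log_pot_circle_measure[OF r] N.integral_log_pot_circle_measure[OF r] by simp
  qed
  then show "\<mu> = \<nu>" by (rule trunc_pot_determines_measure[OF M.bp N.bp M.bd])
qed

section \<open>Norms of monic factors\<close>

lemma monic_factorization:
  assumes "monic p"
  obtains xs where "\<And>z. poly p z = (\<Prod>j<length xs. z - xs ! j)" "degree p = length xs"
proof -
  have "p \<noteq> 0" "lead_coeff p = 1" using assms by (auto simp: monic_def)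
  then obtain A where A: "size A = degree p" "p = (\<Prod>x\<in>#A. [:-x, 1:])"
    using alg_closed_imp_factorization[of p] by auto
  obtain xs where xs: "mset xs = A" using ex_mset by blast
  have "p = prod_list (map (\<lambda>x. [:-x, 1:]) xs)"
    unfolding A(2) xs[symmetric] by (simp add: prod_mset_prod_list flip: mset_map)
  moreover have "poly (prod_list (map (\<lambda>x. [:-x, 1:]) xs)) z = prod_list (map (\<lambda>x. z - x) xs)" for z
    by (induction xs) (auto simp: left_diff_distrib)
  ultimately have "poly p z = prod_list (map (\<lambda>x. z - x) xs)" for z by simp
  then have "poly p z = (\<Prod>j<length xs. z - xs ! j)" for z
    by (simp add: prod.list_conv_set_nth atLeast0LessThan)
  then show ?thesis using A(1) xs by (intro that[of xs]) auto
qed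

lemma submean_at_cong:
  assumes "\<forall>\<^sub>F w in nhds z. u w = v w" "submean_at v z"
  shows "submean_at u z"
proof -
  obtain d where d: "d > 0" "\<And>w. dist w z < d \<Longrightarrow> u w = v w"
    using assms(1) unfolding eventually_nhds_metric by blast
  obtain \<rho> where \<rho>: "\<rho> > 0" "\<And>r k. 0 < r \<Longrightarrow> r < \<rho> \<Longrightarrow> continuous_on (sphere z r) k \<Longrightarrow>
      (\<forall>w\<in>sphere z r. v w \<le> ereal (k w)) \<Longrightarrow> v z \<le> ereal (circle_avg k z r)"
    using assms(2) unfolding submean_at_def by blast
  have "u z \<le> ereal (circle_avg k z r)" if "0 < r" "r < min d \<rho>" "continuous_on (sphere z r) k"
    "\<forall>w\<in>sphere z r. u w \<le> ereal (k w)" for r k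
  proof -
    have "\<forall>w\<in>sphere z r. v w \<le> ereal (k w)" using that d(2) by (auto simp: dist_commute)
    then have "v z \<le> ereal (circle_avg k z r)" using that by (intro \<rho>(2)) auto
    then show ?thesis using d by simp
  qed
  then show ?thesis unfolding submean_at_def using d \<rho> by (intro exI[of _ "min d \<rho>"]) auto
qed

lemma finite_null_no_atom:
  assumes "\<mu> \<in> borel_probabilities_on S" "\<And>x. measure \<mu> {x} = 0" "finite X"
  shows "AE z in \<mu>. z \<notin> X"
proof -
  interpret prob_space \<mu> using bpD[OF assms(1)] by blast
  have "AE z in \<mu>. z \<noteq> x" for x
    using assms(2)[of x] prob_eq_0[of "{x}"] bpD(2)[OF assms(1)] by simp
  then have "AE z in \<mu>. \<forall>x\<in>X. z \<noteq> x" using assms(3) by (intro AE_finite_allI) auto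
  then show ?thesis by eventually_elim auto
qed

context equilibrium
begin

text \<open>Off \<open>E\<close> the logarithm of the product, set to -\<infinity> at the zeros, is
  submean, and upper semicontinuity gives the bound by \<open>ln M\<close> at every frontier point;
  so the generalised principle is applied with empty exceptional set. What it contributes is that a
  bounded difference at infinity is enough. On \<open>E\<close> the claim follows from
  \<open>V \<le> log_pot \<mu> z\<close>.\<close>

theorem bernstein_walsh:
  assumes M: "0 < M" "\<And>z. z \<in> E \<Longrightarrow> (\<Prod>j<n. cmod (z - w j)) \<le> M" and n: "0 < n"
    and z: "\<And>j. j < n \<Longrightarrow> z \<noteq> w j"
  shows "(\<Sum>j<n. ln (cmod (z - w j))) \<le> ln M + real n * (log_pot \<mu> z - V)"
proof (cases "z \<in> E")
  case True
  have "(\<Sum>j<n. ln (cmod (z - w j))) = ln (\<Prod>j<n. cmod (z - w j))"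
    using z ln_prod[of "{..<n}" "\<lambda>j. cmod (z - w j)"] by auto
  also have "\<dots> \<le> ln M" using M(2)[OF True] z by (intro ln_mono prod_pos) auto
  also have "\<dots> \<le> ln M + real n * (log_pot \<mu> z - V)" using log_pot_ge[of z] by simp
  finally show ?thesis .
next
  case False
  define X where "X = w ` {..<n}"
  have X: "finite X" "closed X" "bounded X" by (auto simp: X_def finite_imp_closed finite_imp_bounded)
  define \<tau> where "\<tau> = empirical w n"
  have \<tau>: "\<tau> \<in> borel_probabilities_on X" unfolding \<tau>_def X_def
    by (rule empirical_bp[OF n]) (use X in \<open>auto simp: X_def\<close>)
  have pt: "real n * log_pot \<tau> a = (\<Sum>j<n. ln (cmod (a - w j)))" if "a \<notin> X" for a
  proof -
    have "\<And>j. j < n \<Longrightarrow> a \<noteq> w j" using that by (auto simp: X_def)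
    then show ?thesis using log_pot_empirical[OF n, of a w] n ln_prod[of "{..<n}" "\<lambda>j. cmod (a - w j)"] by (simp add: \<tau>_def)
  qed
  have ph: "mean_harmonic (- X) (\<lambda>z. real n * log_pot \<tau> z)"
    by (intro mean_harmonic_mult mean_harmonic_log_pot[OF \<tau> X(3,2)])
  define g where "g a = (\<Prod>j<n. cmod (a - w j))" for a
  have gc: "continuous_on A g" for A unfolding g_def by (intro continuous_intros)
  have g0: "g a = 0 \<longleftrightarrow> a \<in> X" "0 \<le> g a" for a by (auto simp: g_def X_def prod_nonneg)
  have gln: "ln (g a) = real n * log_pot \<tau> a" if "a \<notin> X" for a
  proof -
    have "\<And>j. j < n \<Longrightarrow> a \<noteq> w j" using that by (auto simp: X_def)
    then show ?thesis using pt[OF that] ln_prod[of "{..<n}" "\<lambda>j. cmod (a - w j)"] by (simp add: g_def)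
  qed
  define u where "u a = (if a \<in> X then -\<infinity> else ereal (ln (g a)))" for a
  define H where "H a = ln M + real n * (log_pot \<mu> a + (- V))" for a
  have oE: "open (- E)" using compact_imp_closed[OF compact] by (rule open_Compl)
  have u_lt: "\<forall>\<^sub>F b in nhds a. u b < c" if "u a < c" for a c
  proof -
    have "(g \<longlongrightarrow> g a) (nhds a)" using gc[of UNIV]
      by (simp add: continuous_on_eq_continuous_at isCont_def tendsto_at_iff_tendsto_nhds)
    show ?thesis
    proof (cases "a \<in> X")
      case True
      have "c \<noteq> -\<infinity>" using that by auto
      then obtain c' where c': "ereal c' \<le> c" by (cases c) (auto intro: that)
      have "g a = 0" using True g0(1) by blast
      then have "\<forall>\<^sub>F b in nhds a. g b < exp c'"
        using \<open>(g \<longlongrightarrow> g a) (nhds a)\<close> by (intro order_tendstoD(2)) auto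
      then show ?thesis
      proof eventually_elim
        case (elim b)
        have "u b < ereal c'"
        proof (cases "b \<in> X")
          case False
          then have "g b > 0" using g0[of b] by (simp add: less_le)
          then have "ln (g b) < c'" using elim by (metis exp_gt_zero ln_exp ln_less_cancel_iff)
          then show ?thesis using False by (simp add: u_def)
        qed (simp add: u_def)
        then show ?case using c' by (rule less_le_trans)
      qed
    next
      case False
      then have "g a > 0" using g0[of a] by (simp add: less_le)
      have "\<forall>\<^sub>F b in nhds a. b \<in> - X" using X(2) False by (intro eventually_nhds_in_open) auto
      moreover have "((\<lambda>b. ereal (ln (g b))) \<longlongrightarrow> ereal (ln (g a))) (nhds a)"
        using \<open>(g \<longlongrightarrow> g a) (nhds a)\<close> \<open>g a > 0\<close> by (intro tendsto_intros) auto
      then have "\<forall>\<^sub>F b in nhds a. ereal (ln (g b)) < c"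
        using that False by (intro order_tendstoD(2)) (auto simp: u_def)
      ultimately show ?thesis by eventually_elim (simp add: u_def)
    qed
  qed
  obtain R where R: "1 \<le> R" "\<And>t. t \<in> E \<Longrightarrow> cmod t \<le> R" using radius by blast
  obtain R2 where R2: "R2 > 0" "\<And>t. t \<in> X \<Longrightarrow> cmod t \<le> R2" using X(3) bounded_pos by metis
  have "u z \<le> ereal (H z)"
  proof (rule generalised_maximum_principle[where D = "- E" and P = "{}" and R = "R2 + 2 * R"
        and C' = "real n * ln 2 + real n * V - ln M"])
    show "mean_harmonic (- E) H" unfolding H_def
      by (intro mean_harmonic_add mean_harmonic_mult mean_harmonic_log_pot' mean_harmonic_const oE)
    show "frontier (- E) \<subseteq> E" by (rule frontier_compl)
    show "\<exists>e>0. trunc_energy \<sigma> \<sigma> e < A" if "\<sigma> \<in> borel_probabilities_on {}" for \<sigma> A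
      using bp_nonempty[OF that] by simp
    show "u a < \<infinity>" for a by (simp add: u_def)
    show "\<forall>\<^sub>F b in at a within - E. u b < c" if "u a < c" for a c
      using u_lt[OF that] unfolding eventually_at_filter by (auto elim: eventually_mono)
    show "submean_at u a" for a
    proof (cases "a \<in> X")
      case True
      then show ?thesis by (auto simp: submean_at_def u_def intro!: exI[of _ 1])
    next
      case False
      have "\<forall>\<^sub>F b in nhds a. b \<in> - X" using X(2) False by (intro eventually_nhds_in_open) auto
      then have "\<forall>\<^sub>F b in nhds a. u b = ereal (real n * log_pot \<tau> b)"
        by eventually_elim (simp add: u_def gln)
      then show ?thesis using False by (intro submean_at_cong[OF _ submean_at_harmonic[OF ph]]) auto
    qed
    show "\<forall>\<^sub>F b in at x within - E. u b \<le> ereal (H b + \<epsilon>)" if "x \<in> frontier (- E)" "0 < \<epsilon>" for x \<epsilon>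
    proof -
      have "g x \<le> M" using that frontier_compl M(2)[of x] by (auto simp: g_def)
      have "u x < ereal (ln M + \<epsilon>)"
      proof (cases "x \<in> X")
        case False
        then have "g x > 0" using g0[of x] by (simp add: less_le)
        then have "ln (g x) \<le> ln M" using \<open>g x \<le> M\<close> M(1) by simp
        then show ?thesis using False that(2) by (simp add: u_def)
      qed (simp add: u_def)
      from u_lt[OF this] have "\<forall>\<^sub>F b in at x within - E. u b < ereal (ln M + \<epsilon>)"
        unfolding eventually_at_filter by (auto elim: eventually_mono)
      then show ?thesis
      proof eventually_elim
        case (elim b)
        have "ereal (ln M + \<epsilon>) \<le> ereal (H b + \<epsilon>)" using log_pot_ge[of b] by (simp add: H_def)
        with elim show ?case by (metis less_imp_le order_trans)
      qed
    qed
    show "u a \<le> ereal (H a + (real n * ln 2 + real n * V - ln M))" if a: "R2 + 2 * R \<le> cmod a" for a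
    proof -
      have aX: "a \<notin> X" using R2(2)[of a] a R by auto
      have "log_pot \<tau> a \<le> ln (cmod a + R2)" using R2 R a by (intro log_pot_growth(2)[OF \<tau> R2(2)]) auto
      also have "\<dots> \<le> ln (2 * (cmod a - R))" using R R2 a by (intro ln_mono) auto
      also have "\<dots> = ln 2 + ln (cmod a - R)" using R R2 a by (intro ln_mult_pos) auto
      also have "ln (cmod a - R) \<le> log_pot \<mu> a" using R R2 a by (intro log_pot_growth(1)[OF bp R(2)]) auto
      finally have "real n * log_pot \<tau> a \<le> real n * (ln 2 + log_pot \<mu> a)" by (intro mult_left_mono) auto
      then show ?thesis using aX by (simp add: u_def gln H_def algebra_simps)
    qed
  qed (use False oE in auto)
  moreover have "z \<notin> X" using z by (auto simp: X_def)
  ultimately show ?thesis using gln[of z] pt[of z] by (simp add: u_def H_def)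
qed

lemma factor_bound:
  assumes M: "0 < M" "\<And>z. z \<in> E \<Longrightarrow> (\<Prod>j<n. cmod (z - w j)) \<le> M" and n: "0 < n"
  shows "(\<Sum>j<n. trunc_log 1 u (w j)) \<le> ln M + real n * (trunc_pot \<mu> 1 u - V)"
proof -
  have c: "circle_measure u 1 \<in> borel_probabilities_on (sphere u 1)" by (rule circle_measure_bp) simp
  have i: "integrable (circle_measure u 1) (\<lambda>z. ln (cmod (z - t)))" for t
    using integrable_circle_measure_ln[of 1 u t] by (simp add: norm_minus_commute)
  have "trunc_log 1 u t = (\<integral>z. ln (cmod (z - t)) \<partial>circle_measure u 1)" for t
    using log_pot_circle_measure[of 1 u t] by (simp add: log_pot_def norm_minus_commute[of t])
  then have "(\<Sum>j<n. trunc_log 1 u (w j)) = (\<Sum>j<n. \<integral>z. ln (cmod (z - w j)) \<partial>circle_measure u 1)" by simp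
  also have "\<dots> = (\<integral>z. (\<Sum>j<n. ln (cmod (z - w j))) \<partial>circle_measure u 1)"
    using i by (intro Bochner_Integration.integral_sum[symmetric]) auto
  also have "\<dots> \<le> (\<integral>z. ln M + real n * (log_pot \<mu> z - V) \<partial>circle_measure u 1)"
  proof (rule integral_mono_AE)
    show "integrable (circle_measure u 1) (\<lambda>z. \<Sum>j<n. ln (cmod (z - w j)))" using i by auto
    show "integrable (circle_measure u 1) (\<lambda>z. ln M + real n * (log_pot \<mu> z - V))"
      using integrable_log_pot[OF c] finite_measure.integrable_const[OF bpD(8)[OF c], of "ln M"]
        finite_measure.integrable_const[OF bpD(8)[OF c], of V] by auto
    have "AE z in circle_measure u 1. z \<notin> w ` {..<n}"
      by (rule finite_null_no_atom[OF c circle_measure_no_atom]) auto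
    then show "AE z in circle_measure u 1. (\<Sum>j<n. ln (cmod (z - w j))) \<le> ln M + real n * (log_pot \<mu> z - V)"
      by eventually_elim (use bernstein_walsh[OF M n] in auto)
  qed
  also have "\<dots> = ln M + real n * ((\<integral>z. log_pot \<mu> z \<partial>circle_measure u 1) - V)"
    using integrable_log_pot[OF c] finite_measure.integrable_const[OF bpD(8)[OF c], of "ln M"]
      finite_measure.integrable_const[OF bpD(8)[OF c], of V]
    by (simp add: bpD(3,7)[OF c])
  finally show ?thesis using integral_log_pot_circle_measure[of 1 u] by simp
qed

lemma E_nonempty: "E \<noteq> {}" by (rule bp_nonempty[OF bp])

lemma E_not_finite_zeros:
  assumes "finite X" shows "\<exists>z\<in>E. z \<notin> X"
proof (rule ccontr)
  assume "\<not> ?thesis"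
  moreover have "AE z in \<mu>. z \<notin> X" by (rule finite_null_no_atom[OF bp no_atom assms])
  ultimately have "AE z in \<mu>. False" using bpD(6)[OF bp] by (auto elim: eventually_elim2)
  then show False using prob_space.AE_False[OF bpD(1)[OF bp]] by simp
qed

lemma leja_max_pos: "0 < leja_max E n"
proof -
  obtain z where z: "z \<in> E" "z \<notin> leja E ` {..<n}" using E_not_finite_zeros[of "leja E ` {..<n}"] by auto
  then have "0 < leja_prod E n z" unfolding leja_prod_eq by (intro prod_pos) auto
  also have "\<dots> \<le> leja_max E n" by (rule leja_prod_le[OF compact E_nonempty z(1)])
  finally show ?thesis .
qed

text \<open>Average \<open>ln (leja_prod E n)\<close> over \<open>\<mu>\<close>: each zero
  contributes its potential, at least \<open>V\<close>, and the maximum bounds the average.\<close>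

lemma leja_max_ge: "real n * V \<le> ln (leja_max E n)"
proof -
  let ?w = "leja E"
  have i: "integrable \<mu> (\<lambda>z. ln (cmod (z - t)))" for t
    using integrable_ln[of t] by (simp add: norm_minus_commute)
  have "real n * V = (\<Sum>j<n. V)" by simp
  also have "\<dots> \<le> (\<Sum>j<n. log_pot \<mu> (?w j))" by (intro sum_mono log_pot_ge)
  also have "\<dots> = (\<integral>z. (\<Sum>j<n. ln (cmod (z - ?w j))) \<partial>\<mu>)"
  proof -
    have "log_pot \<mu> t = (\<integral>z. ln (cmod (z - t)) \<partial>\<mu>)" for t
      by (simp add: log_pot_def norm_minus_commute[of t])
    then show ?thesis using i by (simp add: Bochner_Integration.integral_sum)
  qed
  also have "\<dots> \<le> (\<integral>z. ln (leja_max E n) \<partial>\<mu>)"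
  proof (rule integral_mono_AE)
    show "integrable \<mu> (\<lambda>z. \<Sum>j<n. ln (cmod (z - ?w j)))" using i by auto
    show "integrable \<mu> (\<lambda>z. ln (leja_max E n))" using finite_measure.integrable_const[OF bpD(8)[OF bp]] .
    have "AE z in \<mu>. z \<notin> ?w ` {..<n}" by (rule finite_null_no_atom[OF bp no_atom]) auto
    with bpD(6)[OF bp] show "AE z in \<mu>. (\<Sum>j<n. ln (cmod (z - ?w j))) \<le> ln (leja_max E n)"
    proof eventually_elim
      case (elim z)
      have ne: "z \<noteq> ?w j" if "j < n" for j using elim that by auto
      have "(\<Sum>j<n. ln (cmod (z - ?w j))) = ln (leja_prod E n z)"
        unfolding leja_prod_eq using ne ln_prod[of "{..<n}" "\<lambda>j. cmod (z - ?w j)"] by auto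
      also have "\<dots> \<le> ln (leja_max E n)"
        using ne elim by (intro ln_mono leja_prod_le compact E_nonempty) (auto simp: leja_prod_eq intro!: prod_pos)
      finally show ?case .
    qed
  qed
  also have "\<dots> = ln (leja_max E n)" by (rule bp_const[OF bp])
  finally show ?thesis .
qed

text \<open>Along a subsequence \<open>leja_max E n\<close> is below
  \<open>exp (n * (V + \<eta>))\<close>. By \<open>leja_max_ge\<close> a weak limit of the empirical
  measures has energy at least \<open>V\<close>, so it is \<open>\<mu>\<close>, and the averages of
  the continuous function \<open>trunc_log 1 u\<close> converge to
  \<open>trunc_pot \<mu> 1 u\<close>.\<close>

lemma trunc_pot_le_of_leja:
  assumes K: "\<And>n. 0 < n \<Longrightarrow> (\<Sum>j<n. trunc_log 1 u (leja E j)) \<le> real n * K + ln (leja_max E n)"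
  shows "trunc_pot \<mu> 1 u - V \<le> K"
proof (rule field_le_epsilon)
  fix \<eta> :: real assume \<eta>: "0 < \<eta>"
  let ?w = "leja E"
  have "\<exists>e>0. trunc_energy \<sigma> \<sigma> e < V + \<eta>" if "\<sigma> \<in> borel_probabilities_on E" for \<sigma>
    using maximal[OF that, of "V + \<eta>"] \<eta> by (meson less_add_same_cancel1 not_less)
  then have "\<exists>n\<ge>m. 0 < n \<and> leja_max E n < exp (real n * (V + \<eta>))" for m
    by (intro leja_max_small compact E_nonempty)
  then obtain k where k: "\<And>m. m \<le> k m" "\<And>m. 0 < k m" "\<And>m. leja_max E (k m) < exp (real (k m) * (V + \<eta>))"
    by metis
  have ebp: "empirical ?w (k m) \<in> borel_probabilities_on E" for m
    using bpD(5)[OF bp] leja_in[OF compact E_nonempty] by (intro empirical_bp k(2))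
  obtain s \<sigma> where s: "strict_mono (s :: nat \<Rightarrow> nat)" "\<sigma> \<in> borel_probabilities_on E"
    "\<And>f :: complex \<Rightarrow> real. continuous_on UNIV f \<Longrightarrow> (\<lambda>n. integral\<^sup>L (empirical ?w (k (s n))) f) \<longlonglongrightarrow> integral\<^sup>L \<sigma> f"
    using weak_compactness[of E "\<lambda>m. empirical ?w (k m)", OF compact ebp] by blast
  have fl: "filterlim (\<lambda>n. k (s n)) at_top sequentially"
  proof (rule filterlim_at_top_mono[OF filterlim_subseq[OF s(1)]])
    show "\<forall>\<^sub>F n in sequentially. s n \<le> k (s n)" using k(1) by simp
  qed
  have "equilibrium E V \<sigma>"
  proof
    show "V \<le> trunc_energy \<sigma> \<sigma> e" if "0 < e" for e
      by (rule leja_limit_energy[where ?n0.0 = 0, OF compact E_nonempty leja_max_pos leja_max_ge k(2) fl s(2,3) that])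
  qed (use compact s(2) maximal in auto)
  then have "\<sigma> = \<mu>" using equilibrium_unique(1)[OF _ equilibrium_axioms] by blast
  then have "(\<lambda>n. integral\<^sup>L (empirical ?w (k (s n))) (trunc_log 1 u)) \<longlonglongrightarrow> trunc_pot \<mu> 1 u"
    using s(3)[OF continuous_on_trunc_log[of 1 u]] by (simp add: trunc_pot_def)
  moreover have "integral\<^sup>L (empirical ?w (k n)) (trunc_log 1 u) \<le> K + (V + \<eta>)" for n
  proof -
    have "(\<Sum>j<k n. trunc_log 1 u (?w j)) \<le> real (k n) * K + ln (leja_max E (k n))" by (rule K[OF k(2)])
    also have "ln (leja_max E (k n)) \<le> real (k n) * (V + \<eta>)"
      using k(3)[of n] leja_max_pos[of "k n"] by (metis exp_gt_zero less_imp_le ln_exp ln_mono)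
    finally have "(\<Sum>j<k n. trunc_log 1 u (?w j)) \<le> real (k n) * (K + (V + \<eta>))" by (simp add: algebra_simps)
    then show ?thesis using k(2)[of n]
      by (subst integral_empirical[OF k(2) trunc_log_measurable]) (simp add: divide_le_eq mult.commute)
  qed
  ultimately have "trunc_pot \<mu> 1 u \<le> K + (V + \<eta>)" by (intro tendsto_upperbound) auto
  then show "trunc_pot \<mu> 1 u - V \<le> K + \<eta>" by simp
qed

section \<open>Sup norms of monic factors and the best constant\<close>

lemma
  shows sup_norm_ge: "z \<in> E \<Longrightarrow> cmod (poly p z) \<le> sup_norm_on E (poly p)"
    and sup_norm_le: "(\<And>z. z \<in> E \<Longrightarrow> cmod (poly p z) \<le> B) \<Longrightarrow> sup_norm_on E (poly p) \<le> B"
proof -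
  have "compact ((\<lambda>z. cmod (poly p z)) ` E)"
    by (intro compact_continuous_image compact continuous_intros)
  then have "bdd_above ((\<lambda>z. cmod (poly p z)) ` E)" by (simp add: bounded_imp_bdd_above compact_imp_bounded)
  then show "z \<in> E \<Longrightarrow> cmod (poly p z) \<le> sup_norm_on E (poly p)"
    unfolding sup_norm_on_def by (intro cSUP_upper)
  show "(\<And>z. z \<in> E \<Longrightarrow> cmod (poly p z) \<le> B) \<Longrightarrow> sup_norm_on E (poly p) \<le> B"
    unfolding sup_norm_on_def by (intro cSUP_least E_nonempty)
qed

lemma sup_norm_pos:
  assumes "p \<noteq> 0" shows "0 < sup_norm_on E (poly p)"
proof -
  obtain z where "z \<in> E" "poly p z \<noteq> 0"
    using E_not_finite_zeros[OF poly_roots_finite[OF assms]] by auto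
  then show ?thesis using sup_norm_ge[of z p] by (metis less_le_trans zero_less_norm_iff)
qed

lemma frontier_E: "frontier E \<noteq> {}" "compact (frontier E)" "frontier E \<subseteq> E"
proof -
  have "E \<noteq> UNIV" using bd not_bounded_UNIV by metis
  then show "frontier E \<noteq> {}" using E_nonempty by (simp add: frontier_eq_empty)
  show "compact (frontier E)" using compact by (rule compact_frontier)
  show "frontier E \<subseteq> E" using compact_imp_closed[OF compact] by (rule frontier_subset_closed)
qed

lemma factor_constant_upper:
  assumes u: "\<And>v. v \<in> frontier E \<Longrightarrow> trunc_pot \<mu> 1 v \<le> trunc_pot \<mu> 1 u"
  shows "factor_constant E (exp (trunc_pot \<mu> 1 u - V))"
  unfolding factor_constant_def
proof (intro allI impI)
  fix n :: nat and p q :: "complex poly"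
  assume n: "1 \<le> n" and "monic p \<and> degree p = n \<and> monic_factor q p"
  then obtain r where p: "monic p" "degree p = n" and q: "monic q" "monic r" "p = q * r"
    by (auto simp: monic_factor_def)
  obtain xs where xs: "\<And>z. poly q z = (\<Prod>j<length xs. z - xs ! j)" "degree q = length xs"
    using monic_factorization[OF q(1)] by blast
  obtain ys where ys: "\<And>z. poly r z = (\<Prod>j<length ys. z - ys ! j)" "degree r = length ys"
    using monic_factorization[OF q(2)] by blast
  \<comment> \<open>The roots of \<open>q\<close> come first, so passing from \<open>p\<close> to
    \<open>q\<close> shortens the index range.\<close>
  define w where "w j = (xs @ ys) ! j" for j
  have nz: "p \<noteq> 0" "q \<noteq> 0" "r \<noteq> 0" using p q by (auto simp: monic_def)
  have len: "n = length xs + length ys" using p(2) q(3) xs(2) ys(2) nz by (simp add: degree_mult_eq)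
  have pw: "cmod (poly p z) = (\<Prod>j<n. cmod (z - w j))" for z
  proof -
    have "(\<Prod>j<n. z - w j) = (\<Prod>j<length xs. z - w j) * (\<Prod>j<length ys. z - w (length xs + j))"
    proof -
      have "(\<Prod>j<a + b. f j) = (\<Prod>j<a. f j) * (\<Prod>j<b. f (a + j))" for a b :: nat and f :: "nat \<Rightarrow> complex"
        by (induction b) (simp_all add: mult.assoc)
      then show ?thesis unfolding len .
    qed
    also have "\<dots> = poly p z"
      unfolding q(3) by (simp add: xs(1) ys(1) w_def nth_append)
    finally show ?thesis by (metis prod_norm)
  qed
  define M where "M = sup_norm_on E (poly p)"
  have M: "0 < M" using sup_norm_pos[OF nz(1)] by (simp add: M_def)
  have MB: "(\<Prod>j<n. cmod (z - w j)) \<le> M" if "z \<in> E" for z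
    using sup_norm_ge[OF that, of p] pw[of z] by (simp add: M_def)
  have bound: "cmod (poly q v) \<le> exp (trunc_pot \<mu> 1 u - V) ^ n * M" if v: "v \<in> frontier E" for v
  proof (cases "poly q v = 0")
    case True then show ?thesis using M by simp
  next
    case False
    then have ne: "v \<noteq> xs ! j" if "j < length xs" for j using that xs(1)[of v] by auto
    have "ln (cmod (poly q v)) = (\<Sum>j<length xs. ln (cmod (v - xs ! j)))"
      using ne ln_prod[of "{..<length xs}" "\<lambda>j. cmod (v - xs ! j)"] by (simp add: xs(1) flip: prod_norm)
    also have "\<dots> \<le> (\<Sum>j<length xs. trunc_log 1 v (w j))"
      using ne by (intro sum_mono) (auto simp: w_def nth_append intro!: trunc_log_ge_ln)
    also have "\<dots> \<le> (\<Sum>j<n. trunc_log 1 v (w j))"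
      using len trunc_log_ge[of 1 v] by (intro sum_mono2) auto
    also have "\<dots> \<le> ln M + real n * (trunc_pot \<mu> 1 v - V)"
      using n by (intro factor_bound[OF M MB]) auto
    also have "\<dots> \<le> ln M + real n * (trunc_pot \<mu> 1 u - V)" using u[OF v] by (simp add: mult_left_mono)
    finally have "exp (ln (cmod (poly q v))) \<le> exp (ln M + real n * (trunc_pot \<mu> 1 u - V))" by simp
    then show ?thesis using False M by (simp add: exp_add exp_of_nat_mult mult.commute)
  qed
  \<comment> \<open>The maximality of \<open>u\<close> covers only frontier points; the maximum
    modulus principle carries the bound into the interior of \<open>E\<close>.\<close>
  have "cmod (poly q z) \<le> exp (trunc_pot \<mu> 1 u - V) ^ n * M" if "z \<in> E" for z
    by (rule maximum_modulus_frontier[OF _ _ bd bound that])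
      (auto intro!: holomorphic_intros continuous_intros)
  then show "sup_norm_on E (poly q) \<le> exp (trunc_pot \<mu> 1 u - V) ^ n * sup_norm_on E (poly p)"
    unfolding M_def[symmetric] by (rule sup_norm_le)
qed

lemma factor_constant_lower:
  assumes C: "factor_constant E C" and u: "u \<in> E"
  shows "exp (trunc_pot \<mu> 1 u - V) \<le> C"
proof -
  have norm_le: "sup_norm_on E (poly q) \<le> C ^ degree p * sup_norm_on E (poly p)"
    if "monic p" "monic_factor q p" "1 \<le> degree p" for p q
    using C that unfolding factor_constant_def by blast
  have mon: "monic (\<Prod>j\<in>J. [:- w j, 1:])" "degree (\<Prod>j\<in>J. [:- w j, 1:]) = card J" if "finite J" for J and w :: "nat \<Rightarrow> complex"
  proof -
    show "monic (\<Prod>j\<in>J. [:- w j, 1:])" unfolding monic_def by (simp add: lead_coeff_prod)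
    show "degree (\<Prod>j\<in>J. [:- w j, 1:]) = card J" by (subst degree_prod_eq_sum_degree) auto
  qed
  \<comment> \<open>A nonpositive constant already fails for \<open>q = p\<close> equal to the
    identity polynomial. Positivity is what gives \<open>ln C\<close> its meaning below.\<close>
  have Cpos: "0 < C"
  proof -
    let ?N = "sup_norm_on E (poly [:0, 1:])"
    have "?N \<le> C ^ degree [:0, 1 :: complex:] * ?N"
      by (rule norm_le) (auto simp: monic_def monic_factor_def intro!: exI[of _ 1])
    then have "?N \<le> C * ?N" by simp
    moreover have "0 < ?N" by (rule sup_norm_pos) simp
    moreover have "C * ?N \<le> 0" if "C \<le> 0" using that \<open>0 < ?N\<close> by (simp add: mult_nonpos_nonneg)
    ultimately show ?thesis by linarith
  qed
  have "trunc_pot \<mu> 1 u - V \<le> ln C"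
  proof (rule trunc_pot_le_of_leja)
    fix n :: nat assume n: "0 < n"
    let ?w = "leja E"
    define J where "J = {j\<in>{..<n}. 1 \<le> cmod (u - ?w j)}"
    define p where "p = (\<Prod>j<n. [:- ?w j, 1:])"
    define q where "q = (\<Prod>j\<in>J. [:- ?w j, 1:])"
    define r where "r = (\<Prod>j\<in>{..<n} - J. [:- ?w j, 1:])"
    have J: "finite J" "J \<subseteq> {..<n}" by (auto simp: J_def)
    have p: "monic p" "degree p = n" using mon[of "{..<n}" ?w] by (auto simp: p_def)
    have "p = r * q" unfolding p_def q_def r_def using J by (intro prod.subset_diff) auto
    then have mf: "monic_factor q p"
      unfolding monic_factor_def using mon[of J ?w] mon[of "{..<n} - J" ?w] J
      by (auto simp: q_def r_def mult.commute intro!: exI[of _ r])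
    have "cmod (poly p z) = leja_prod E n z" for z
      by (simp add: p_def poly_prod leja_prod_eq algebra_simps flip: prod_norm)
    then have np: "sup_norm_on E (poly p) \<le> leja_max E n"
      using leja_prod_le[OF compact E_nonempty] by (intro sup_norm_le) simp
    have qu: "cmod (poly q u) = (\<Prod>j\<in>J. cmod (u - ?w j))"
      by (simp add: q_def poly_prod algebra_simps flip: prod_norm)
    have "(\<Sum>j<n. trunc_log 1 u (?w j)) = (\<Sum>j\<in>J. trunc_log 1 u (?w j))"
      using J by (intro sum.mono_neutral_right) (auto simp: J_def trunc_log_def max_def)
    also have "\<dots> = (\<Sum>j\<in>J. ln (cmod (u - ?w j)))"
      by (intro sum.cong) (auto simp: J_def trunc_log_eq_ln)
    also have "\<dots> = ln (cmod (poly q u))"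
      unfolding qu using J by (intro ln_prod[symmetric]) (auto simp: J_def)
    also have "\<dots> \<le> ln (C ^ n * leja_max E n)"
    proof (rule ln_mono)
      show "0 < cmod (poly q u)" unfolding qu by (intro prod_pos) (auto simp: J_def)
      have "cmod (poly q u) \<le> sup_norm_on E (poly q)" by (rule sup_norm_ge[OF u])
      also have "\<dots> \<le> C ^ n * sup_norm_on E (poly p)" using norm_le[OF p(1) mf] p(2) n by simp
      also have "\<dots> \<le> C ^ n * leja_max E n" using np Cpos by (intro mult_left_mono) auto
      finally show "cmod (poly q u) \<le> C ^ n * leja_max E n" .
    qed
    also have "\<dots> = real n * ln C + ln (leja_max E n)"
      using Cpos leja_max_pos[of n] by (simp add: ln_mult_pos ln_realpow)
    finally show "(\<Sum>j<n. trunc_log 1 u (?w j)) \<le> real n * ln C + ln (leja_max E n)" .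
  qed
  then have "exp (trunc_pot \<mu> 1 u - V) \<le> exp (ln C)" by simp
  then show ?thesis using Cpos by simp
qed

theorem best_factor_constant_eq:
  "\<exists>u\<in>frontier E. (\<forall>v\<in>frontier E. trunc_pot \<mu> 1 v \<le> trunc_pot \<mu> 1 u) \<and> best_factor_constant E = exp (trunc_pot \<mu> 1 u - V)"
proof -
  obtain u where u: "u \<in> frontier E" "\<And>v. v \<in> frontier E \<Longrightarrow> trunc_pot \<mu> 1 v \<le> trunc_pot \<mu> 1 u"
    using continuous_attains_sup[OF frontier_E(2,1) continuous_on_trunc_pot[OF bp bd, of 1]] by auto
  have "best_factor_constant E = exp (trunc_pot \<mu> 1 u - V)"
    unfolding best_factor_constant_def
    using factor_constant_upper[OF u(2)] factor_constant_lower u(1) frontier_E(3)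
    by (intro Least_equality) auto
  then show ?thesis using u by blast
qed

lemma log_integral_outer:
  "(LINT z:{z. 1 \<le> cmod (z - u)}|\<mu>. ln (cmod (z - u))) = trunc_pot \<mu> 1 u"
  unfolding set_lebesgue_integral_def trunc_pot_def
  by (intro Bochner_Integration.integral_cong) (auto simp: trunc_log_def norm_minus_commute max_def indicator_def)

text \<open>Subtracting the positive part leaves \<open>ln\<close> in the closed unit disc about
  \<open>u\<close> and 0 outside. At \<open>z = u\<close> the value \<open>ln 0 = 0\<close> appears
  on both sides.\<close>

lemma log_integral_inner:
  "(LINT z:{z. cmod (z - u) \<le> 1}|\<mu>. ln (cmod (z - u))) = log_pot \<mu> u - trunc_pot \<mu> 1 u"
proof -
  have "log_pot \<mu> u - trunc_pot \<mu> 1 u = (\<integral>z. ln (cmod (u - z)) - trunc_log 1 u z \<partial>\<mu>)"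
    unfolding log_pot_def trunc_pot_def
    by (intro Bochner_Integration.integral_diff[symmetric] integrable_ln integrable_trunc_log(2)[OF bp bd]) simp
  also have "\<dots> = (LINT z:{z. cmod (z - u) \<le> 1}|\<mu>. ln (cmod (z - u)))"
    unfolding set_lebesgue_integral_def
    by (intro Bochner_Integration.integral_cong) (auto simp: trunc_log_def norm_minus_commute max_def indicator_def)
  finally show ?thesis by simp
qed

end

text \<open>Positive capacity provides a measure of finite energy, hence an instance of the locale,
  and uniqueness justifies the definite description.\<close>

lemma equilibrium_measureI:
  assumes "compact E" "0 < log_capacity E"
  shows "\<exists>V. equilibrium E V (equilibrium_measure E) \<and> log_capacity E = exp V"
proof -
  have bd: "bounded E" using assms(1) by (rule compact_imp_bounded)
  have "max_log_energy E \<noteq> -\<infinity>" using assms(2) by (auto simp: log_capacity_def)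
  then obtain \<sigma>0 where \<sigma>0: "\<sigma>0 \<in> borel_probabilities_on E" "-\<infinity> < log_energy \<sigma>0"
    unfolding max_log_energy_def by (metis SUP_least ereal_infty_less_eq(2) ereal_less_PInfty less_ereal.simps(6) linorder_not_less)
  obtain A0 where "ereal A0 \<le> log_energy \<sigma>0" using ereal_dense2[OF \<sigma>0(2)] by (auto intro: less_imp_le)
  then have "\<And>e. 0 < e \<Longrightarrow> A0 \<le> trunc_energy \<sigma>0 \<sigma>0 e" using log_energy_ge_iff[OF \<sigma>0(1) bd] by blast
  then obtain V \<mu> where eq: "equilibrium E V \<mu>" using equilibrium_exists[OF assms(1) \<sigma>0(1)] by blast
  interpret equilibrium E V \<mu> by fact
  have le: "log_energy \<sigma> \<le> ereal V" if \<sigma>: "\<sigma> \<in> borel_probabilities_on E" for \<sigma>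
  proof (rule ccontr)
    assume "\<not> log_energy \<sigma> \<le> ereal V"
    then have "ereal V < log_energy \<sigma>" by (simp only: not_le)
    from ereal_dense2[OF this] obtain A where A: "ereal V < ereal A" "ereal A < log_energy \<sigma>" by blast
    then have "\<And>e. 0 < e \<Longrightarrow> A \<le> trunc_energy \<sigma> \<sigma> e" using log_energy_ge_iff[OF \<sigma> bd] by (blast intro: less_imp_le)
    from maximal[OF \<sigma> this] A show False by simp
  qed
  have ge: "ereal V \<le> log_energy \<mu>" using log_energy_ge_iff[OF bp bd] energy by blast
  have max: "max_log_energy E = ereal V"
    unfolding max_log_energy_def
  proof (rule antisym)
    show "(SUP \<sigma>\<in>borel_probabilities_on E. log_energy \<sigma>) \<le> ereal V" by (intro SUP_least le)
    show "ereal V \<le> (SUP \<sigma>\<in>borel_probabilities_on E. log_energy \<sigma>)" 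
      using ge SUP_upper[OF bp, of log_energy] by (rule order_trans)
  qed
  have "equilibrium_measure E = \<mu>"
    unfolding equilibrium_measure_def
  proof (rule the_equality)
    show "\<mu> \<in> borel_probabilities_on E \<and> log_energy \<mu> = max_log_energy E"
      using bp le[OF bp] ge max by auto
    fix \<nu> assume \<nu>: "\<nu> \<in> borel_probabilities_on E \<and> log_energy \<nu> = max_log_energy E"
    have "equilibrium E V \<nu>"
    proof
      show "V \<le> trunc_energy \<nu> \<nu> e" if "0 < e" for e
        using \<nu> max log_energy_ge_iff[of \<nu> E V] bd that by simp
    qed (use \<nu> compact maximal in auto)
    then show "\<nu> = \<mu>" using equilibrium_unique(1) eq by blast
  qed
  then show ?thesis using eq max by (auto simp: log_capacity_def)
qed

section \<open>Regular sets\<close>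

text \<open>A continuous majorant on the circle turns the extended-real mean into an ordinary
  integral.\<close>

lemma subharmonic_on_submean:
  assumes "subharmonic_on D u" "z \<in> D"
  shows "submean_at u z"
proof -
  obtain \<rho> where \<rho>: "\<rho> > 0" "\<And>r. 0 < r \<Longrightarrow> r < \<rho> \<Longrightarrow> u z \<le> circle_mean u z r"
    using assms unfolding subharmonic_on_def by blast
  have "u z \<le> ereal (circle_avg k z r)"
    if r: "0 < r" "r < \<rho>" "continuous_on (sphere z r) k" "\<forall>w\<in>sphere z r. u w \<le> ereal (k w)" for r k
  proof -
    have "u z \<le> circle_mean u z r" using \<rho>(2) r by blast
    also have "\<dots> \<le> ext_integral (uniform_measure lborel {0..2 * pi}) (\<lambda>\<theta>. ereal (k (z + of_real r * cis \<theta>)))"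
      unfolding circle_mean_def using r angle_in_sphere[of r z] by (intro ext_integral_mono) auto
    also have "\<dots> = ereal (circle_avg k z r)" using r by (intro ext_integral_real integrable_circle_avg) auto
    finally show ?thesis .
  qed
  then show ?thesis unfolding submean_at_def using \<rho>(1) by blast
qed

text \<open>Upper semicontinuity at the origin of the chart \<open>1 / z\<close>, where the value is
  less than \<infinity>.\<close>

lemma subharmonic_bounded_at_infinity:
  assumes "subharmonic_on_with_infinity D u c"
  shows "\<exists>a R. \<forall>z\<in>D. R \<le> cmod z \<longrightarrow> u z \<le> ereal a"
proof -
  define D' where "D' = {w. w = 0 \<or> inverse w \<in> D}"
  define v where "v w = (if w = 0 then c else u (inverse w))" for w
  have sh: "subharmonic_on D' v" using assms by (simp add: subharmonic_on_with_infinity_def D'_def v_def[abs_def])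
  have "v 0 < \<infinity>" using sh unfolding subharmonic_on_def by (auto simp: D'_def)
  then obtain a where a: "v 0 < ereal a" using ereal_dense2[of "v 0" \<infinity>] by auto
  then have "\<forall>\<^sub>F w in at 0 within D'. v w < ereal a" using sh unfolding subharmonic_on_def by (auto simp: D'_def)
  then obtain d where d: "d > 0" "\<And>w. w \<in> D' \<Longrightarrow> w \<noteq> 0 \<Longrightarrow> dist w 0 < d \<Longrightarrow> v w < ereal a"
    unfolding eventually_at by blast
  have "u z \<le> ereal a" if z: "z \<in> D" "1 + 1 / d \<le> cmod z" for z
  proof -
    have d1: "0 < 1 / d" using d(1) by simp
    have z0: "1 / d < cmod z" using z(2) by linarith
    then have z0: "1 / d < cmod z" "z \<noteq> 0" using d1 less_trans[OF d1 z0] by auto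
    then have "cmod (inverse z) < d" using d(1) by (simp add: norm_inverse inverse_eq_divide norm_divide field_simps)
    moreover have "inverse z \<in> D'" "inverse z \<noteq> 0" using z z0 by (auto simp: D'_def)
    ultimately have "v (inverse z) < ereal a" by (intro d(2)) auto
    then show ?thesis using z0 by (simp add: v_def less_imp_le)
  qed
  then show ?thesis by blast
qed

context equilibrium
begin

text \<open>
  Filling the holes of \<open>E\<close> does not change the equilibrium measure: in the interior of the filled set the
  potential of its equilibrium measure is constant, so the measure lives on the boundary, which is part of \<open>E\<close>.
\<close>

lemma equilibrium_hull: "equilibrium (- outside E) V \<mu>"
  and hull_interior_log_pot: "x \<in> interior (- outside E) \<Longrightarrow> log_pot \<mu> x = V"
proof -
  define F where "F = - outside E"
  have Ecl: "closed E" using compact by (rule compact_imp_closed)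
  have Fc: "compact F" unfolding F_def compact_eq_bounded_closed
    using cobounded_outside[OF bd] open_outside[OF Ecl] by (auto simp: closed_Compl)
  have EF: "E \<subseteq> F" by (auto simp: F_def outside_def)
  have Fm: "F \<in> sets borel" using Fc by (simp add: compact_imp_closed)
  have frF: "frontier F \<subseteq> E" using frontier_outside_subset[OF Ecl] by (simp add: F_def)
  obtain V' \<mu>' where eq': "equilibrium F V' \<mu>'"
    using equilibrium_exists[OF Fc bp_mono[OF bp EF Fm] energy] by blast
  interpret H: equilibrium F V' \<mu>' by (rule eq')
  have int: "log_pot \<mu>' x = V' \<and> x \<notin> measure_support \<mu>'" if x: "x \<in> interior F" for x
  proof -
    obtain r where r: "r > 0" "ball x r \<subseteq> F" using x by (meson mem_interior)
    \<comment> \<open>Small circles about \<open>x\<close> lie in the filled set, so the potential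
      is \<open>V'\<close> almost everywhere on them.\<close>
    have tp: "trunc_pot \<mu>' \<rho> x = V'" if \<rho>: "0 < \<rho>" "\<rho> < r" for \<rho>
    proof -
      have c: "circle_measure x \<rho> \<in> borel_probabilities_on (sphere x \<rho>)" using \<rho> by (intro circle_measure_bp) auto
      have "AE z in circle_measure x \<rho>. log_pot \<mu>' z = V'"
        using H.log_pot_circle_measure_AE[OF \<rho>(1), of x] bpD(6)[OF c]
      proof eventually_elim
        case (elim z)
        then have "z \<in> F" using r(2) \<rho>(2) by auto
        then show ?case using elim by blast
      qed
      then have "(\<integral>z. log_pot \<mu>' z \<partial>circle_measure x \<rho>) = (\<integral>z. V' \<partial>circle_measure x \<rho>)"
        using H.log_pot_measurable by (intro integral_cong_AE) (auto simp: circle_measure_def)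
      then show ?thesis using H.integral_log_pot_circle_measure[OF \<rho>(1), of x] bp_const[OF c, of V'] by simp
    qed
    have "log_pot \<mu>' x \<le> trunc_pot \<mu>' (r / 2) x" using r by (intro H.log_pot_le_trunc_pot) auto
    then have p: "log_pot \<mu>' x = V'" using tp[of "r / 2"] H.log_pot_ge[of x] r by simp
    \<comment> \<open>The integrand is a tent, positive on \<open>ball x (r / 4)\<close>. Its
      integral is the difference of two equal circle means, so that ball carries no mass.\<close>
    have i: "integrable \<mu>' (\<lambda>t. trunc_log (r / 2) x t - trunc_log (r / 4) x t)"
      using r by (intro Bochner_Integration.integrable_diff integrable_trunc_log(2)[OF H.bp H.bd]) auto
    have "(\<integral>t. trunc_log (r / 2) x t - trunc_log (r / 4) x t \<partial>\<mu>') = trunc_pot \<mu>' (r / 2) x - trunc_pot \<mu>' (r / 4) x"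
      unfolding trunc_pot_def using r by (intro Bochner_Integration.integral_diff integrable_trunc_log(2)[OF H.bp H.bd]) auto
    also have "\<dots> = 0" using tp[of "r / 2"] tp[of "r / 4"] r by simp
    finally have "AE t in \<mu>'. trunc_log (r / 2) x t - trunc_log (r / 4) x t = 0"
      using i r by (subst (asm) integral_nonneg_eq_0_iff_AE) (auto intro!: trunc_log_mono)
    then have "AE t in \<mu>'. t \<notin> ball x (r / 4)"
    proof eventually_elim
      case (elim t)
      show ?case
      proof
        assume "t \<in> ball x (r / 4)"
        then have "trunc_log (r / 2) x t = ln (r / 2)" "trunc_log (r / 4) x t = ln (r / 4)"
          using r(1) by (auto simp: trunc_log_def dist_norm max_def)
        moreover have "ln (r / 4) < ln (r / 2)" using r by simp
        ultimately show False using elim by simp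
      qed
    qed
    then have "measure \<mu>' (ball x (r / 4)) = 0"
      using prob_space.prob_eq_0[OF bpD(1)[OF H.bp], of "ball x (r / 4)"] bpD(2)[OF H.bp] by simp
    moreover have "0 < r / 4" using r by simp
    ultimately have "x \<notin> measure_support \<mu>'" unfolding measure_support_def by (metis (mono_tags) less_irrefl mem_Collect_eq)
    then show ?thesis using p by blast
  qed
  have "measure_support \<mu>' \<subseteq> F" using measure_support_subset[OF H.bp compact_imp_closed[OF Fc]] .
  then have "measure_support \<mu>' \<subseteq> E" using int frF Fc by (fastforce simp: frontier_def compact_imp_closed)
  then have bp': "\<mu>' \<in> borel_probabilities_on E"
    using bp_mono[OF bp_measure_support[OF H.bp]] bpD(5)[OF bp] by blast
  \<comment> \<open>A maximiser for the larger set that lives on \<open>E\<close> is a maximiser for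
    \<open>E\<close>, and uniqueness identifies it with \<open>\<mu>\<close>.\<close>
  have "equilibrium E V' \<mu>'"
  proof
    show "A \<le> V'" if "\<sigma> \<in> borel_probabilities_on E" "\<And>e. 0 < e \<Longrightarrow> A \<le> trunc_energy \<sigma> \<sigma> e" for \<sigma> A
      using H.maximal[OF bp_mono[OF that(1) EF Fm] that(2)] .
  qed (use compact bp' H.energy in auto)
  then have e: "\<mu> = \<mu>'" "V = V'" using equilibrium_unique[OF equilibrium_axioms] by blast+
  show "equilibrium (- outside E) V \<mu>" using eq' e by (simp add: F_def)
  show "x \<in> interior (- outside E) \<Longrightarrow> log_pot \<mu> x = V" using int e by (simp add: F_def)
qed

text \<open>A frontier point of \<open>E\<close> away from the closure of the unbounded component is
  interior to the filled set. At any other one, almost every point of a small circle has potential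
  at most \<open>V + \<epsilon>\<close>, by \<open>lim\<close> in the unbounded component and by the
  equality with \<open>V\<close> in the filled set; the potential at \<open>x\<close> is at most the
  circle mean.\<close>

lemma log_pot_boundary:
  assumes lim: "\<And>\<zeta> \<epsilon>. \<zeta> \<in> frontier (outside E) \<Longrightarrow> 0 < \<epsilon> \<Longrightarrow> \<forall>\<^sub>F z in at \<zeta> within outside E. log_pot \<mu> z \<le> V + \<epsilon>"
    and x: "x \<in> frontier E"
  shows "log_pot \<mu> x = V"
proof -
  interpret H: equilibrium "- outside E" V \<mu> by (rule equilibrium_hull)
  have xE: "x \<in> E" using x frontier_E(3) by blast
  then have xo: "x \<notin> outside E" by (auto simp: outside_def)
  show ?thesis
  proof (cases "x \<in> closure (outside E)")
    case False
    then have "x \<in> interior (- outside E)" by (simp add: interior_closure)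
    then show ?thesis by (rule hull_interior_log_pot)
  next
    case True
    then have fr: "x \<in> frontier (outside E)"
      using xo open_outside[OF compact_imp_closed[OF compact]] by (simp add: frontier_def interior_open)
    have "log_pot \<mu> x \<le> V + \<epsilon>" if \<epsilon>: "0 < \<epsilon>" for \<epsilon>
    proof -
      obtain d where d: "d > 0" "\<And>z. z \<in> outside E \<Longrightarrow> z \<noteq> x \<Longrightarrow> dist z x < d \<Longrightarrow> log_pot \<mu> z \<le> V + \<epsilon>"
        using lim[OF fr \<epsilon>] unfolding eventually_at by blast
      have r: "0 < d / 2" using d by simp
      have c: "circle_measure x (d / 2) \<in> borel_probabilities_on (sphere x (d / 2))" using r by (intro circle_measure_bp) auto
      have "AE z in circle_measure x (d / 2). log_pot \<mu> z \<le> V + \<epsilon>"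
        using H.log_pot_circle_measure_AE[OF r, of x] bpD(6)[OF c]
      proof eventually_elim
        case (elim z)
        show ?case
        proof (cases "z \<in> outside E")
          case True
          then show ?thesis using elim d by (intro d(2)) (auto simp: dist_commute)
        qed (use elim \<epsilon> in auto)
      qed
      then have "(\<integral>z. log_pot \<mu> z \<partial>circle_measure x (d / 2)) \<le> (\<integral>z. V + \<epsilon> \<partial>circle_measure x (d / 2))"
        by (intro integral_mono_AE integrable_log_pot[OF c] finite_measure.integrable_const[OF bpD(8)[OF c]]) auto
      then have "trunc_pot \<mu> (d / 2) x \<le> V + \<epsilon>"
        using integral_log_pot_circle_measure[OF r, of x] by (simp add: bpD(3,7)[OF c])
      then show ?thesis using log_pot_le_trunc_pot[OF r, of x] by simp
    qed
    then have "log_pot \<mu> x \<le> V" by (rule field_le_epsilon)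
    then show ?thesis using log_pot_ge[of x] by simp
  qed
qed

text \<open>
  With \<open>\<nu>\<close> the normalised part of \<open>\<mu>\<close> away from \<open>\<zeta>\<close> and \<open>m\<close> its mass, the potential \<open>m U\<^sub>\<nu>\<close> is continuous near \<open>\<zeta>\<close>.
  For boundary data \<open>\<phi> \<le> m U\<^sub>\<nu>\<close> with equality at \<open>\<zeta>\<close>, the generalised maximum principle bounds the
  Perron solution by \<open>m (U\<^sub>\<nu> - (U - V))\<close>; at a regular point this forces \<open>U \<longrightarrow> V\<close>.
\<close>

lemma regular_limit:
  assumes reg: "dirichlet_regular_point (outside E) \<zeta>" and \<zeta>: "\<zeta> \<in> frontier (outside E)" and \<epsilon>: "0 < \<epsilon>"
  shows "\<forall>\<^sub>F z in at \<zeta> within outside E. log_pot \<mu> z \<le> V + \<epsilon>"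
proof -
  define \<Omega> where "\<Omega> = outside E"
  have Ecl: "closed E" using compact by (rule compact_imp_closed)
  have \<Omega>: "open \<Omega>" "\<Omega> \<subseteq> - E" "frontier \<Omega> \<subseteq> E"
    using open_outside[OF Ecl] frontier_outside_subset[OF Ecl] unfolding \<Omega>_def by (auto simp: outside_def)
  interpret P: prob_space \<mu> using bpD[OF bp] by blast
  obtain \<rho> where \<rho>: "\<rho> > 0" "measure \<mu> (ball \<zeta> \<rho>) < 1" using no_atom_small_ball[OF bp no_atom, of 1 \<zeta>] by auto
  define B where "B = - ball \<zeta> \<rho>"
  define m where "m = measure \<mu> B"
  have Bm: "B \<in> sets borel" "closed B" by (auto simp: B_def)
  have m: "0 < m" "m \<le> 1"
  proof -
    have "m = 1 - measure \<mu> (ball \<zeta> \<rho>)"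
      using P.prob_compl[of "ball \<zeta> \<rho>"] bpD(2,3)[OF bp] by (simp add: m_def B_def Compl_eq_Diff_UNIV)
    then show "0 < m" "m \<le> 1" using \<rho> by (auto simp: measure_nonneg)
  qed
  define \<nu> where "\<nu> = uniform_measure \<mu> B"
  have \<nu>: "\<nu> \<in> borel_probabilities_on (E \<inter> B)"
    unfolding \<nu>_def using m(1) by (intro uniform_measure_bp[OF bp Bm(1)]) (simp add: m_def)
  have EB: "closed (E \<inter> B)" "bounded (E \<inter> B)" using Ecl Bm bd by (auto simp: bounded_Int closed_Int)
  have int\<nu>: "m * (\<integral>t. f t \<partial>\<nu>) = (\<integral>t. indicator B t * f t \<partial>\<mu>)" if "f \<in> borel_measurable borel" for f :: "complex \<Rightarrow> real"
    using integral_uniform_bp[OF bp Bm(1) _ that] m(1) by (simp add: \<nu>_def m_def)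
  \<comment> \<open>The truncation error of the kernel is nonnegative off the null set
    \<open>t = z\<close>, so the error of the part of \<open>\<mu>\<close> in \<open>B\<close> is at
    most the whole error.\<close>
  have diff: "0 \<le> m * (trunc_pot \<nu> e z - log_pot \<nu> z)" "m * (trunc_pot \<nu> e z - log_pot \<nu> z) \<le> trunc_pot \<mu> e z - log_pot \<mu> z" if e: "0 < e" for e z
  proof -
    have i: "integrable \<mu> (\<lambda>t. trunc_log e z t - ln (cmod (z - t)))"
      by (intro Bochner_Integration.integrable_diff integrable_trunc_log(2)[OF bp bd e] integrable_ln)
    have ne: "AE t in \<mu>. t \<noteq> z"
      using no_atom[of z] P.prob_eq_0[of "{z}"] bpD(2)[OF bp] by simp
    have "m * (trunc_pot \<nu> e z - log_pot \<nu> z) = (\<integral>t. indicator B t * trunc_log e z t \<partial>\<mu>) - (\<integral>t. indicator B t * ln (cmod (z - t)) \<partial>\<mu>)"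
      unfolding right_diff_distrib trunc_pot_def log_pot_def by (simp only: int\<nu>[OF trunc_log_measurable] int\<nu>[OF ln_cmod_measurable])
    also have "\<dots> = (\<integral>t. indicator B t * (trunc_log e z t - ln (cmod (z - t))) \<partial>\<mu>)"
      unfolding right_diff_distrib
      by (intro Bochner_Integration.integral_diff[symmetric] bp_integrable_indicator[OF bp Bm(1)] integrable_trunc_log(2)[OF bp bd e] integrable_ln)
    finally have eq: "m * (trunc_pot \<nu> e z - log_pot \<nu> z) = (\<integral>t. indicator B t * (trunc_log e z t - ln (cmod (z - t))) \<partial>\<mu>)" .
    have "AE t in \<mu>. 0 \<le> indicator B t * (trunc_log e z t - ln (cmod (z - t)))"
      using ne by eventually_elim (auto simp: indicator_def intro!: trunc_log_ge_ln)
    then show "0 \<le> m * (trunc_pot \<nu> e z - log_pot \<nu> z)" unfolding eq by (rule integral_nonneg_AE)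
    have "(\<integral>t. indicator B t * (trunc_log e z t - ln (cmod (z - t))) \<partial>\<mu>) \<le> (\<integral>t. trunc_log e z t - ln (cmod (z - t)) \<partial>\<mu>)"
      by (rule integral_mono_AE[OF bp_integrable_indicator[OF bp Bm(1) i] i])
        (use ne in eventually_elim, auto simp: indicator_def intro!: trunc_log_ge_ln)
    also have "\<dots> = trunc_pot \<mu> e z - log_pot \<mu> z"
      unfolding trunc_pot_def log_pot_def by (intro Bochner_Integration.integral_diff integrable_trunc_log(2)[OF bp bd e] integrable_ln)
    finally show "m * (trunc_pot \<nu> e z - log_pot \<nu> z) \<le> trunc_pot \<mu> e z - log_pot \<mu> z" unfolding eq .
  qed
  \<comment> \<open>\<open>b\<close> is the potential of the part of \<open>\<mu>\<close> in the
    ball about \<open>\<zeta>\<close>, an infimum of the continuous functions \<open>be e\<close>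
    and hence upper semicontinuous.\<close>
  define b where "b z = log_pot \<mu> z - m * log_pot \<nu> z" for z
  define be where "be e z = trunc_pot \<mu> e z - m * trunc_pot \<nu> e z" for e z
  have b_le: "b z \<le> be e z" if "0 < e" for e z using diff(2)[OF that, of z] by (simp add: b_def be_def right_diff_distrib)
  have be_cont: "continuous_on UNIV (be e)" if "0 < e" for e
    unfolding be_def using that by (intro continuous_intros continuous_on_trunc_pot[OF bp bd] continuous_on_trunc_pot[OF \<nu> EB(2)])
  have be_lim: "(\<lambda>n. be (1 / Suc n) z) \<longlonglongrightarrow> b z" for z
  proof -
    have l0: "(\<lambda>n. trunc_pot \<mu> (1 / Suc n) z - log_pot \<mu> z) \<longlonglongrightarrow> 0"
      using tendsto_diff[OF trunc_pot_tendsto_log_pot[of z] tendsto_const[of "log_pot \<mu> z"]] by simp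
    have "(\<lambda>n. m * (trunc_pot \<nu> (1 / Suc n) z - log_pot \<nu> z)) \<longlonglongrightarrow> 0"
      by (rule tendsto_sandwich[OF _ _ tendsto_const l0]) (use diff in auto)
    from tendsto_diff[OF l0 this] have "(\<lambda>n. be (1 / Suc n) z - b z) \<longlonglongrightarrow> 0"
      by (simp add: be_def b_def algebra_simps)
    then show ?thesis using LIM_zero_iff by blast
  qed
  have b_usc: "\<forall>\<^sub>F w in nhds z. b w < a" if "b z < a" for z a
  proof -
    have "\<forall>\<^sub>F n in sequentially. be (1 / Suc n) z < a" using order_tendstoD(2)[OF be_lim that] .
    then obtain n where n: "be (1 / Suc n) z < a" by (auto simp: eventually_sequentially)
    have "isCont (be (1 / Suc n)) z" using be_cont[of "1 / Suc n"] by (simp add: continuous_on_eq_continuous_at)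
    then have "\<forall>\<^sub>F w in nhds z. be (1 / Suc n) w < a"
      using n by (intro order_tendstoD) (simp_all add: isCont_def tendsto_at_iff_tendsto_nhds)
    then show ?thesis
    proof eventually_elim
      case (elim w)
      then show ?case using b_le[of "1 / Suc n" w] by simp
    qed
  qed
  obtain R where R: "1 \<le> R" "\<And>t. t \<in> E \<Longrightarrow> cmod t \<le> R" using radius by blast
  define L where "L = ln (2 * R + 1)"
  have b_near: "b w \<le> L" if "cmod w \<le> R + 1" for w
  proof -
    have "0 \<le> trunc_pot \<nu> 1 w" using trunc_pot_ge[OF \<nu> EB(2), of 1 w] by simp
    then have "be 1 w \<le> trunc_pot \<mu> 1 w" using m(1) by (simp add: be_def)
    also have "\<dots> \<le> ln (max 1 (2 * R + 1))" unfolding trunc_pot_def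
    proof (rule bp_integral_le_const[OF bp integrable_trunc_log(2)[OF bp bd]])
      fix t assume "t \<in> E"
      then have "cmod (w - t) \<le> 2 * R + 1" using R(2)[of t] that norm_triangle_ineq4[of w t] by linarith
      then show "trunc_log 1 w t \<le> ln (max 1 (2 * R + 1))" by (intro trunc_log_le) auto
    qed simp
    also have "max 1 (2 * R + 1) = 2 * R + 1" using R by simp
    finally show ?thesis using b_le[of 1 w] by (simp add: L_def)
  qed
  \<comment> \<open>\<open>Lb\<close> lies below \<open>m * log_pot \<nu>\<close> on
    \<open>E\<close>, where the whole potential is at least \<open>V\<close> and \<open>b\<close> at
    most \<open>L\<close>. It is the boundary value away from \<open>\<zeta>\<close>.\<close>
  define Lb where "Lb = V - L"
  have U1_ge: "Lb \<le> m * log_pot \<nu> x" if "x \<in> E" for x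
    using b_near[of x] R(2)[OF that] log_pot_ge[of x] by (simp add: b_def Lb_def)
  define g where "g z = m * trunc_pot \<nu> (\<rho> / 2) z" for z
  have g_cont: "continuous_on A g" for A unfolding g_def using \<rho>
    by (intro continuous_intros continuous_on_trunc_pot[OF \<nu> EB(2)]) auto
  have g_eq: "g z = m * log_pot \<nu> z" if "z \<in> ball \<zeta> (\<rho> / 2)" for z
  proof -
    have "log_pot \<nu> z = trunc_pot \<nu> (\<rho> / 2) z"
    proof (rule log_pot_eq_trunc_pot[OF \<nu>])
      fix t assume "t \<in> E \<inter> B"
      then have "\<rho> \<le> dist \<zeta> t" by (simp add: B_def)
      then show "\<rho> / 2 \<le> cmod (z - t)" using that dist_triangle[of \<zeta> t z] by (simp add: dist_norm)
    qed
    then show ?thesis by (simp add: g_def)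
  qed
  define \<kappa> where "\<kappa> z = max 0 (1 - 2 * dist \<zeta> z / \<rho>)" for z
  have \<kappa>: "0 \<le> \<kappa> z" "\<kappa> z \<le> 1" "\<kappa> z \<noteq> 0 \<Longrightarrow> z \<in> ball \<zeta> (\<rho> / 2)" "\<kappa> \<zeta> = 1" for z
    using \<rho> by (auto simp: \<kappa>_def max_def field_simps split: if_splits)
  \<comment> \<open>The cutoff \<open>\<kappa>\<close> is supported where \<open>g\<close> is the
    potential \<open>m * log_pot \<nu>\<close>, so interpolating with \<open>Lb\<close> keeps the
    data continuous and below that potential on all of \<open>E\<close>.\<close>
  define \<phi> where "\<phi> z = Lb + \<kappa> z * (g z - Lb)" for z
  have \<phi>_cont: "continuous_on A \<phi>" for A
    unfolding \<phi>_def \<kappa>_def using \<rho> by (intro continuous_intros g_cont) auto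
  have \<phi>_le: "\<phi> x \<le> m * log_pot \<nu> x" if "x \<in> E" for x
  proof (cases "\<kappa> x = 0")
    case False
    then have "g x = m * log_pot \<nu> x" using \<kappa>(3) g_eq by blast
    moreover have "\<kappa> x * (m * log_pot \<nu> x - Lb) \<le> 1 * (m * log_pot \<nu> x - Lb)"
      using \<kappa>(2) U1_ge[OF that] by (intro mult_right_mono) auto
    ultimately show ?thesis by (simp add: \<phi>_def)
  qed (use U1_ge[OF that] in \<open>simp add: \<phi>_def\<close>)
  have \<phi>\<zeta>: "\<phi> \<zeta> = m * log_pot \<nu> \<zeta>" using \<kappa>(4) g_eq[of \<zeta>] \<rho> by (simp add: \<phi>_def)
  obtain C0 where C0: "\<forall>x\<in>E. \<bar>\<phi> x\<bar> \<le> C0" using bounded_imp_bounded_continuous[OF bd \<phi>_cont] by blast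
  have perron: "u z \<le> ereal (m * (log_pot \<nu> z - (log_pot \<mu> z - V)) + \<eta>)"
    if u: "subharmonic_on_with_infinity \<Omega> u c" "\<forall>x\<in>frontier \<Omega>. Limsup (at x within \<Omega>) u \<le> ereal (\<phi> x)"
      and z: "z \<in> \<Omega>" and \<eta>: "0 < \<eta>" for u c z \<eta>
  proof -
    have su: "subharmonic_on \<Omega> u" using u(1) by (simp add: subharmonic_on_with_infinity_def)
    have ev_u: "\<forall>\<^sub>F w in at x within \<Omega>. u w < ereal (\<phi> x + \<delta>)" if "x \<in> frontier \<Omega>" "0 < \<delta>" for x \<delta>
    proof (rule Limsup_lessD)
      have "Limsup (at x within \<Omega>) u \<le> ereal (\<phi> x)" using u(2) that by blast
      also have "\<dots> < ereal (\<phi> x + \<delta>)" using that by simp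
      finally show "Limsup (at x within \<Omega>) u < ereal (\<phi> x + \<delta>)" .
    qed
    obtain a Ru where a: "\<And>w. w \<in> \<Omega> \<Longrightarrow> Ru \<le> cmod w \<Longrightarrow> u w \<le> ereal a"
      using subharmonic_bounded_at_infinity[OF u(1)] by blast
    define H where "H w = m * (log_pot \<nu> w + (- 1) * (log_pot \<mu> w + (- V))) + \<eta>" for w
    \<comment> \<open>In this form the term with factor \<open>1 - m\<close> is visibly nonnegative;
      off the set \<open>P\<close> the rest, \<open>V - b w + \<eta>\<close>, exceeds
      \<open>\<phi> x\<close> near a frontier point \<open>x\<close>.\<close>
    have H_eq: "H w = (1 - m) * (log_pot \<mu> w - V) + V - b w + \<eta>" for w by (simp add: H_def b_def algebra_simps)
    have H_ge: "V - b w + \<eta> \<le> H w" for w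
      using m log_pot_ge[of w] by (simp add: H_eq)
    have hn: "mean_harmonic \<Omega> (log_pot \<nu>)"
      by (rule mean_harmonic_subset[OF mean_harmonic_log_pot[OF \<nu> EB(2,1)] _ \<Omega>(1)]) (use \<Omega>(2) in auto)
    have hm: "mean_harmonic \<Omega> (log_pot \<mu>)" by (rule mean_harmonic_subset[OF mean_harmonic_log_pot' \<Omega>(2,1)])
    define P where "P = {x\<in>E. V + \<eta> \<le> log_pot \<mu> x}"
    have "u z \<le> ereal (H z)"
    proof (rule generalised_maximum_principle[where D = \<Omega> and P = P and C = "C0 + 1 - V + L"
          and R = "max Ru (3 * R)" and C' = "a + m * (ln 2 - V)"])
      show "mean_harmonic \<Omega> H" unfolding H_def
        by (intro mean_harmonic_add mean_harmonic_mult mean_harmonic_const hn hm \<Omega>)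
      show "compact P" "P \<subseteq> E" using polar_superlevel(1)[OF \<eta>] by (auto simp: P_def)
      show "\<exists>e>0. trunc_energy \<sigma> \<sigma> e < A" if "\<sigma> \<in> borel_probabilities_on P" for \<sigma> A
        using polar_superlevel(2)[OF \<eta>] that by (simp add: P_def)
      show "u w < \<infinity>" if "w \<in> \<Omega>" for w using su that unfolding subharmonic_on_def by blast
      show "\<forall>\<^sub>F w in at x within \<Omega>. u w < c" if "x \<in> \<Omega>" "u x < c" for x c
        using su that unfolding subharmonic_on_def by blast
      show "submean_at u w" if "w \<in> \<Omega>" for w using subharmonic_on_submean[OF su that] .
      show "\<forall>\<^sub>F w in at x within \<Omega>. u w \<le> ereal (H w + \<delta>)" if x: "x \<in> frontier \<Omega>" "x \<notin> P" "0 < \<delta>" for x \<delta>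
      proof -
        have xE: "x \<in> E" using x \<Omega> by auto
        then have "log_pot \<mu> x < V + \<eta>" using x by (auto simp: P_def)
        then have "b x < V + \<eta> - \<phi> x" using \<phi>_le[OF xE] by (simp add: b_def)
        from b_usc[OF this] have "\<forall>\<^sub>F w in at x within \<Omega>. b w < V + \<eta> - \<phi> x"
          unfolding eventually_at_filter by (auto elim: eventually_mono)
        with ev_u[OF x(1,3)] show ?thesis
        proof eventually_elim
          case (elim w)
          have "ereal (\<phi> x + \<delta>) \<le> ereal (H w + \<delta>)" using elim(2) H_ge[of w] by simp
          with elim(1) show ?case by (metis less_imp_le order_trans)
        qed
      qed
      show "\<forall>\<^sub>F w in at x within \<Omega>. u w \<le> ereal (H w + (C0 + 1 - V + L))" if x: "x \<in> frontier \<Omega>" for x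
      proof -
        have xE: "x \<in> E" using x \<Omega> by auto
        then have "cmod x < R + 1" using R(2)[of x] by auto
        then have "\<forall>\<^sub>F w in nhds x. cmod w < R + 1"
          by (intro order_tendstoD(2)[of _ "cmod x"] tendsto_intros filterlim_ident)
        then have "\<forall>\<^sub>F w in at x within \<Omega>. cmod w < R + 1"
          unfolding eventually_at_filter by (auto elim: eventually_mono)
        with ev_u[OF x zero_less_one] show ?thesis
        proof eventually_elim
          case (elim w)
          have "\<phi> x \<le> C0" using C0 xE by (auto simp: abs_le_iff)
          moreover have "b w \<le> L" using elim(2) by (intro b_near) simp
          ultimately have "\<phi> x + 1 \<le> H w + (C0 + 1 - V + L)" using H_ge[of w] \<eta> by linarith
          then have "ereal (\<phi> x + 1) \<le> ereal (H w + (C0 + 1 - V + L))" by simp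
          with elim(1) show ?case by (metis less_imp_le order_trans)
        qed
      qed
      \<comment> \<open>At infinity the two potentials in \<open>H\<close> differ by a bounded
        amount, so \<open>H\<close> is bounded below while \<open>u\<close> is bounded above by
        \<open>a\<close>.\<close>
      show "u w \<le> ereal (H w + (a + m * (ln 2 - V)))" if w: "w \<in> \<Omega>" "max Ru (3 * R) \<le> cmod w" for w
      proof -
        have "log_pot \<mu> w \<le> ln (cmod w + R)" using R w by (intro log_pot_growth(2)[OF bp R(2)]) auto
        also have "\<dots> \<le> ln (2 * (cmod w - R))" using R w by (intro ln_mono) auto
        also have "\<dots> = ln 2 + ln (cmod w - R)" using R w by (intro ln_mult_pos) auto
        also have "ln (cmod w - R) \<le> log_pot \<nu> w" using R w by (intro log_pot_growth(1)[OF \<nu>]) auto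
        finally have "0 \<le> m * (log_pot \<nu> w + ln 2 - log_pot \<mu> w)" using m by simp
        then have "a \<le> H w + (a + m * (ln 2 - V))" using \<eta> by (simp add: H_def algebra_simps)
        then have "ereal a \<le> ereal (H w + (a + m * (ln 2 - V)))" by simp
        with a[OF w(1)] w(2) show ?thesis by (metis max.bounded_iff order_trans)
      qed
    qed (use \<Omega> z in auto)
    then show ?thesis by (simp add: H_def algebra_simps)
  qed
  \<comment> \<open>Three errors of size \<open>\<eta>\<close> add up to
    \<open>m * \<epsilon>\<close>: from the limit of the Perron solution, from the continuity of
    \<open>g\<close>, and from the majorant in \<open>perron\<close>.\<close>
  define \<eta> where "\<eta> = m * \<epsilon> / 3"
  have \<eta>: "\<eta> > 0" using m \<epsilon> by (simp add: \<eta>_def)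
  have "(perron_solution \<Omega> \<phi> \<longlongrightarrow> ereal (\<phi> \<zeta>)) (at \<zeta> within \<Omega>)"
    using reg \<phi>_cont unfolding dirichlet_regular_point_def \<Omega>_def by blast
  then have e1: "\<forall>\<^sub>F z in at \<zeta> within \<Omega>. ereal (\<phi> \<zeta> - \<eta>) < perron_solution \<Omega> \<phi> z"
    using \<eta> by (intro order_tendstoD(1)) auto
  have "(g \<longlongrightarrow> g \<zeta>) (at \<zeta> within \<Omega>)" using g_cont[of UNIV]
    by (metis UNIV_I continuous_on_def tendsto_within_subset top_greatest)
  then have e2: "\<forall>\<^sub>F z in at \<zeta> within \<Omega>. g z < g \<zeta> + \<eta>" using \<eta> by (intro order_tendstoD(2)) auto
  have e3: "\<forall>\<^sub>F z in at \<zeta> within \<Omega>. z \<in> \<Omega> \<and> z \<in> ball \<zeta> (\<rho> / 2)"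
    unfolding eventually_at using \<rho> by (intro exI[of _ "\<rho> / 2"]) (auto simp: dist_commute)
  from e1 e2 e3 have "\<forall>\<^sub>F z in at \<zeta> within \<Omega>. log_pot \<mu> z \<le> V + \<epsilon>"
  proof eventually_elim
    case (elim z)
    have "perron_solution \<Omega> \<phi> z \<le> ereal (m * (log_pot \<nu> z - (log_pot \<mu> z - V)) + \<eta>)"
      unfolding perron_solution_def
    proof (rule Sup_least)
      fix y assume "y \<in> {u z |u c. subharmonic_on_with_infinity \<Omega> u c \<and>
        (\<forall>x\<in>frontier \<Omega>. Limsup (at x within \<Omega>) u \<le> ereal (\<phi> x))}"
      then show "y \<le> ereal (m * (log_pot \<nu> z - (log_pot \<mu> z - V)) + \<eta>)" using perron \<eta> elim(3) by blast
    qed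
    with elim(1) have "ereal (\<phi> \<zeta> - \<eta>) < ereal (m * (log_pot \<nu> z - (log_pot \<mu> z - V)) + \<eta>)" by (rule less_le_trans)
    then have "\<phi> \<zeta> - \<eta> < m * log_pot \<nu> z - m * (log_pot \<mu> z - V) + \<eta>" by (simp add: right_diff_distrib)
    moreover have "g z = m * log_pot \<nu> z" using elim(3) g_eq by blast
    moreover have "g \<zeta> = \<phi> \<zeta>" using g_eq[of \<zeta>] \<rho> \<phi>\<zeta> by simp
    ultimately have "m * (log_pot \<mu> z - V) \<le> m * \<epsilon>" using elim(2) by (simp add: \<eta>_def)
    then show ?case using m by simp
  qed
  then show ?thesis by (simp add: \<Omega>_def)
qed

end

theorem theorem2p1:
  fixes E :: "complex set"
  assumes "compact E" and "log_capacity E > 0"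
  shows "(\<exists>u. is_arg_max
              (\<lambda>u. exp (LINT z:{z. 1 \<le> cmod (z - u)}|equilibrium_measure E. ln (cmod (z - u))))
              (\<lambda>u. u \<in> frontier E) u \<and>
            best_factor_constant E =
              exp (LINT z:{z. 1 \<le> cmod (z - u)}|equilibrium_measure E. ln (cmod (z - u)))
                / log_capacity E) \<and>
         (dirichlet_regular E \<longrightarrow>
            (\<exists>u. is_arg_max
                (\<lambda>u. exp (- (LINT z:{z. cmod (z - u) \<le> 1}|equilibrium_measure E. ln (cmod (z - u)))))
                (\<lambda>u. u \<in> frontier E) u \<and>
              best_factor_constant E =
                exp (- (LINT z:{z. cmod (z - u) \<le> 1}|equilibrium_measure E. ln (cmod (z - u))))))"
proof -
  define \<mu> where "\<mu> = equilibrium_measure E"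
  obtain V where "equilibrium E V \<mu>" and cap: "log_capacity E = exp V"
    using equilibrium_measureI[OF assms] by (auto simp: \<mu>_def)
  then interpret equilibrium E V \<mu> by simp
  obtain u where u: "u \<in> frontier E" "\<And>v. v \<in> frontier E \<Longrightarrow> trunc_pot \<mu> 1 v \<le> trunc_pot \<mu> 1 u"
    and best: "best_factor_constant E = exp (trunc_pot \<mu> 1 u - V)"
    using best_factor_constant_eq by blast
  show ?thesis
    unfolding \<mu>_def[symmetric] log_integral_outer log_integral_inner cap
  proof (intro conjI impI exI[of _ u])
    show "is_arg_max (\<lambda>u. exp (trunc_pot \<mu> 1 u)) (\<lambda>u. u \<in> frontier E) u"
      using u by (auto simp: is_arg_max_def not_less)
    show "best_factor_constant E = exp (trunc_pot \<mu> 1 u) / exp V" using best by (simp add: exp_diff)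
    assume reg: "dirichlet_regular E"
    have U: "log_pot \<mu> x = V" if "x \<in> frontier E" for x
      by (rule log_pot_boundary[OF regular_limit that]) (use reg in \<open>auto simp: dirichlet_regular_def\<close>)
    show "is_arg_max (\<lambda>u. exp (- (log_pot \<mu> u - trunc_pot \<mu> 1 u))) (\<lambda>u. u \<in> frontier E) u"
      using u U by (auto simp: is_arg_max_def not_less)
    show "best_factor_constant E = exp (- (log_pot \<mu> u - trunc_pot \<mu> 1 u))" using best U[OF u(1)] by simp
  qed
qed

end
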